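(* Let $A$ be an abelian group for which there is a set $\pi$ of primes such that for every $n\in\mathbb{N}$ the subgroup $\{a\in A: a^n=1\}$ is cyclic of order $n_\pi$ (the $\pi$-part of $n$). Let $k$ be a commutative ring, let $G$ be a finite group, and let $(K,\kappa)\in\mathcal{M}_G^G$. Then $(K,\kappa)$ is reduced in $G$ (i.e. $e_{(K,\kappa)}\notin I_G$) if and only if $K$ is a cyclic $\pi$-subgroup contained in $Z(G)\cap G'$ and $\kappa$ is faithful (injective).
   Context: $A$ is written multiplicatively; $G'$ is the commutator subgroup and $Z(G)$ the center. For a finite group $K$, $K^*=\mathrm{Hom}(K,A)$. $\mathcal{M}_G$ is the set of pairs $(K,\kappa)$ with $K\le G$, $\kappa\in K^*$; $\mathcal{M}_G^G$ is the subset of pairs with $K\trianglelefteq G$ and $\kappa(gxg^{-1})=\kappa(x)$ for all $g\in G,x\in K$. An $A$-fibered $(G,H)$-biset is a left $A\times G\times H$-set, free as an $A$-set with finitely many $A$-orbits. For $(U,\phi)\in\mathcal{M}_{G\times H}$, $\left(\frac{G\times H}{U,\phi}\right)=(A\times G\times H)/U_\phi$ with $U_\phi=\{(\phi(u)^{-1},u):u\in U\}$; these are up to isomorphism the transitive ones, two being isomorphic iff the pairs are $G\times H$-conjugate. For an $A$-fibered $(G,H)$-biset $X$ and an $A$-fibered $(H,I)$-biset $Y$, let $A\times H$ act on $X\times Y$ by $(a,h)\cdot(x,y)=((a^{-1},1,h)x,(a,h,1)y)$; the orbit set is an $A\times G\times I$-set via $(a,g,i)[x,y]=[(a,g,1)x,(1,1,i)y]$,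 and $X\otimes_{AH}Y$ is its subset of elements with trivial stabilizer in $A$. $B_k^A(G,H)=k\otimes B^A(G,H)$, where $B^A(G,H)$ is the Grothendieck group of isomorphism classes of $A$-fibered $(G,H)$-bisets under disjoint union (with basis the classes $\left[\frac{G\times H}{U,\phi}\right]$); the tensor product induces bilinear compositions $B_k^A(G,H)\times B_k^A(H,I)\to B_k^A(G,I)$. $I_G=\sum_{|H|<|G|}B_k^A(G,H)\cdot B_k^A(H,G)\subseteq B_k^A(G,G)$, the sum over finite groups $H$ with $|H|<|G|$. For $(K,\kappa)\in\mathcal{M}_G^G$, $e_{(K,\kappa)}=\left[\frac{G\times G}{\Delta_K(G),\phi_\kappa}\right]$ with $\Delta_K(G)=\{(g_1,g_2)\in G\times G:g_1K=g_2K\}$ and $\phi_\kappa(g_1,g_2)=\kappa(g_1g_2^{-1})$. *)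

theory Defs
  imports Complex_Main "HOL-Algebra.Elementary_Groups" "HOL-Algebra.Generated_Groups" "HOL-Algebra.Group_Action"
    "HOL-Algebra.Left_Coset" "HOL-Library.Poly_Mapping" "HOL-Computational_Algebra.Primes"
begin

section \<open>Groups\<close>

definition torsion :: "'a monoid \<Rightarrow> nat \<Rightarrow> 'a set" where
  "torsion A n = {a \<in> carrier A. a [^]\<^bsub>A\<^esub> n = \<one>\<^bsub>A\<^esub>}"

definition pi_part :: "nat set \<Rightarrow> nat \<Rightarrow> nat" where
  "pi_part \<pi> n = (\<Prod>p\<in>prime_factors n \<inter> \<pi>. p ^ multiplicity p n)"

definition pi_subgroup :: "nat set \<Rightarrow> 'g set \<Rightarrow> 'g monoid \<Rightarrow> bool" where
  "pi_subgroup \<pi> K G \<longleftrightarrow> subgroup K G \<and> finite K \<and> prime_factors (card K) \<subseteq> \<pi>"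

definition group_center :: "'g monoid \<Rightarrow> 'g set" where
  "group_center G = {z \<in> carrier G. \<forall>g\<in>carrier G. g \<otimes>\<^bsub>G\<^esub> z = z \<otimes>\<^bsub>G\<^esub> g}"

text \<open>The sets \<open>\<M>\<^sub>G\<close> and \<open>\<M>\<^sub>G\<^sup>G\<close>. A homomorphism \<open>\<kappa>\<close> on \<open>K\<close> is a HOL function on the whole
  type whose values outside \<open>K\<close> are arbitrary; nothing below depends on those values.\<close>

definition char_pairs :: "'a monoid \<Rightarrow> 'g monoid \<Rightarrow> ('g set \<times> ('g \<Rightarrow> 'a)) set" where
  "char_pairs A G = {(K, \<kappa>). subgroup K G \<and> \<kappa> \<in> hom (G\<lparr>carrier := K\<rparr>) A}"

definition invariant_char_pairs :: "'a monoid \<Rightarrow> 'g monoid \<Rightarrow> ('g set \<times> ('g \<Rightarrow> 'a)) set" where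
  "invariant_char_pairs A G = {(K, \<kappa>) \<in> char_pairs A G. normal K G \<and>
     (\<forall>g\<in>carrier G. \<forall>x\<in>K. \<kappa> (g \<otimes>\<^bsub>G\<^esub> x \<otimes>\<^bsub>G\<^esub> inv\<^bsub>G\<^esub> g) = \<kappa> x)}"

section \<open>Fibered bisets\<close>

text \<open>A set with an action of \<open>A \<times> G \<times> H\<close>: carrier and action map.\<close>

type_synonym ('x, 'a, 'g, 'h) actset = "'x set \<times> ('a \<times> 'g \<times> 'h \<Rightarrow> 'x \<Rightarrow> 'x)"

definition A_action ::
  "'g monoid \<Rightarrow> 'h monoid \<Rightarrow> ('a \<times> 'g \<times> 'h \<Rightarrow> 'x \<Rightarrow> 'x) \<Rightarrow> 'a \<Rightarrow> 'x \<Rightarrow> 'x" where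
  "A_action G H \<alpha> = (\<lambda>a. \<alpha> (a, \<one>\<^bsub>G\<^esub>, \<one>\<^bsub>H\<^esub>))"

definition fibered_biset ::
  "'a monoid \<Rightarrow> 'g monoid \<Rightarrow> 'h monoid \<Rightarrow> ('x, 'a, 'g, 'h) actset \<Rightarrow> bool" where
  "fibered_biset A G H = (\<lambda>(X, \<alpha>).
     group_action (A \<times>\<times> G \<times>\<times> H) X \<alpha> \<and>
     (\<forall>x\<in>X. stabilizer A (A_action G H \<alpha>) x = {\<one>\<^bsub>A\<^esub>}) \<and>
     finite (orbits A X (A_action G H \<alpha>)))"

definition fb_iso ::
  "'a monoid \<Rightarrow> 'g monoid \<Rightarrow> 'h monoid \<Rightarrow>
   ('x, 'a, 'g, 'h) actset \<Rightarrow> ('y, 'a, 'g, 'h) actset \<Rightarrow> bool" where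
  "fb_iso A G H = (\<lambda>(X, \<alpha>) (Y, \<beta>).
     \<exists>f. bij_betw f X Y \<and> (\<forall>u\<in>carrier (A \<times>\<times> G \<times>\<times> H). \<forall>x\<in>X. f (\<alpha> u x) = \<beta> u (f x)))"

definition fb_disjoint_union ::
  "('x, 'a, 'g, 'h) actset \<Rightarrow> ('y, 'a, 'g, 'h) actset \<Rightarrow> ('x + 'y, 'a, 'g, 'h) actset" where
  "fb_disjoint_union = (\<lambda>(X, \<alpha>) (Y, \<beta>).
     (Sum_Type.Plus X Y, \<lambda>u. restrict (map_sum (\<alpha> u) (\<beta> u)) (Sum_Type.Plus X Y)))"

definition twisted_subgroup ::
  "'a monoid \<Rightarrow> ('g \<times> 'h) set \<Rightarrow> ('g \<times> 'h \<Rightarrow> 'a) \<Rightarrow> ('a \<times> 'g \<times> 'h) set" where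
  "twisted_subgroup A U \<phi> = {(inv\<^bsub>A\<^esub> (\<phi> u), u) | u. u \<in> U}"

definition fb_transitive ::
  "'a monoid \<Rightarrow> 'g monoid \<Rightarrow> 'h monoid \<Rightarrow> ('g \<times> 'h) set \<Rightarrow> ('g \<times> 'h \<Rightarrow> 'a) \<Rightarrow>
   (('a \<times> 'g \<times> 'h) set, 'a, 'g, 'h) actset" where
  "fb_transitive A G H U \<phi> =
     (let P = A \<times>\<times> G \<times>\<times> H; C = lcosets\<^bsub>P\<^esub> (twisted_subgroup A U \<phi>)
      in (C, \<lambda>u. \<lambda>c\<in>C. u <#\<^bsub>P\<^esub> c))"

text \<open>The action of \<open>A \<times> H\<close> on \<open>X \<times> Y\<close> whose orbits \<open>[x, y]\<close> form the tensor product. In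
  \<open>fb_tensor\<close>, the element \<open>(a, g, i)\<close> sends an orbit to its image under
  \<open>(x, y) \<mapsto> ((a, g, 1) x, (1, 1, i) y)\<close>.\<close>

definition balanced_action ::
  "'a monoid \<Rightarrow> 'g monoid \<Rightarrow> 'i monoid \<Rightarrow>
   ('a \<times> 'g \<times> 'h \<Rightarrow> 'x \<Rightarrow> 'x) \<Rightarrow> ('a \<times> 'h \<times> 'i \<Rightarrow> 'y \<Rightarrow> 'y) \<Rightarrow> 'a \<times> 'h \<Rightarrow> 'x \<times> 'y \<Rightarrow> 'x \<times> 'y" where
  "balanced_action A G I \<alpha> \<beta> = (\<lambda>(a, h) (x, y).
     (\<alpha> (inv\<^bsub>A\<^esub> a, \<one>\<^bsub>G\<^esub>, h) x, \<beta> (a, h, \<one>\<^bsub>I\<^esub>) y))"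

definition fb_tensor ::
  "'a monoid \<Rightarrow> 'g monoid \<Rightarrow> 'h monoid \<Rightarrow> 'i monoid \<Rightarrow>
   ('x, 'a, 'g, 'h) actset \<Rightarrow> ('y, 'a, 'h, 'i) actset \<Rightarrow> (('x \<times> 'y) set, 'a, 'g, 'i) actset" where
  "fb_tensor A G H I = (\<lambda>(X, \<alpha>) (Y, \<beta>).
     (let \<gamma> = (\<lambda>(a, g, i) \<omega>.
            (\<lambda>(x, y). (\<alpha> (a, g, \<one>\<^bsub>H\<^esub>) x, \<beta> (\<one>\<^bsub>A\<^esub>, \<one>\<^bsub>H\<^esub>, i) y)) ` \<omega>);
          T = {\<omega> \<in> orbits (A \<times>\<times> H) (X \<times> Y) (balanced_action A G I \<alpha> \<beta>).
                 stabilizer A (A_action G I \<gamma>) \<omega> = {\<one>\<^bsub>A\<^esub>}}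
      in (T, \<lambda>u. restrict (\<gamma> u) T)))"

section \<open>The Grothendieck group with coefficients\<close>

text \<open>A fibered biset is, as an \<open>A\<close>-set, isomorphic to \<open>A \<times> {0..<n}\<close>. Hence every isomorphism
  class has members whose carrier is a set of elements of type \<open>'a \<times> nat\<close>, and an isomorphism
  class is represented by the (nonempty) set of all such members.\<close>

type_synonym ('a, 'g, 'h) fb_class = "('a \<times> nat, 'a, 'g, 'h) actset set"

definition fb_class_of ::
  "'a monoid \<Rightarrow> 'g monoid \<Rightarrow> 'h monoid \<Rightarrow> ('x, 'a, 'g, 'h) actset \<Rightarrow> ('a, 'g, 'h) fb_class" where
  "fb_class_of A G H X = {Y. fibered_biset A G H Y \<and> fb_iso A G H X Y}"

definition fb_classes ::
  "'a monoid \<Rightarrow> 'g monoid \<Rightarrow> 'h monoid \<Rightarrow> ('a, 'g, 'h) fb_class set" where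
  "fb_classes A G H = {fb_class_of A G H X | X :: ('a \<times> nat, 'a, 'g, 'h) actset. fibered_biset A G H X}"

definition class_tensor ::
  "'a monoid \<Rightarrow> 'g monoid \<Rightarrow> 'h monoid \<Rightarrow> 'i monoid \<Rightarrow>
   ('a, 'g, 'h) fb_class \<Rightarrow> ('a, 'h, 'i) fb_class \<Rightarrow> ('a, 'g, 'i) fb_class" where
  "class_tensor A G H I c d = (\<Union>X\<in>c. \<Union>Y\<in>d. fb_class_of A G I (fb_tensor A G H I X Y))"

text \<open>\<open>k \<otimes> B\<^sup>A(G, H)\<close> is presented as the free \<open>k\<close>-module on the isomorphism classes modulo the
  submodule spanned by all \<open>[X \<squnion> Y] - [X] - [Y]\<close>; its elements are cosets of that submodule.
  The type class \<open>comm_ring_1\<close> includes \<open>0 \<noteq> 1\<close> in \<open>k\<close>.\<close>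

definition pm_scale :: "'k::comm_ring_1 \<Rightarrow> ('c \<Rightarrow>\<^sub>0 'k) \<Rightarrow> ('c \<Rightarrow>\<^sub>0 'k)" where
  "pm_scale r p = Poly_Mapping.map ((*) r) p"

lemma lookup_pm_scale: "Poly_Mapping.lookup (pm_scale r p) c = r * Poly_Mapping.lookup p c"
  by (simp add: pm_scale_def Poly_Mapping.map.rep_eq when_def)

lemma module_pm_scale: "Modules.module (pm_scale :: 'k::comm_ring_1 \<Rightarrow> ('c \<Rightarrow>\<^sub>0 'k) \<Rightarrow> _)"
  by (rule Modules.module.intro)
    (auto intro!: poly_mapping_eqI simp: lookup_pm_scale lookup_add algebra_simps)

definition fb_free ::
  "'a monoid \<Rightarrow> 'g monoid \<Rightarrow> 'h monoid \<Rightarrow> (('a, 'g, 'h) fb_class \<Rightarrow>\<^sub>0 'k::comm_ring_1) set" where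
  "fb_free A G H = {p. Poly_Mapping.keys p \<subseteq> fb_classes A G H}"

definition fb_gen ::
  "'a monoid \<Rightarrow> 'g monoid \<Rightarrow> 'h monoid \<Rightarrow> ('x, 'a, 'g, 'h) actset \<Rightarrow>
   (('a, 'g, 'h) fb_class \<Rightarrow>\<^sub>0 'k::comm_ring_1)" where
  "fb_gen A G H X = Poly_Mapping.single (fb_class_of A G H X) 1"

definition fb_relations ::
  "'a monoid \<Rightarrow> 'g monoid \<Rightarrow> 'h monoid \<Rightarrow> (('a, 'g, 'h) fb_class \<Rightarrow>\<^sub>0 'k::comm_ring_1) set" where
  "fb_relations A G H = Modules.module.span pm_scale
     {fb_gen A G H (fb_disjoint_union X Y) - fb_gen A G H X - fb_gen A G H Y 
      | (X :: ('a \<times> nat, 'a, 'g, 'h) actset) (Y :: ('a \<times> nat, 'a, 'g, 'h) actset).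
      fibered_biset A G H X \<and> fibered_biset A G H Y}"

definition fb_coset ::
  "'a monoid \<Rightarrow> 'g monoid \<Rightarrow> 'h monoid \<Rightarrow> (('a, 'g, 'h) fb_class \<Rightarrow>\<^sub>0 'k::comm_ring_1) \<Rightarrow>
   (('a, 'g, 'h) fb_class \<Rightarrow>\<^sub>0 'k) set" where
  "fb_coset A G H p = (\<lambda>r. p + r) ` fb_relations A G H"

definition fb_module ::
  "'a monoid \<Rightarrow> 'g monoid \<Rightarrow> 'h monoid \<Rightarrow> (('a, 'g, 'h) fb_class \<Rightarrow>\<^sub>0 'k::comm_ring_1) set set" where
  "fb_module A G H = fb_coset A G H ` fb_free A G H"

definition fb_elem ::
  "'a monoid \<Rightarrow> 'g monoid \<Rightarrow> 'h monoid \<Rightarrow> ('x, 'a, 'g, 'h) actset \<Rightarrow>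
   (('a, 'g, 'h) fb_class \<Rightarrow>\<^sub>0 'k::comm_ring_1) set" where
  "fb_elem A G H X = fb_coset A G H (fb_gen A G H X)"

definition fb_add :: "('c \<Rightarrow>\<^sub>0 'k::comm_ring_1) set \<Rightarrow> ('c \<Rightarrow>\<^sub>0 'k) set \<Rightarrow> ('c \<Rightarrow>\<^sub>0 'k) set" where
  "fb_add P Q = {p + q | p q. p \<in> P \<and> q \<in> Q}"

text \<open>The bilinear extension of the tensor product of classes, first on the free modules and then on
  the quotients.\<close>

definition free_comp ::
  "'a monoid \<Rightarrow> 'g monoid \<Rightarrow> 'h monoid \<Rightarrow> 'i monoid \<Rightarrow>
   (('a, 'g, 'h) fb_class \<Rightarrow>\<^sub>0 'k::comm_ring_1) \<Rightarrow> (('a, 'h, 'i) fb_class \<Rightarrow>\<^sub>0 'k) \<Rightarrow>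
   (('a, 'g, 'i) fb_class \<Rightarrow>\<^sub>0 'k)" where
  "free_comp A G H I p q = (\<Sum>c\<in>Poly_Mapping.keys p. \<Sum>d\<in>Poly_Mapping.keys q.
     Poly_Mapping.single (class_tensor A G H I c d) (Poly_Mapping.lookup p c * Poly_Mapping.lookup q d))"

definition fb_comp ::
  "'a monoid \<Rightarrow> 'g monoid \<Rightarrow> 'h monoid \<Rightarrow> 'i monoid \<Rightarrow>
   (('a, 'g, 'h) fb_class \<Rightarrow>\<^sub>0 'k::comm_ring_1) set \<Rightarrow> (('a, 'h, 'i) fb_class \<Rightarrow>\<^sub>0 'k) set \<Rightarrow>
   (('a, 'g, 'i) fb_class \<Rightarrow>\<^sub>0 'k) set" where
  "fb_comp A G H I P Q =
     (\<Union>p\<in>P \<inter> fb_free A G H. \<Union>q\<in>Q \<inter> fb_free A H I. fb_coset A G I (free_comp A G H I p q))"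

section \<open>The ideal of lower-order factorizations, and reduced pairs\<close>

text \<open>Every finite group is isomorphic to one whose elements are natural numbers, so it suffices to
  let \<open>H\<close> range over those. The additive span of the products is closed under scalars, since
  \<open>r (P \<cdot> Q) = (r P) \<cdot> Q\<close>.\<close>

inductive_set fb_ideal ::
  "'a monoid \<Rightarrow> 'g monoid \<Rightarrow> (('a, 'g, 'g) fb_class \<Rightarrow>\<^sub>0 'k::comm_ring_1) set set"
  for A :: "'a monoid" and G :: "'g monoid" where
  zero: "fb_coset A G G 0 \<in> fb_ideal A G"
| prod: "\<lbrakk>group (H :: nat monoid); finite (carrier H); order H < order G;
           P \<in> fb_module A G H; Q \<in> fb_module A H G\<rbrakk>
         \<Longrightarrow> fb_comp A G H G P Q \<in> fb_ideal A G"
| add: "\<lbrakk>P \<in> fb_ideal A G; Q \<in> fb_ideal A G\<rbrakk> \<Longrightarrow> fb_add P Q \<in> fb_ideal A G"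

definition Delta :: "'g monoid \<Rightarrow> 'g set \<Rightarrow> ('g \<times> 'g) set" where
  "Delta G K = {(g1, g2) \<in> carrier G \<times> carrier G. g1 <#\<^bsub>G\<^esub> K = g2 <#\<^bsub>G\<^esub> K}"

definition phi_char :: "'g monoid \<Rightarrow> ('g \<Rightarrow> 'a) \<Rightarrow> 'g \<times> 'g \<Rightarrow> 'a" where
  "phi_char G \<kappa> = (\<lambda>(g1, g2). \<kappa> (g1 \<otimes>\<^bsub>G\<^esub> inv\<^bsub>G\<^esub> g2))"

definition e_elem ::
  "'a monoid \<Rightarrow> 'g monoid \<Rightarrow> 'g set \<Rightarrow> ('g \<Rightarrow> 'a) \<Rightarrow>
   (('a, 'g, 'g) fb_class \<Rightarrow>\<^sub>0 'k::comm_ring_1) set" where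
  "e_elem A G K \<kappa> = fb_elem A G G (fb_transitive A G G (Delta G K) (phi_char G \<kappa>))"

definition reduced_pair ::
  "'k::comm_ring_1 itself \<Rightarrow> 'a monoid \<Rightarrow> 'g monoid \<Rightarrow> 'g set \<Rightarrow> ('g \<Rightarrow> 'a) \<Rightarrow> bool" where
  "reduced_pair k A G K \<kappa> \<longleftrightarrow>
     (e_elem A G K \<kappa> :: (('a, 'g, 'g) fb_class \<Rightarrow>\<^sub>0 'k) set) \<notin> fb_ideal A G"

end

theory Submission
  imports Defs "HOL-Algebra.Zassenhaus" "HOL-Algebra.Weak_Morphisms" "HOL-Algebra.Multiplicative_Group"
begin

text \<open>
  Let \<open>B = \<kappa>(K \<inter> G')\<close>. The proof shows that \<open>(K, \<kappa>)\<close> is reduced exactly when \<open>|B| = |K|\<close>, that is, when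
  \<open>K \<subseteq> G'\<close> and \<open>\<kappa>\<close> is injective. The other conditions on \<open>K\<close> then come for free (\<open>K_central\<close>,
  \<open>K_cyclic_pi\<close>): an invariant injective character lives on central elements, and \<open>\<kappa>(K)\<close> lies in
  \<open>{a. a^n = 1}\<close> for \<open>n = |K|\<close>, a cyclic group of order \<open>n\<^sub>\<pi> \<le> n\<close>, so that \<open>\<kappa>(K)\<close> is all of it and \<open>n\<^sub>\<pi> = n\<close>.

  \<^bold>\<open>Pairs with \<open>K \<subseteq> G'\<close> and injective \<open>\<kappa>\<close> are reduced.\<close>
  For a subgroup \<open>S\<close> of \<open>A \<times> G \<times> G\<close>, the number of orbits of a fibered biset that contain a point with
  stabilizer exactly \<open>S\<close> does not change under isomorphism and is additive on disjoint unions. Hence it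
  defines a linear functional on the Grothendieck group (\<open>mark_functional_relations\<close>). For the point
  stabilizer \<open>S\<close> of the biset of \<open>(K, \<kappa>)\<close> the functional is \<open>1\<close> on \<open>e\<close>, so it suffices that it vanishes on
  \<open>I\<^sub>G\<close>. Otherwise a tensor product over some \<open>H\<close> with \<open>|H| < |G|\<close> has a point \<open>[x, y]\<close> with stabilizer \<open>S\<close>.
  Let \<open>U \<le> A \<times> G \<times> H\<close> be the stabilizer of \<open>x\<close>. It projects onto \<open>G\<close>, and its elements over \<open>1 \<in> H\<close> have the form
  \<open>(\<kappa>(g)\<^sup>-\<^sup>1, g, 1)\<close> with \<open>g \<in> K\<close>. Since \<open>A\<close> is abelian, commutators in \<open>U\<close> have trivial \<open>A\<close>-component, so every
  element of \<open>K \<subseteq> G'\<close> lifts to \<open>U\<close> with \<open>A\<close>-component \<open>1\<close>. Together with arbitrary lifts of coset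
  representatives of \<open>K\<close> this gives an injection of \<open>G\<close> into \<open>H\<close> (\<open>order_le_of_stabilizer\<close>), a contradiction.

  \<^bold>\<open>If \<open>|B| < |K|\<close>, then \<open>e\<close> factors through a smaller group.\<close>
  The character \<open>\<kappa>\<close> becomes trivial on \<open>K \<inter> G'\<close> modulo \<open>B\<close>. By the hypothesis on \<open>A\<close> its torsion elements have
  torsion \<open>m\<close>-th roots for all \<open>m > 0\<close> (\<open>torsion_root\<close>), so \<open>\<kappa>\<close> extends to a homomorphism \<open>G \<rightarrow> A/B\<close>, trivial on
  \<open>G'\<close>. Its graph is a subgroup \<open>E \<le> A \<times> G\<close> that projects onto \<open>G\<close> with kernel inside \<open>B\<close> and contains
  \<open>D = {(\<kappa>(x), x). x \<in> K}\<close> (\<open>ex_extension\<close>). The group \<open>H = E/D\<close> has order at most \<open>|B| |G| / |K| < |G|\<close>, and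
  with the projection \<open>q : E \<rightarrow> H\<close> the subgroups
  \<open>U = {(a\<^sup>-\<^sup>1, g, q(a, g))}\<close> and \<open>V = {(a, q(a, g), g)}\<close> define transitive bisets whose tensor product is the
  biset of \<open>(K, \<kappa>)\<close> (\<open>e_elem_in_ideal\<close>).

  The second part uses that composition on the Grothendieck groups is induced by tensor products of
  representatives (\<open>fb_comp_elem\<close>), which rests on one property of the tensor product: it turns a pair of
  equivariant injections into an equivariant injection with the expected image (\<open>tensor_embedding\<close>).
\<close>

section \<open>Fibered bisets and their embeddings\<close>

lemma group_actionI:
  assumes P: "group P"
    and closed: "\<And>u x. u \<in> carrier P \<Longrightarrow> x \<in> X \<Longrightarrow> \<alpha> u x \<in> X"
    and one: "\<And>x. x \<in> X \<Longrightarrow> \<alpha> \<one>\<^bsub>P\<^esub> x = x"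
    and mult: "\<And>u v x. u \<in> carrier P \<Longrightarrow> v \<in> carrier P \<Longrightarrow> x \<in> X \<Longrightarrow> \<alpha> (u \<otimes>\<^bsub>P\<^esub> v) x = \<alpha> u (\<alpha> v x)"
    and ext: "\<And>u. u \<in> carrier P \<Longrightarrow> \<alpha> u \<in> extensional X"
  shows "group_action P X \<alpha>"
proof -
  interpret P: group P by (rule P)
  have bij: "\<alpha> u \<in> Bij X" if u: "u \<in> carrier P" for u
  proof -
    have "\<alpha> (inv\<^bsub>P\<^esub> u) (\<alpha> u x) = x" "\<alpha> u (\<alpha> (inv\<^bsub>P\<^esub> u) x) = x" if "x \<in> X" for x
      using that u one by (simp_all flip: mult)
    then have "bij_betw (\<alpha> u) X X"
      using u by (intro bij_betw_byWitness[where f' = "\<alpha> (inv\<^bsub>P\<^esub> u)"]) (auto intro: closed)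
    then show ?thesis using ext[OF u] by (simp add: Bij_def)
  qed
  have "\<alpha> \<in> hom P (BijGroup X)"
    using bij ext by (auto simp: hom_def BijGroup_def compose_def restrict_def mult extensional_def)
  then show ?thesis
    using P group_BijGroup by (auto simp: group_action_def group_hom_def group_hom_axioms_def)
qed

locale fiber_groups = A: comm_group A + G: group G + H: group H
  for A :: "'a monoid" and G :: "'g monoid" and H :: "'h monoid"
begin

lemma group_prod: "group (A \<times>\<times> G \<times>\<times> H)"
  by (intro DirProd_group A.is_group G.is_group H.is_group)

lemma fibered_bisetI:
  assumes closed: "\<And>a g h x. \<lbrakk>a \<in> carrier A; g \<in> carrier G; h \<in> carrier H; x \<in> X\<rbrakk> \<Longrightarrow> \<alpha> (a, g, h) x \<in> X"
    and one: "\<And>x. x \<in> X \<Longrightarrow> \<alpha> (\<one>\<^bsub>A\<^esub>, \<one>\<^bsub>G\<^esub>, \<one>\<^bsub>H\<^esub>) x = x"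
    and mult: "\<And>a g h b g' h' x. \<lbrakk>a \<in> carrier A; g \<in> carrier G; h \<in> carrier H; b \<in> carrier A; g' \<in> carrier G;
        h' \<in> carrier H; x \<in> X\<rbrakk> \<Longrightarrow> \<alpha> (a \<otimes>\<^bsub>A\<^esub> b, g \<otimes>\<^bsub>G\<^esub> g', h \<otimes>\<^bsub>H\<^esub> h') x = \<alpha> (a, g, h) (\<alpha> (b, g', h') x)"
    and ext: "\<And>u. u \<in> carrier (A \<times>\<times> G \<times>\<times> H) \<Longrightarrow> \<alpha> u \<in> extensional X"
    and free: "\<And>a x. \<lbrakk>a \<in> carrier A; x \<in> X; \<alpha> (a, \<one>\<^bsub>G\<^esub>, \<one>\<^bsub>H\<^esub>) x = x\<rbrakk> \<Longrightarrow> a = \<one>\<^bsub>A\<^esub>"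
    and fin: "finite F" "F \<subseteq> X" "\<And>x. x \<in> X \<Longrightarrow> \<exists>a\<in>carrier A. \<exists>f\<in>F. x = \<alpha> (a, \<one>\<^bsub>G\<^esub>, \<one>\<^bsub>H\<^esub>) f"
  shows "fibered_biset A G H (X, \<alpha>)"
proof -
  have "group_action (A \<times>\<times> G \<times>\<times> H) X \<alpha>"
    using ext by (intro group_actionI[OF group_prod]) (auto intro: closed one mult)
  moreover have "stabilizer A (A_action G H \<alpha>) x = {\<one>\<^bsub>A\<^esub>}" if "x \<in> X" for x
    using that free one by (auto simp: stabilizer_def A_action_def)
  moreover have "orbits A X (A_action G H \<alpha>) \<subseteq> orbit A (A_action G H \<alpha>) ` F"
  proof
    fix \<omega> assume "\<omega> \<in> orbits A X (A_action G H \<alpha>)"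
    then obtain x where x: "x \<in> X" "\<omega> = orbit A (A_action G H \<alpha>) x" by (auto simp: orbits_def)
    obtain a f where af: "a \<in> carrier A" "f \<in> F" "x = \<alpha> (a, \<one>\<^bsub>G\<^esub>, \<one>\<^bsub>H\<^esub>) f" using fin(3)[OF x(1)] by auto
    have f: "f \<in> X" using af fin by auto
    have *: "\<alpha> (b, \<one>\<^bsub>G\<^esub>, \<one>\<^bsub>H\<^esub>) x = \<alpha> (b \<otimes>\<^bsub>A\<^esub> a, \<one>\<^bsub>G\<^esub>, \<one>\<^bsub>H\<^esub>) f" if "b \<in> carrier A" for b
      using mult[of b "\<one>\<^bsub>G\<^esub>" "\<one>\<^bsub>H\<^esub>" a "\<one>\<^bsub>G\<^esub>" "\<one>\<^bsub>H\<^esub>" f] that af f by simp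
    have "orbit A (A_action G H \<alpha>) x = orbit A (A_action G H \<alpha>) f"
    proof (intro equalityI subsetI)
      fix y assume "y \<in> orbit A (A_action G H \<alpha>) x"
      then obtain b where b: "b \<in> carrier A" "y = \<alpha> (b, \<one>\<^bsub>G\<^esub>, \<one>\<^bsub>H\<^esub>) x" by (auto simp: orbit_def A_action_def)
      then show "y \<in> orbit A (A_action G H \<alpha>) f" using *[OF b(1)] af(1) by (auto simp: orbit_def A_action_def)
    next
      fix y assume "y \<in> orbit A (A_action G H \<alpha>) f"
      then obtain b where b: "b \<in> carrier A" "y = \<alpha> (b, \<one>\<^bsub>G\<^esub>, \<one>\<^bsub>H\<^esub>) f" by (auto simp: orbit_def A_action_def)
      then have "y = \<alpha> (b \<otimes>\<^bsub>A\<^esub> inv\<^bsub>A\<^esub> a, \<one>\<^bsub>G\<^esub>, \<one>\<^bsub>H\<^esub>) x"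
        using *[of "b \<otimes>\<^bsub>A\<^esub> inv\<^bsub>A\<^esub> a"] af(1) by (simp add: A.m_assoc)
      then show "y \<in> orbit A (A_action G H \<alpha>) x" using b(1) af(1) by (auto simp: orbit_def A_action_def)
    qed
    then show "\<omega> \<in> orbit A (A_action G H \<alpha>) ` F" using x af by auto
  qed
  then have "finite (orbits A X (A_action G H \<alpha>))" 
    by (rule finite_subset) (rule finite_imageI[OF fin(1)])
  ultimately show ?thesis by (simp add: fibered_biset_def)
qed

context
  fixes X :: "'x set" and \<alpha> :: "'a \<times> 'g \<times> 'h \<Rightarrow> 'x \<Rightarrow> 'x"
  assumes X: "fibered_biset A G H (X, \<alpha>)"
begin

lemma action: "group_action (A \<times>\<times> G \<times>\<times> H) X \<alpha>"
  using X by (simp add: fibered_biset_def)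

lemma act_closed: "\<lbrakk>a \<in> carrier A; g \<in> carrier G; h \<in> carrier H; x \<in> X\<rbrakk> \<Longrightarrow> \<alpha> (a, g, h) x \<in> X"
  using group_action.element_image[OF action, of "(a, g, h)"] by auto

lemma act_one: "x \<in> X \<Longrightarrow> \<alpha> (\<one>\<^bsub>A\<^esub>, \<one>\<^bsub>G\<^esub>, \<one>\<^bsub>H\<^esub>) x = x"
  using group_action.id_eq_one[OF action] by (metis one_DirProd restrict_apply')

lemma act_act:
  "\<lbrakk>a \<in> carrier A; g \<in> carrier G; h \<in> carrier H; b \<in> carrier A; g' \<in> carrier G; h' \<in> carrier H; x \<in> X\<rbrakk>
   \<Longrightarrow> \<alpha> (a, g, h) (\<alpha> (b, g', h') x) = \<alpha> (a \<otimes>\<^bsub>A\<^esub> b, g \<otimes>\<^bsub>G\<^esub> g', h \<otimes>\<^bsub>H\<^esub> h') x"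
  using group_action.composition_rule[OF action, of x "(a, g, h)" "(b, g', h')"] by auto

lemma act_free: "\<lbrakk>a \<in> carrier A; x \<in> X; \<alpha> (a, \<one>\<^bsub>G\<^esub>, \<one>\<^bsub>H\<^esub>) x = x\<rbrakk> \<Longrightarrow> a = \<one>\<^bsub>A\<^esub>"
  using X by (auto simp: fibered_biset_def stabilizer_def A_action_def)

text \<open>Finiteness of the set of \<open>A\<close>-orbits is used only through a finite set of points that meets all of
  them; \<open>fibered_bisetI\<close> is the converse.\<close>

lemma finite_reps:
  obtains F where "finite F" "F \<subseteq> X" "\<And>x. x \<in> X \<Longrightarrow> \<exists>a\<in>carrier A. \<exists>f\<in>F. x = \<alpha> (a, \<one>\<^bsub>G\<^esub>, \<one>\<^bsub>H\<^esub>) f"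
proof -
  let ?O = "orbits A X (A_action G H \<alpha>)"
  have "\<exists>x. x \<in> X \<and> \<omega> = orbit A (A_action G H \<alpha>) x" if "\<omega> \<in> ?O" for \<omega>
    using that by (auto simp: orbits_def)
  then obtain r where r: "\<And>\<omega>. \<omega> \<in> ?O \<Longrightarrow> r \<omega> \<in> X \<and> \<omega> = orbit A (A_action G H \<alpha>) (r \<omega>)" by metis
  have "finite (r ` ?O)" using X by (auto simp: fibered_biset_def)
  moreover have "r ` ?O \<subseteq> X" using r by auto
  moreover have "\<exists>a\<in>carrier A. \<exists>f\<in>r ` ?O. x = \<alpha> (a, \<one>\<^bsub>G\<^esub>, \<one>\<^bsub>H\<^esub>) f" if x: "x \<in> X" for x
  proof -
    let ?\<omega> = "orbit A (A_action G H \<alpha>) x"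
    have O: "?\<omega> \<in> ?O" using x by (auto simp: orbits_def)
    have "x \<in> ?\<omega>"
      unfolding orbit_def A_action_def mem_Collect_eq using act_one[OF x] by (intro exI[of _ "\<one>\<^bsub>A\<^esub>"]) simp
    then have "x \<in> orbit A (A_action G H \<alpha>) (r ?\<omega>)" using r[OF O] by blast
    then obtain a where "a \<in> carrier A" "x = \<alpha> (a, \<one>\<^bsub>G\<^esub>, \<one>\<^bsub>H\<^esub>) (r ?\<omega>)" by (auto simp: orbit_def A_action_def)
    then show ?thesis using O by blast
  qed
  ultimately show ?thesis by (rule that)
qed

end

end

text \<open>Bijective embeddings are the isomorphisms, and a disjoint union is a pair of embeddings with
  complementary images. Statements about embeddings therefore cover both relations of the
  Grothendieck group at once.\<close>

definition fb_embedding ::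
  "'a monoid \<Rightarrow> 'g monoid \<Rightarrow> 'h monoid \<Rightarrow> ('x \<Rightarrow> 'y) \<Rightarrow>
   ('x, 'a, 'g, 'h) actset \<Rightarrow> ('y, 'a, 'g, 'h) actset \<Rightarrow> bool" where
  "fb_embedding A G H f = (\<lambda>(X, \<alpha>) (Y, \<beta>). inj_on f X \<and> f ` X \<subseteq> Y \<and>
     (\<forall>u\<in>carrier (A \<times>\<times> G \<times>\<times> H). \<forall>x\<in>X. f (\<alpha> u x) = \<beta> u (f x)))"

lemma fb_iso_iff_embedding:
  "fb_iso A G H X Y \<longleftrightarrow> (\<exists>f. fb_embedding A G H f X Y \<and> f ` fst X = fst Y)"
  by (cases X; cases Y) (auto simp: fb_iso_def fb_embedding_def bij_betw_def)

lemma fb_embedding_comp: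
  assumes "fb_embedding A G H f X Y" and "fb_embedding A G H g Y Z"
  shows "fb_embedding A G H (g \<circ> f) X Z"
  using assms by (cases X; cases Y; cases Z)
    (fastforce simp: fb_embedding_def intro!: comp_inj_on intro: inj_on_subset)

lemma fb_iso_trans:
  assumes "fb_iso A G H X Y" and "fb_iso A G H Y Z"
  shows "fb_iso A G H X Z"
proof -
  obtain f g where "fb_embedding A G H f X Y" "f ` fst X = fst Y" "fb_embedding A G H g Y Z" "g ` fst Y = fst Z"
    using assms by (auto simp: fb_iso_iff_embedding)
  then show ?thesis
    unfolding fb_iso_iff_embedding
    by (intro exI[of _ "g \<circ> f"] conjI fb_embedding_comp) (simp_all only: image_comp[symmetric])
qed

context fiber_groups
begin

text \<open>The hypothesis on \<open>X\<close> guarantees that the action preserves the carrier, on which alone the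
  isomorphism is equivariant.\<close>

lemma fb_iso_sym:
  assumes X: "fibered_biset A G H X" and iso: "fb_iso A G H X Y"
  shows "fb_iso A G H Y X"
proof -
  obtain X' \<alpha> Y' \<beta> where XY: "X = (X', \<alpha>)" "Y = (Y', \<beta>)" by (cases X; cases Y)
  obtain f where f: "bij_betw f X' Y'"
    "\<And>u x. u \<in> carrier (A \<times>\<times> G \<times>\<times> H) \<Longrightarrow> x \<in> X' \<Longrightarrow> f (\<alpha> u x) = \<beta> u (f x)"
    using iso by (auto simp: fb_iso_def XY)
  have "inv_into X' f (\<beta> u y) = \<alpha> u (inv_into X' f y)" if "u \<in> carrier (A \<times>\<times> G \<times>\<times> H)" "y \<in> Y'" for u y
  proof -
    have "y \<in> f ` X'" using bij_betw_imp_surj_on[OF f(1)] that(2) by simp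
    then obtain x where x: "x \<in> X'" "y = f x" by (rule imageE) auto
    have "\<alpha> u x \<in> X'" using that(1) x(1) act_closed[of X' \<alpha>] X XY by (cases u) simp
    moreover have "inj_on f X'" using f(1) by (simp add: bij_betw_def)
    moreover have "\<beta> u y = f (\<alpha> u x)" using f(2)[OF that(1) x(1)] x(2) by simp
    ultimately show ?thesis using x by simp
  qed
  moreover have "bij_betw (inv_into X' f) Y' X'" using f(1) by (rule bij_betw_inv_into)
  ultimately show ?thesis by (simp only: fb_iso_def XY prod.case) blast
qed

lemma fibered_biset_transfer:
  assumes X: "fibered_biset A G H (X, \<alpha>)" and f: "fb_embedding A G H f (X, \<alpha>) (Y, \<beta>)" "f ` X = Y"
    and ext: "\<And>u. u \<in> carrier (A \<times>\<times> G \<times>\<times> H) \<Longrightarrow> \<beta> u \<in> extensional Y"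
  shows "fibered_biset A G H (Y, \<beta>)"
proof -
  have inj: "inj_on f X" and eq: "\<And>a g h x. \<lbrakk>a \<in> carrier A; g \<in> carrier G; h \<in> carrier H; x \<in> X\<rbrakk> \<Longrightarrow>
      \<beta> (a, g, h) (f x) = f (\<alpha> (a, g, h) x)"
    using f by (auto simp: fb_embedding_def)
  obtain F where F: "finite F" "F \<subseteq> X" "\<And>x. x \<in> X \<Longrightarrow> \<exists>a\<in>carrier A. \<exists>f\<in>F. x = \<alpha> (a, \<one>\<^bsub>G\<^esub>, \<one>\<^bsub>H\<^esub>) f"
    using finite_reps[OF X] by metis
  show ?thesis
  proof (rule fibered_bisetI[where F = "f ` F"])
    fix a y assume a: "a \<in> carrier A" "y \<in> Y" "\<beta> (a, \<one>\<^bsub>G\<^esub>, \<one>\<^bsub>H\<^esub>) y = y"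
    then obtain x where x: "x \<in> X" "y = f x" using f by auto
    then have "\<alpha> (a, \<one>\<^bsub>G\<^esub>, \<one>\<^bsub>H\<^esub>) x = x"
      using a inj eq act_closed[OF X] by (metis G.one_closed H.one_closed inj_onD)
    then show "a = \<one>\<^bsub>A\<^esub>" using act_free[OF X] a x by auto
  next
    fix y assume "y \<in> Y"
    then obtain x where x: "x \<in> X" "y = f x" using f by auto
    then obtain a r where "a \<in> carrier A" "r \<in> F" "x = \<alpha> (a, \<one>\<^bsub>G\<^esub>, \<one>\<^bsub>H\<^esub>) r" using F(3) by blast
    then show "\<exists>a\<in>carrier A. \<exists>r\<in>f ` F. y = \<beta> (a, \<one>\<^bsub>G\<^esub>, \<one>\<^bsub>H\<^esub>) r"
      using x F(2) eq[of a "\<one>\<^bsub>G\<^esub>" "\<one>\<^bsub>H\<^esub>" r] by (metis G.one_closed H.one_closed imageI subsetD)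
  qed (use f F in \<open>auto simp: eq act_closed[OF X] act_one[OF X] act_act[OF X] ext[simplified]\<close>)
qed

text \<open>Every element is \<open>a\<close> times one of finitely many representatives; recording \<open>a\<close> and the number of the
  representative embeds the biset into \<open>A \<times> \<nat>\<close>. The structure is then carried over along this injection.
  This is why isomorphism classes may be represented by bisets on the type \<open>'a \<times> nat\<close>.\<close>

lemma ex_representative:
  fixes X :: "('x, 'a, 'g, 'h) actset"
  assumes X: "fibered_biset A G H X"
  obtains Y :: "('a \<times> nat, 'a, 'g, 'h) actset"
  where "fibered_biset A G H Y" "fb_iso A G H X Y"
proof -
  obtain X' \<alpha> where X': "X = (X', \<alpha>)" by (cases X)
  note X = X[unfolded X']
  obtain F where F: "finite F" "F \<subseteq> X'" "\<And>x. x \<in> X' \<Longrightarrow> \<exists>a\<in>carrier A. \<exists>f\<in>F. x = \<alpha> (a, \<one>\<^bsub>G\<^esub>, \<one>\<^bsub>H\<^esub>) f"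
    using finite_reps[OF X] by metis
  obtain idx :: "'x \<Rightarrow> nat" where idx: "inj_on idx F" using F(1) finite_imp_inj_to_nat_seg by metis
  have "\<exists>p. \<forall>x\<in>X'. snd (p x) \<in> F \<and> x = \<alpha> (fst (p x), \<one>\<^bsub>G\<^esub>, \<one>\<^bsub>H\<^esub>) (snd (p x))"
    using F(3) by (intro bchoice) fastforce
  then obtain p where p: "\<And>x. x \<in> X' \<Longrightarrow> snd (p x) \<in> F \<and> x = \<alpha> (fst (p x), \<one>\<^bsub>G\<^esub>, \<one>\<^bsub>H\<^esub>) (snd (p x))" by blast
  define f where "f x = (fst (p x), idx (snd (p x)))" for x
  have inj: "inj_on f X'"
  proof (rule inj_onI)
    fix x y assume xy: "x \<in> X'" "y \<in> X'" "f x = f y"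
    then have "fst (p x) = fst (p y)" "snd (p x) = snd (p y)"
      using idx p by (auto simp: f_def dest: inj_onD)
    then show "x = y" using p xy by metis
  qed
  define \<beta> where "\<beta> u = restrict (\<lambda>y. f (\<alpha> u (inv_into X' f y))) (f ` X')" for u
  have emb: "fb_embedding A G H f (X', \<alpha>) (f ` X', \<beta>)"
    using inj by (auto simp: fb_embedding_def \<beta>_def)
  have "fibered_biset A G H (f ` X', \<beta>)"
    by (rule fibered_biset_transfer[OF X emb refl]) (auto simp: \<beta>_def)
  moreover have "fb_iso A G H X (f ` X', \<beta>)"
    using emb by (auto simp: fb_iso_iff_embedding X')
  ultimately show ?thesis by (rule that)
qed

lemma fb_class_of_eqI:
  assumes "fibered_biset A G H X" and "fb_iso A G H X Y"
  shows "fb_class_of A G H X = fb_class_of A G H Y"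
  using assms by (auto simp: fb_class_of_def intro: fb_iso_trans fb_iso_sym)

lemma fb_class_of_in_classes:
  assumes X: "fibered_biset A G H X"
  shows "fb_class_of A G H X \<in> fb_classes A G H"
proof -
  obtain Y :: "('a \<times> nat, 'a, 'g, 'h) actset" where "fibered_biset A G H Y" "fb_iso A G H X Y"
    using ex_representative[OF X] .
  then show ?thesis using fb_class_of_eqI[OF X, of Y] unfolding fb_classes_def by blast
qed

end

section \<open>Transitive bisets\<close>

lemma (in group) l_coset_eq_iff:
  assumes S: "subgroup S G" and u: "u \<in> carrier G" and v: "v \<in> carrier G"
  shows "u <# S = v <# S \<longleftrightarrow> inv v \<otimes> u \<in> S"
proof
  assume "u <# S = v <# S"
  then have "u \<in> v <# S" using lcos_self[OF u S] by simp
  then show "inv v \<otimes> u \<in> S" using subgroup.lcos_module_imp[OF S is_group v] by simp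
next
  assume *: "inv v \<otimes> u \<in> S"
  have "u <# S = v <# ((inv v \<otimes> u) <# S)"
    using u v subgroup.subset[OF S] by (simp add: lcos_m_assoc m_assoc[symmetric])
  also have "(inv v \<otimes> u) <# S = S" using * S by (simp add: coset_join3 subgroup.mem_carrier)
  finally show "u <# S = v <# S" .
qed

definition coset_biset :: "('a \<times> 'g \<times> 'h) monoid \<Rightarrow> ('a \<times> 'g \<times> 'h) set \<Rightarrow> (('a \<times> 'g \<times> 'h) set, 'a, 'g, 'h) actset" where
  "coset_biset P S = (lcosets\<^bsub>P\<^esub> S, \<lambda>u. \<lambda>c\<in>lcosets\<^bsub>P\<^esub> S. u <#\<^bsub>P\<^esub> c)"

lemma fb_transitive_eq_coset_biset:
  "fb_transitive A G H U \<phi> = coset_biset (A \<times>\<times> G \<times>\<times> H) (twisted_subgroup A U \<phi>)"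
  by (simp add: fb_transitive_def coset_biset_def Let_def)

context fiber_groups
begin

abbreviation P where "P \<equiv> A \<times>\<times> G \<times>\<times> H"

sublocale P: group P by (rule group_prod)

lemma inv_P: "\<lbrakk>a \<in> carrier A; g \<in> carrier G; h \<in> carrier H\<rbrakk> \<Longrightarrow>
    inv\<^bsub>P\<^esub> (a, g, h) = (inv\<^bsub>A\<^esub> a, inv\<^bsub>G\<^esub> g, inv\<^bsub>H\<^esub> h)"
  by (simp add: inv_DirProd A.is_group G.is_group H.is_group DirProd_group)

lemma act_lcoset:
  assumes S: "subgroup S P" and u: "u \<in> carrier P" "v \<in> carrier P"
  shows "u <#\<^bsub>P\<^esub> (v <#\<^bsub>P\<^esub> S) = (u \<otimes>\<^bsub>P\<^esub> v) <#\<^bsub>P\<^esub> S"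
  using u subgroup.subset[OF S] by (simp only: P.lcos_m_assoc)

text \<open>The subgroup \<open>A\<close> is central, so its stabilizer at any point \<open>u S\<close> is \<open>A \<inter> S\<close>, and the cosets of the
  elements \<open>(1, g, h)\<close> meet every \<open>A\<close>-orbit.\<close>

lemma fibered_coset_biset:
  assumes S: "subgroup S P" and S1: "\<And>a. (a, \<one>\<^bsub>G\<^esub>, \<one>\<^bsub>H\<^esub>) \<in> S \<Longrightarrow> a = \<one>\<^bsub>A\<^esub>"
    and fin: "finite (carrier G)" "finite (carrier H)"
  shows "fibered_biset A G H (coset_biset P S)"
proof -
  let ?X = "lcosets\<^bsub>P\<^esub> S" and ?F = "(\<lambda>(g, h). (\<one>\<^bsub>A\<^esub>, g, h) <#\<^bsub>P\<^esub> S) ` (carrier G \<times> carrier H)"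
  have in_X: "u <#\<^bsub>P\<^esub> S \<in> ?X" if "u \<in> carrier P" for u
    using that by (auto simp: LCOSETS_def)
  have X_ex: "\<exists>a g h. a \<in> carrier A \<and> g \<in> carrier G \<and> h \<in> carrier H \<and> c = (a, g, h) <#\<^bsub>P\<^esub> S" if "c \<in> ?X" for c
    using that by (auto simp: LCOSETS_def)
  show ?thesis
    unfolding coset_biset_def
  proof (rule fibered_bisetI[where F = ?F])
    fix a g h c assume "a \<in> carrier A" "g \<in> carrier G" "h \<in> carrier H" "c \<in> ?X"
    then show "(\<lambda>c\<in>?X. (a, g, h) <#\<^bsub>P\<^esub> c) c \<in> ?X"
      using X_ex[of c] by (auto simp: act_lcoset[OF S] intro!: in_X)
  next
    fix c assume "c \<in> ?X"
    then show "(\<lambda>c\<in>?X. (\<one>\<^bsub>A\<^esub>, \<one>\<^bsub>G\<^esub>, \<one>\<^bsub>H\<^esub>) <#\<^bsub>P\<^esub> c) c = c"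
      using X_ex[of c] by (auto simp: act_lcoset[OF S])
  next
    fix a g h b g' h' c
    assume *: "a \<in> carrier A" "g \<in> carrier G" "h \<in> carrier H" "b \<in> carrier A" "g' \<in> carrier G" "h' \<in> carrier H" "c \<in> ?X"
    then obtain a2 g2 h2 where c: "a2 \<in> carrier A" "g2 \<in> carrier G" "h2 \<in> carrier H" "c = (a2, g2, h2) <#\<^bsub>P\<^esub> S"
      using X_ex by blast
    show "(\<lambda>c\<in>?X. (a \<otimes>\<^bsub>A\<^esub> b, g \<otimes>\<^bsub>G\<^esub> g', h \<otimes>\<^bsub>H\<^esub> h') <#\<^bsub>P\<^esub> c) c =
        (\<lambda>c\<in>?X. (a, g, h) <#\<^bsub>P\<^esub> c) ((\<lambda>c\<in>?X. (b, g', h') <#\<^bsub>P\<^esub> c) c)"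
      using * c by (simp add: act_lcoset[OF S] in_X A.m_assoc G.m_assoc H.m_assoc)
  next
    fix a c assume a: "a \<in> carrier A" "c \<in> ?X" "(\<lambda>c\<in>?X. (a, \<one>\<^bsub>G\<^esub>, \<one>\<^bsub>H\<^esub>) <#\<^bsub>P\<^esub> c) c = c"
    then obtain b g h where c: "b \<in> carrier A" "g \<in> carrier G" "h \<in> carrier H" "c = (b, g, h) <#\<^bsub>P\<^esub> S"
      using X_ex by blast
    have "(a \<otimes>\<^bsub>A\<^esub> b, g, h) <#\<^bsub>P\<^esub> S = (b, g, h) <#\<^bsub>P\<^esub> S"
      using a c by (simp add: act_lcoset[OF S] in_X)
    then have "inv\<^bsub>P\<^esub> (b, g, h) \<otimes>\<^bsub>P\<^esub> (a \<otimes>\<^bsub>A\<^esub> b, g, h) \<in> S"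
      using a c by (subst (asm) P.l_coset_eq_iff[OF S]) auto
    then have "(inv\<^bsub>A\<^esub> b \<otimes>\<^bsub>A\<^esub> (a \<otimes>\<^bsub>A\<^esub> b), \<one>\<^bsub>G\<^esub>, \<one>\<^bsub>H\<^esub>) \<in> S"
      using a c by (simp add: inv_P)
    moreover have "inv\<^bsub>A\<^esub> b \<otimes>\<^bsub>A\<^esub> (a \<otimes>\<^bsub>A\<^esub> b) = a"
      using a c by (simp add: A.m_comm[of a b] A.m_assoc[symmetric])
    ultimately show "a = \<one>\<^bsub>A\<^esub>" using S1 by simp
  next
    fix c assume "c \<in> ?X"
    then obtain b g h where c: "b \<in> carrier A" "g \<in> carrier G" "h \<in> carrier H" "c = (b, g, h) <#\<^bsub>P\<^esub> S"
      using X_ex by blast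
    then show "\<exists>a\<in>carrier A. \<exists>f\<in>?F. c = (\<lambda>c\<in>?X. (a, \<one>\<^bsub>G\<^esub>, \<one>\<^bsub>H\<^esub>) <#\<^bsub>P\<^esub> c) f"
      by (intro bexI[of _ b] bexI[of _ "(\<one>\<^bsub>A\<^esub>, g, h) <#\<^bsub>P\<^esub> S"]) (auto simp: act_lcoset[OF S] in_X)
  qed (use fin in \<open>auto simp: in_X\<close>)
qed

text \<open>The orbit-stabilizer correspondence \<open>u S \<mapsto> u x\<close>, as an isomorphism of bisets.\<close>

lemma coset_biset_iso:
  assumes S: "subgroup S P" and X: "fibered_biset A G H (X, \<alpha>)" and x: "x \<in> X"
    and trans: "\<And>y. y \<in> X \<Longrightarrow> \<exists>u\<in>carrier P. y = \<alpha> u x"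
    and stab: "stabilizer P \<alpha> x = S"
  shows "fb_iso A G H (coset_biset P S) (X, \<alpha>)"
proof -
  interpret act: group_action P X \<alpha> by (rule action[OF X])
  have stab': "\<alpha> s x = x" if "s \<in> S" for s using that stab by (auto simp: stabilizer_def)
  have const: "\<alpha> w x = \<alpha> u x" if u: "u \<in> carrier P" and w: "w \<in> u <#\<^bsub>P\<^esub> S" for u w
  proof -
    obtain s where s: "s \<in> S" "w = u \<otimes>\<^bsub>P\<^esub> s" using w unfolding l_coset_def by blast
    have "s \<in> carrier P" using s(1) by (rule subgroup.mem_carrier[OF S])
    then show ?thesis unfolding s(2) using x u stab'[OF s(1)] by (simp only: act.composition_rule)
  qed
  define f where "f c = \<alpha> (SOME w. w \<in> c) x" for c
  have f: "f (u <#\<^bsub>P\<^esub> S) = \<alpha> u x" if u: "u \<in> carrier P" for u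
    unfolding f_def using P.lcos_self[OF u S] by (intro const[OF u]) (rule someI)
  have inj: "u <#\<^bsub>P\<^esub> S = v <#\<^bsub>P\<^esub> S" if uv: "u \<in> carrier P" "v \<in> carrier P" "\<alpha> u x = \<alpha> v x" for u v
  proof -
    have "\<alpha> (inv\<^bsub>P\<^esub> v \<otimes>\<^bsub>P\<^esub> u) x = \<alpha> (inv\<^bsub>P\<^esub> v) (\<alpha> v x)"
      using uv x by (simp only: act.composition_rule P.inv_closed)
    also have "\<dots> = x" using act.orbit_sym_aux[OF uv(2) x refl] .
    finally have "inv\<^bsub>P\<^esub> v \<otimes>\<^bsub>P\<^esub> u \<in> S"
      unfolding stab[symmetric] stabilizer_def using uv by (simp only: mem_Collect_eq P.m_closed P.inv_closed)
    then show ?thesis using uv by (simp only: P.l_coset_eq_iff[OF S])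
  qed
  have im: "f ` (lcosets\<^bsub>P\<^esub> S) = X"
  proof (intro equalityI subsetI)
    fix y assume "y \<in> f ` (lcosets\<^bsub>P\<^esub> S)"
    then obtain u where "u \<in> carrier P" "y = f (u <#\<^bsub>P\<^esub> S)" unfolding LCOSETS_def by blast
    then show "y \<in> X" using act.element_image[OF _ x] f by metis
  next
    fix y assume "y \<in> X"
    then obtain u where "u \<in> carrier P" "y = \<alpha> u x" using trans by blast
    then show "y \<in> f ` (lcosets\<^bsub>P\<^esub> S)" unfolding LCOSETS_def using f by (intro image_eqI[of _ _ "u <#\<^bsub>P\<^esub> S"]) auto
  qed
  have "fb_embedding A G H f (coset_biset P S) (X, \<alpha>)"
    unfolding fb_embedding_def coset_biset_def prod.case
  proof (intro conjI ballI)
    show "inj_on f (lcosets\<^bsub>P\<^esub> S)"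
    proof (rule inj_onI)
      fix c d assume "c \<in> lcosets\<^bsub>P\<^esub> S" "d \<in> lcosets\<^bsub>P\<^esub> S" "f c = f d"
      then obtain u v where "u \<in> carrier P" "v \<in> carrier P" "c = u <#\<^bsub>P\<^esub> S" "d = v <#\<^bsub>P\<^esub> S" "f c = f d"
        unfolding LCOSETS_def by blast
      then show "c = d" using inj[of u v] f by metis
    qed
    show "f ` (lcosets\<^bsub>P\<^esub> S) \<subseteq> X" using im by blast
    fix u c assume u: "u \<in> carrier P" and c: "c \<in> lcosets\<^bsub>P\<^esub> S"
    obtain v where v: "v \<in> carrier P" "c = v <#\<^bsub>P\<^esub> S" using c unfolding LCOSETS_def by blast
    have "f (u <#\<^bsub>P\<^esub> c) = \<alpha> (u \<otimes>\<^bsub>P\<^esub> v) x"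
      unfolding v(2) act_lcoset[OF S u v(1)] by (rule f) (rule P.m_closed[OF u v(1)])
    also have "\<dots> = \<alpha> u (f c)" unfolding v(2) f[OF v(1)] by (rule act.composition_rule[OF x u v(1)])
    finally show "f ((\<lambda>c\<in>lcosets\<^bsub>P\<^esub> S. u <#\<^bsub>P\<^esub> c) c) = \<alpha> u (f c)" using c by (simp only: restrict_apply')
  qed
  then show ?thesis unfolding fb_iso_iff_embedding using im by (auto simp: coset_biset_def)
qed

lemma coset_biset_base:
  assumes S: "subgroup S P"
  shows "S \<in> fst (coset_biset P S)" and "stabilizer P (snd (coset_biset P S)) S = S"
    and "\<And>y. y \<in> fst (coset_biset P S) \<Longrightarrow> \<exists>u\<in>carrier P. y = snd (coset_biset P S) u S"
proof -
  have one: "\<one>\<^bsub>P\<^esub> <#\<^bsub>P\<^esub> S = S" using P.lcos_mult_one subgroup.subset[OF S] by blast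
  show S_in: "S \<in> fst (coset_biset P S)"
    unfolding coset_biset_def LCOSETS_def fst_conv using one P.one_closed by blast
  have eq: "snd (coset_biset P S) u S = u <#\<^bsub>P\<^esub> S" for u
    using S_in unfolding coset_biset_def snd_conv fst_conv by (rule restrict_apply')
  have "u <#\<^bsub>P\<^esub> S = S \<longleftrightarrow> u \<in> S" if u: "u \<in> carrier P" for u
    using P.l_coset_eq_iff[OF S u P.one_closed] unfolding one P.inv_one P.l_one[OF u] .
  then show "stabilizer P (snd (coset_biset P S)) S = S"
    unfolding stabilizer_def eq using subgroup.subset[OF S] by blast
  show "\<exists>u\<in>carrier P. y = snd (coset_biset P S) u S" if "y \<in> fst (coset_biset P S)" for y
    using that unfolding eq unfolding coset_biset_def LCOSETS_def fst_conv by blast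
qed

end

section \<open>Tensor products\<close>

text \<open>The element \<open>[x, y]\<close> of the orbit set; it belongs to the tensor product only if its stabilizer in \<open>A\<close> is
  trivial. The next definitions name the action and the underlying set of \<open>fb_tensor\<close>.\<close>

definition tensor_orbit ::
  "'a monoid \<Rightarrow> 'g monoid \<Rightarrow> 'h monoid \<Rightarrow> 'i monoid \<Rightarrow>
   ('a \<times> 'g \<times> 'h \<Rightarrow> 'x \<Rightarrow> 'x) \<Rightarrow> ('a \<times> 'h \<times> 'i \<Rightarrow> 'y \<Rightarrow> 'y) \<Rightarrow> 'x \<Rightarrow> 'y \<Rightarrow> ('x \<times> 'y) set" where
  "tensor_orbit A G H I \<alpha> \<beta> x y = orbit (A \<times>\<times> H) (balanced_action A G I \<alpha> \<beta>) (x, y)"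

definition tensor_action ::
  "'a monoid \<Rightarrow> 'h monoid \<Rightarrow> ('a \<times> 'g \<times> 'h \<Rightarrow> 'x \<Rightarrow> 'x) \<Rightarrow> ('a \<times> 'h \<times> 'i \<Rightarrow> 'y \<Rightarrow> 'y) \<Rightarrow>
   'a \<times> 'g \<times> 'i \<Rightarrow> ('x \<times> 'y) set \<Rightarrow> ('x \<times> 'y) set" where
  "tensor_action A H \<alpha> \<beta> = (\<lambda>(a, g, i) \<omega>.
     (\<lambda>(x, y). (\<alpha> (a, g, \<one>\<^bsub>H\<^esub>) x, \<beta> (\<one>\<^bsub>A\<^esub>, \<one>\<^bsub>H\<^esub>, i) y)) ` \<omega>)"

definition tensor_points ::
  "'a monoid \<Rightarrow> 'g monoid \<Rightarrow> 'h monoid \<Rightarrow> 'i monoid \<Rightarrow>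
   ('x, 'a, 'g, 'h) actset \<Rightarrow> ('y, 'a, 'h, 'i) actset \<Rightarrow> ('x \<times> 'y) set set" where
  "tensor_points A G H I = (\<lambda>(X, \<alpha>) (Y, \<beta>).
     {\<omega> \<in> orbits (A \<times>\<times> H) (X \<times> Y) (balanced_action A G I \<alpha> \<beta>).
        stabilizer A (A_action G I (tensor_action A H \<alpha> \<beta>)) \<omega> = {\<one>\<^bsub>A\<^esub>}})"

lemma fb_tensor_eq:
  "fb_tensor A G H I (X, \<alpha>) (Y, \<beta>) =
    (tensor_points A G H I (X, \<alpha>) (Y, \<beta>),
     \<lambda>u. restrict (tensor_action A H \<alpha> \<beta> u) (tensor_points A G H I (X, \<alpha>) (Y, \<beta>)))"
  by (simp add: fb_tensor_def tensor_points_def tensor_action_def Let_def)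

locale fiber_groups3 = fiber_groups A G H + I: group I
  for A :: "'a monoid" and G :: "'g monoid" and H :: "'h monoid" and I :: "'i monoid"
begin

sublocale HI: fiber_groups A H I ..
sublocale GI: fiber_groups A G I ..

context
  fixes X :: "'x set" and \<alpha> :: "'a \<times> 'g \<times> 'h \<Rightarrow> 'x \<Rightarrow> 'x" and Y :: "'y set" and \<beta> :: "'a \<times> 'h \<times> 'i \<Rightarrow> 'y \<Rightarrow> 'y"
  assumes X: "fibered_biset A G H (X, \<alpha>)" and Y: "fibered_biset A H I (Y, \<beta>)"
begin

abbreviation (input) tens where "tens \<equiv> tensor_orbit A G H I \<alpha> \<beta>"
abbreviation (input) tact where "tact \<equiv> tensor_action A H \<alpha> \<beta>"
abbreviation (input) T where "T \<equiv> tensor_points A G H I (X, \<alpha>) (Y, \<beta>)"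

lemmas X_rules = act_closed[OF X] act_one[OF X] act_act[OF X]
lemmas Y_rules = HI.act_closed[OF Y] HI.act_one[OF Y] HI.act_act[OF Y]

lemma tensor_orbit_image:
  "tens x y = (\<lambda>(b, h). (\<alpha> (inv\<^bsub>A\<^esub> b, \<one>\<^bsub>G\<^esub>, h) x, \<beta> (b, h, \<one>\<^bsub>I\<^esub>) y)) ` (carrier A \<times> carrier H)"
  by (auto simp: tensor_orbit_def orbit_def balanced_action_def image_iff)

lemma mem_tensor_orbit:
  "p \<in> tens x y \<longleftrightarrow>
    (\<exists>b\<in>carrier A. \<exists>h\<in>carrier H. p = (\<alpha> (inv\<^bsub>A\<^esub> b, \<one>\<^bsub>G\<^esub>, h) x, \<beta> (b, h, \<one>\<^bsub>I\<^esub>) y))"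
  by (auto simp: tensor_orbit_image)

lemma tensor_orbit_self: "x \<in> X \<Longrightarrow> y \<in> Y \<Longrightarrow> (x, y) \<in> tens x y"
  unfolding mem_tensor_orbit
  by (rule bexI[of _ "\<one>\<^bsub>A\<^esub>"], rule bexI[of _ "\<one>\<^bsub>H\<^esub>"]) (simp_all add: X_rules Y_rules)

lemma tensor_orbit_subset: "x \<in> X \<Longrightarrow> y \<in> Y \<Longrightarrow> tens x y \<subseteq> X \<times> Y"
  by (auto simp: mem_tensor_orbit X_rules Y_rules)

lemma tensor_orbit_shift_subset:
  assumes "x \<in> X" "y \<in> Y" "b \<in> carrier A" "h \<in> carrier H"
  shows "tens (\<alpha> (inv\<^bsub>A\<^esub> b, \<one>\<^bsub>G\<^esub>, h) x) (\<beta> (b, h, \<one>\<^bsub>I\<^esub>) y) \<subseteq> tens x y"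
proof
  fix p assume "p \<in> tens (\<alpha> (inv\<^bsub>A\<^esub> b, \<one>\<^bsub>G\<^esub>, h) x) (\<beta> (b, h, \<one>\<^bsub>I\<^esub>) y)"
  then obtain c k where "c \<in> carrier A" "k \<in> carrier H"
    "p = (\<alpha> (inv\<^bsub>A\<^esub> c, \<one>\<^bsub>G\<^esub>, k) (\<alpha> (inv\<^bsub>A\<^esub> b, \<one>\<^bsub>G\<^esub>, h) x), \<beta> (c, k, \<one>\<^bsub>I\<^esub>) (\<beta> (b, h, \<one>\<^bsub>I\<^esub>) y))"
    unfolding mem_tensor_orbit by blast
  then show "p \<in> tens x y"
    unfolding mem_tensor_orbit using assms
    by (intro bexI[of _ "c \<otimes>\<^bsub>A\<^esub> b"] bexI[of _ "k \<otimes>\<^bsub>H\<^esub> h"]) (simp_all add: X_rules Y_rules A.inv_mult)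
qed

lemma tensor_orbit_shift:
  assumes xy: "x \<in> X" "y \<in> Y" and bh: "b \<in> carrier A" "h \<in> carrier H"
  shows "tens (\<alpha> (inv\<^bsub>A\<^esub> b, \<one>\<^bsub>G\<^esub>, h) x) (\<beta> (b, h, \<one>\<^bsub>I\<^esub>) y) = tens x y"
proof
  have "tens (\<alpha> (inv\<^bsub>A\<^esub> (inv\<^bsub>A\<^esub> b), \<one>\<^bsub>G\<^esub>, inv\<^bsub>H\<^esub> h) (\<alpha> (inv\<^bsub>A\<^esub> b, \<one>\<^bsub>G\<^esub>, h) x))
      (\<beta> (inv\<^bsub>A\<^esub> b, inv\<^bsub>H\<^esub> h, \<one>\<^bsub>I\<^esub>) (\<beta> (b, h, \<one>\<^bsub>I\<^esub>) y)) \<subseteq> tens (\<alpha> (inv\<^bsub>A\<^esub> b, \<one>\<^bsub>G\<^esub>, h) x) (\<beta> (b, h, \<one>\<^bsub>I\<^esub>) y)"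
    using xy bh by (intro tensor_orbit_shift_subset) (auto simp: X_rules Y_rules)
  then show "tens x y \<subseteq> tens (\<alpha> (inv\<^bsub>A\<^esub> b, \<one>\<^bsub>G\<^esub>, h) x) (\<beta> (b, h, \<one>\<^bsub>I\<^esub>) y)"
    using xy bh by (simp add: X_rules Y_rules)
qed (rule tensor_orbit_shift_subset[OF xy bh])

lemma tensor_orbit_eq_iff:
  assumes "x \<in> X" "y \<in> Y" "x' \<in> X" "y' \<in> Y"
  shows "tens x' y' = tens x y \<longleftrightarrow>
    (\<exists>b\<in>carrier A. \<exists>h\<in>carrier H. x' = \<alpha> (inv\<^bsub>A\<^esub> b, \<one>\<^bsub>G\<^esub>, h) x \<and> y' = \<beta> (b, h, \<one>\<^bsub>I\<^esub>) y)"
proof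
  assume "tens x' y' = tens x y"
  then have "(x', y') \<in> tens x y" using tensor_orbit_self assms by blast
  then show "\<exists>b\<in>carrier A. \<exists>h\<in>carrier H. x' = \<alpha> (inv\<^bsub>A\<^esub> b, \<one>\<^bsub>G\<^esub>, h) x \<and> y' = \<beta> (b, h, \<one>\<^bsub>I\<^esub>) y"
    unfolding mem_tensor_orbit by auto
qed (use assms tensor_orbit_shift in blast)

lemma tensor_action_orbit:
  assumes "x \<in> X" "y \<in> Y" "a \<in> carrier A" "g \<in> carrier G" "i \<in> carrier I"
  shows "tact (a, g, i) (tens x y) = tens (\<alpha> (a, g, \<one>\<^bsub>H\<^esub>) x) (\<beta> (\<one>\<^bsub>A\<^esub>, \<one>\<^bsub>H\<^esub>, i) y)"
proof -
  have "tact (a, g, i) (tens x y) = (\<lambda>(b, h). (\<alpha> (a, g, \<one>\<^bsub>H\<^esub>) (\<alpha> (inv\<^bsub>A\<^esub> b, \<one>\<^bsub>G\<^esub>, h) x),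
      \<beta> (\<one>\<^bsub>A\<^esub>, \<one>\<^bsub>H\<^esub>, i) (\<beta> (b, h, \<one>\<^bsub>I\<^esub>) y))) ` (carrier A \<times> carrier H)"
    by (simp add: tensor_action_def tensor_orbit_image image_image split_def)
  also have "\<dots> = tens (\<alpha> (a, g, \<one>\<^bsub>H\<^esub>) x) (\<beta> (\<one>\<^bsub>A\<^esub>, \<one>\<^bsub>H\<^esub>, i) y)"
    unfolding tensor_orbit_image using assms
    by (intro image_cong refl) (auto simp: X_rules Y_rules A.m_comm)
  finally show ?thesis .
qed

lemma tensor_pointsE:
  assumes "\<omega> \<in> T"
  obtains x y where "x \<in> X" "y \<in> Y" "\<omega> = tens x y"
  using assms by (auto simp: tensor_points_def orbits_def tensor_orbit_def)

text \<open>Freeness is tested on the first factor alone, because \<open>A\<close> can be moved across the tensor sign.\<close>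

lemma tensor_points_iff:
  assumes "x \<in> X" "y \<in> Y"
  shows "tens x y \<in> T \<longleftrightarrow> (\<forall>a\<in>carrier A. tens (\<alpha> (a, \<one>\<^bsub>G\<^esub>, \<one>\<^bsub>H\<^esub>) x) y = tens x y \<longrightarrow> a = \<one>\<^bsub>A\<^esub>)"
proof -
  have "tens x y \<in> orbits (A \<times>\<times> H) (X \<times> Y) (balanced_action A G I \<alpha> \<beta>)"
    using assms by (auto simp: orbits_def tensor_orbit_def)
  moreover have "stabilizer A (A_action G I tact) (tens x y) =
      {a \<in> carrier A. tens (\<alpha> (a, \<one>\<^bsub>G\<^esub>, \<one>\<^bsub>H\<^esub>) x) y = tens x y}"
    unfolding stabilizer_def A_action_def using assms
    by (intro Collect_cong conj_cong refl) (simp add: tensor_action_orbit Y_rules)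
  moreover have "\<one>\<^bsub>A\<^esub> \<in> {a \<in> carrier A. tens (\<alpha> (a, \<one>\<^bsub>G\<^esub>, \<one>\<^bsub>H\<^esub>) x) y = tens x y}"
    using assms by (simp add: X_rules)
  ultimately show ?thesis unfolding tensor_points_def by auto
qed

lemma tensor_action_mult:
  assumes "x \<in> X" "y \<in> Y" "a \<in> carrier A" "g \<in> carrier G" "i \<in> carrier I"
    "b \<in> carrier A" "g' \<in> carrier G" "i' \<in> carrier I"
  shows "tact (a, g, i) (tact (b, g', i') (tens x y)) = tact (a \<otimes>\<^bsub>A\<^esub> b, g \<otimes>\<^bsub>G\<^esub> g', i \<otimes>\<^bsub>I\<^esub> i') (tens x y)"
  using assms by (simp add: tensor_action_orbit X_rules Y_rules)

text \<open>The actions of \<open>A\<close> and of \<open>G \<times> I\<close> commute, so translating by a group element does not change the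
  stabilizer in \<open>A\<close>.\<close>

lemma tensor_action_closed:
  assumes \<omega>: "\<omega> \<in> T" and u: "a \<in> carrier A" "g \<in> carrier G" "i \<in> carrier I"
  shows "tact (a, g, i) \<omega> \<in> T"
proof -
  obtain x y where xy: "x \<in> X" "y \<in> Y" "\<omega> = tens x y" using \<omega> by (rule tensor_pointsE)
  have eq: "tact (inv\<^bsub>A\<^esub> a, inv\<^bsub>G\<^esub> g, inv\<^bsub>I\<^esub> i) (tens (\<alpha> (a, g, \<one>\<^bsub>H\<^esub>) x') (\<beta> (\<one>\<^bsub>A\<^esub>, \<one>\<^bsub>H\<^esub>, i) y)) = tens x' y"
    if "x' \<in> X" for x'
    using u xy that by (simp add: tensor_action_orbit X_rules Y_rules)
  have "b = \<one>\<^bsub>A\<^esub>" if b: "b \<in> carrier A"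
    "tens (\<alpha> (b, \<one>\<^bsub>G\<^esub>, \<one>\<^bsub>H\<^esub>) (\<alpha> (a, g, \<one>\<^bsub>H\<^esub>) x)) (\<beta> (\<one>\<^bsub>A\<^esub>, \<one>\<^bsub>H\<^esub>, i) y) =
     tens (\<alpha> (a, g, \<one>\<^bsub>H\<^esub>) x) (\<beta> (\<one>\<^bsub>A\<^esub>, \<one>\<^bsub>H\<^esub>, i) y)" for b
  proof -
    have "\<alpha> (b, \<one>\<^bsub>G\<^esub>, \<one>\<^bsub>H\<^esub>) (\<alpha> (a, g, \<one>\<^bsub>H\<^esub>) x) = \<alpha> (a, g, \<one>\<^bsub>H\<^esub>) (\<alpha> (b, \<one>\<^bsub>G\<^esub>, \<one>\<^bsub>H\<^esub>) x)"
      using b(1) u xy by (simp add: X_rules A.m_comm)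
    then have "tens (\<alpha> (b, \<one>\<^bsub>G\<^esub>, \<one>\<^bsub>H\<^esub>) x) y = tens x y"
      using eq[of "\<alpha> (b, \<one>\<^bsub>G\<^esub>, \<one>\<^bsub>H\<^esub>) x"] eq[of x] b xy by (simp add: X_rules)
    then show ?thesis using \<omega> b(1) xy by (simp add: tensor_points_iff)
  qed
  then have "tens (\<alpha> (a, g, \<one>\<^bsub>H\<^esub>) x) (\<beta> (\<one>\<^bsub>A\<^esub>, \<one>\<^bsub>H\<^esub>, i) y) \<in> T"
    using u xy by (subst tensor_points_iff) (auto simp: X_rules Y_rules)
  then show ?thesis using u xy by (simp add: tensor_action_orbit)
qed

text \<open>For finite sets of representatives \<open>F\<^sub>X\<close> and \<open>F\<^sub>Y\<close>, the elements \<open>[x, y]\<close> with \<open>x \<in> F\<^sub>X\<close> and \<open>y \<in> F\<^sub>Y\<close>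
  represent all \<open>A\<close>-orbits of the tensor product, since \<open>[a x, b y] = (b a) [x, y]\<close>.\<close>

lemma fibered_tensor: "fibered_biset A G I (fb_tensor A G H I (X, \<alpha>) (Y, \<beta>))"
proof -
  obtain FX where FX: "finite FX" "FX \<subseteq> X"
    "\<And>x. x \<in> X \<Longrightarrow> \<exists>a\<in>carrier A. \<exists>f\<in>FX. x = \<alpha> (a, \<one>\<^bsub>G\<^esub>, \<one>\<^bsub>H\<^esub>) f"
    using finite_reps[OF X] by metis
  obtain FY where FY: "finite FY" "FY \<subseteq> Y"
    "\<And>y. y \<in> Y \<Longrightarrow> \<exists>a\<in>carrier A. \<exists>f\<in>FY. y = \<beta> (a, \<one>\<^bsub>H\<^esub>, \<one>\<^bsub>I\<^esub>) f"
    using HI.finite_reps[OF Y] by metis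
  let ?F = "(\<lambda>(x, y). tens x y) ` (FX \<times> FY) \<inter> T"
  show ?thesis
    unfolding fb_tensor_eq
  proof (rule GI.fibered_bisetI[where F = ?F])
    fix \<omega> assume \<omega>: "\<omega> \<in> T"
    obtain x y where xy: "x \<in> X" "y \<in> Y" "\<omega> = tens x y" using \<omega> by (rule tensor_pointsE)
    obtain a r where r: "a \<in> carrier A" "r \<in> FX" "x = \<alpha> (a, \<one>\<^bsub>G\<^esub>, \<one>\<^bsub>H\<^esub>) r" using FX(3)[OF xy(1)] by blast
    obtain b s where s: "b \<in> carrier A" "s \<in> FY" "y = \<beta> (b, \<one>\<^bsub>H\<^esub>, \<one>\<^bsub>I\<^esub>) s" using FY(3)[OF xy(2)] by blast
    have rs: "r \<in> X" "s \<in> Y" using r(2) s(2) FX(2) FY(2) by auto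
    have "tens x y = tens (\<alpha> (inv\<^bsub>A\<^esub> b, \<one>\<^bsub>G\<^esub>, \<one>\<^bsub>H\<^esub>) (\<alpha> (b \<otimes>\<^bsub>A\<^esub> a, \<one>\<^bsub>G\<^esub>, \<one>\<^bsub>H\<^esub>) r)) (\<beta> (b, \<one>\<^bsub>H\<^esub>, \<one>\<^bsub>I\<^esub>) s)"
      using r(1) s(1) rs by (simp add: X_rules r(3) s(3) A.m_assoc[symmetric])
    also have "\<dots> = tens (\<alpha> (b \<otimes>\<^bsub>A\<^esub> a, \<one>\<^bsub>G\<^esub>, \<one>\<^bsub>H\<^esub>) r) s"
      using r(1) s(1) rs by (intro tensor_orbit_shift) (auto simp: X_rules)
    also have "\<dots> = tact (b \<otimes>\<^bsub>A\<^esub> a, \<one>\<^bsub>G\<^esub>, \<one>\<^bsub>I\<^esub>) (tens r s)"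
      using r(1) s(1) rs by (simp add: tensor_action_orbit Y_rules)
    finally have eq: "\<omega> = tact (b \<otimes>\<^bsub>A\<^esub> a, \<one>\<^bsub>G\<^esub>, \<one>\<^bsub>I\<^esub>) (tens r s)" using xy by simp
    have "tens r s = tact (inv\<^bsub>A\<^esub> (b \<otimes>\<^bsub>A\<^esub> a), \<one>\<^bsub>G\<^esub>, \<one>\<^bsub>I\<^esub>) \<omega>"
      unfolding eq using r(1) s(1) rs by (simp add: tensor_action_orbit X_rules Y_rules)
    then have "tens r s \<in> T" using r(1) s(1) \<omega> by (simp add: tensor_action_closed)
    then show "\<exists>a\<in>carrier A. \<exists>f\<in>?F. \<omega> = restrict (tact (a, \<one>\<^bsub>G\<^esub>, \<one>\<^bsub>I\<^esub>)) T f"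
      using r(1,2) s(1,2) eq by (intro bexI[of _ "b \<otimes>\<^bsub>A\<^esub> a"] bexI[of _ "tens r s"]) auto
    show "restrict (tact (\<one>\<^bsub>A\<^esub>, \<one>\<^bsub>G\<^esub>, \<one>\<^bsub>I\<^esub>)) T \<omega> = \<omega>"
      using \<omega> xy by (simp add: tensor_action_orbit X_rules Y_rules)
    {
      fix a g i b g' i'
      assume *: "a \<in> carrier A" "g \<in> carrier G" "i \<in> carrier I" "b \<in> carrier A" "g' \<in> carrier G" "i' \<in> carrier I"
      have "tact (a, g, i) (tact (b, g', i') \<omega>) = tact (a \<otimes>\<^bsub>A\<^esub> b, g \<otimes>\<^bsub>G\<^esub> g', i \<otimes>\<^bsub>I\<^esub> i') \<omega>"
        unfolding xy(3) by (rule tensor_action_mult[OF xy(1,2) *])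
      then show "restrict (tact (a \<otimes>\<^bsub>A\<^esub> b, g \<otimes>\<^bsub>G\<^esub> g', i \<otimes>\<^bsub>I\<^esub> i')) T \<omega> =
          restrict (tact (a, g, i)) T (restrict (tact (b, g', i')) T \<omega>)"
        using \<omega> * by (simp add: tensor_action_closed)
    }
    fix a assume "a \<in> carrier A" "restrict (tact (a, \<one>\<^bsub>G\<^esub>, \<one>\<^bsub>I\<^esub>)) T \<omega> = \<omega>"
    then show "a = \<one>\<^bsub>A\<^esub>"
      using \<omega> xy by (auto simp: tensor_action_orbit Y_rules tensor_points_iff)
  qed (use FX FY in \<open>auto simp: tensor_action_closed\<close>)
qed

text \<open>The stabilizer of \<open>[x, y]\<close> is the composition of the stabilizers of \<open>x\<close> and \<open>y\<close> as relations, with the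
  \<open>A\<close>-components multiplied. Both directions of the theorem read off stabilizers from this formula.\<close>

lemma tensor_stabilizer:
  assumes xy: "x \<in> X" "y \<in> Y" and u: "a \<in> carrier A" "g \<in> carrier G" "i \<in> carrier I"
  shows "tact (a, g, i) (tens x y) = tens x y \<longleftrightarrow>
    (\<exists>b\<in>carrier A. \<exists>h\<in>carrier H. \<alpha> (a \<otimes>\<^bsub>A\<^esub> b, g, h) x = x \<and> \<beta> (inv\<^bsub>A\<^esub> b, h, i) y = y)"
proof -
  have *: "(x = \<alpha> (inv\<^bsub>A\<^esub> b, \<one>\<^bsub>G\<^esub>, h) (\<alpha> (a, g, \<one>\<^bsub>H\<^esub>) x)) \<longleftrightarrow> \<alpha> (a \<otimes>\<^bsub>A\<^esub> inv\<^bsub>A\<^esub> b, g, h) x = x"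
    "(y = \<beta> (b, h, \<one>\<^bsub>I\<^esub>) (\<beta> (\<one>\<^bsub>A\<^esub>, \<one>\<^bsub>H\<^esub>, i) y)) \<longleftrightarrow> \<beta> (b, h, i) y = y"
    if "b \<in> carrier A" "h \<in> carrier H" for b h
    using that xy u by (auto simp: X_rules Y_rules A.m_comm)
  have "tact (a, g, i) (tens x y) = tens x y \<longleftrightarrow>
      tens x y = tens (\<alpha> (a, g, \<one>\<^bsub>H\<^esub>) x) (\<beta> (\<one>\<^bsub>A\<^esub>, \<one>\<^bsub>H\<^esub>, i) y)"
    using xy u by (auto simp: tensor_action_orbit)
  also have "\<dots> \<longleftrightarrow> (\<exists>b\<in>carrier A. \<exists>h\<in>carrier H. \<alpha> (a \<otimes>\<^bsub>A\<^esub> inv\<^bsub>A\<^esub> b, g, h) x = x \<and> \<beta> (b, h, i) y = y)"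
    using xy u * by (subst tensor_orbit_eq_iff) (auto simp: X_rules Y_rules)
  also have "\<dots> \<longleftrightarrow> (\<exists>b\<in>carrier A. \<exists>h\<in>carrier H. \<alpha> (a \<otimes>\<^bsub>A\<^esub> b, g, h) x = x \<and> \<beta> (inv\<^bsub>A\<^esub> b, h, i) y = y)"
    by (metis A.inv_closed A.inv_inv)
  finally show ?thesis .
qed

end

text \<open>Taking images under \<open>f \<times> g\<close> maps orbits to orbits, preserves and reflects the stabilizer in \<open>A\<close>, and
  reaches exactly the orbits inside the image of \<open>f \<times> g\<close>. For bijections this is invariance of the
  tensor product under isomorphism; for the inclusions into a disjoint union it is distributivity.\<close>

lemma tensor_embedding:
  assumes X: "fibered_biset A G H (X, \<alpha>)" and Y: "fibered_biset A H I (Y, \<beta>)"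
    and X': "fibered_biset A G H (X', \<alpha>')" and Y': "fibered_biset A H I (Y', \<beta>')"
    and f: "fb_embedding A G H f (X, \<alpha>) (X', \<alpha>')" and g: "fb_embedding A H I g (Y, \<beta>) (Y', \<beta>')"
  shows "fb_embedding A G I ((`) (map_prod f g))
      (fb_tensor A G H I (X, \<alpha>) (Y, \<beta>)) (fb_tensor A G H I (X', \<alpha>') (Y', \<beta>'))"
    and "(`) (map_prod f g) ` fst (fb_tensor A G H I (X, \<alpha>) (Y, \<beta>)) =
      {\<omega> \<in> fst (fb_tensor A G H I (X', \<alpha>') (Y', \<beta>')). \<omega> \<subseteq> f ` X \<times> g ` Y}"
proof -
  let ?T = "tensor_points A G H I (X, \<alpha>) (Y, \<beta>)" and ?T' = "tensor_points A G H I (X', \<alpha>') (Y', \<beta>')"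
  let ?t = "tensor_orbit A G H I \<alpha> \<beta>" and ?t' = "tensor_orbit A G H I \<alpha>' \<beta>'"
  let ?m = "(`) (map_prod f g)"
  have f': "inj_on f X" "\<And>x. x \<in> X \<Longrightarrow> f x \<in> X'"
    "\<And>a g h x. \<lbrakk>a \<in> carrier A; g \<in> carrier G; h \<in> carrier H; x \<in> X\<rbrakk> \<Longrightarrow> f (\<alpha> (a, g, h) x) = \<alpha>' (a, g, h) (f x)"
    using f by (auto simp: fb_embedding_def)
  have g': "inj_on g Y" "\<And>y. y \<in> Y \<Longrightarrow> g y \<in> Y'"
    "\<And>a h i y. \<lbrakk>a \<in> carrier A; h \<in> carrier H; i \<in> carrier I; y \<in> Y\<rbrakk> \<Longrightarrow> g (\<beta> (a, h, i) y) = \<beta>' (a, h, i) (g y)"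
    using g by (auto simp: fb_embedding_def)
  note XR = act_closed[OF X] act_one[OF X] act_act[OF X]
  note YR = HI.act_closed[OF Y] HI.act_one[OF Y] HI.act_act[OF Y]
  have m: "?m (?t x y) = ?t' (f x) (g y)" if "x \<in> X" "y \<in> Y" for x y
    unfolding tensor_orbit_image[OF X Y] tensor_orbit_image[OF X' Y'] image_image using that
    by (intro image_cong refl) (auto simp: f' g')
  have inj: "inj_on ?m (Pow (X \<times> Y))"
    using f' g' by (intro inj_on_image_Pow map_prod_inj_on)
  have t_eq: "?t' (f x) (g y) = ?t' (f x') (g y') \<longleftrightarrow> ?t x y = ?t x' y'"
    if "x \<in> X" "y \<in> Y" "x' \<in> X" "y' \<in> Y" for x y x' y'
  proof -
    have "?t x y \<in> Pow (X \<times> Y)" "?t x' y' \<in> Pow (X \<times> Y)"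
      using that tensor_orbit_subset[OF X Y] by auto
    then show ?thesis using that inj by (simp only: m[symmetric] inj_on_eq_iff)
  qed
  have T_iff: "?t' (f x) (g y) \<in> ?T' \<longleftrightarrow> ?t x y \<in> ?T" if "x \<in> X" "y \<in> Y" for x y
  proof -
    have "(?t' (\<alpha>' (a, \<one>\<^bsub>G\<^esub>, \<one>\<^bsub>H\<^esub>) (f x)) (g y) = ?t' (f x) (g y)) \<longleftrightarrow>
        ?t (\<alpha> (a, \<one>\<^bsub>G\<^esub>, \<one>\<^bsub>H\<^esub>) x) y = ?t x y" if "a \<in> carrier A" for a
      using that \<open>x \<in> X\<close> \<open>y \<in> Y\<close> by (simp add: f'(3)[symmetric] t_eq XR)
    then show ?thesis
      using that f' g' by (simp add: tensor_points_iff[OF X Y] tensor_points_iff[OF X' Y'])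
  qed
  have T_sub: "?T \<subseteq> Pow (X \<times> Y)"
  proof
    fix \<omega> assume "\<omega> \<in> ?T"
    then obtain x y where "x \<in> X" "y \<in> Y" "\<omega> = ?t x y" by (rule tensor_pointsE[OF X Y])
    then show "\<omega> \<in> Pow (X \<times> Y)" using tensor_orbit_subset[OF X Y] by auto
  qed
  have m_T: "?m \<omega> \<in> ?T'" if "\<omega> \<in> ?T" for \<omega>
    using that
  proof (rule tensor_pointsE[OF X Y])
    fix x y assume xy: "x \<in> X" "y \<in> Y" "\<omega> = ?t x y"
    show ?thesis using that T_iff xy by (simp only: m)
  qed
  show "fb_embedding A G I ?m (fb_tensor A G H I (X, \<alpha>) (Y, \<beta>)) (fb_tensor A G H I (X', \<alpha>') (Y', \<beta>'))"
    unfolding fb_tensor_eq fb_embedding_def prod.case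
  proof (intro conjI ballI)
    show "inj_on ?m ?T" by (rule inj_on_subset[OF inj T_sub])
    show "?m ` ?T \<subseteq> ?T'" using m_T by blast
    fix u \<omega> assume "u \<in> carrier (A \<times>\<times> G \<times>\<times> I)" and \<omega>: "\<omega> \<in> ?T"
    then obtain a k i where u: "u = (a, k, i)" "a \<in> carrier A" "k \<in> carrier G" "i \<in> carrier I" by auto
    obtain x y where xy: "x \<in> X" "y \<in> Y" "\<omega> = ?t x y" using \<omega> by (rule tensor_pointsE[OF X Y])
    have "?m (tensor_action A H \<alpha> \<beta> u \<omega>) = ?t' (f (\<alpha> (a, k, \<one>\<^bsub>H\<^esub>) x)) (g (\<beta> (\<one>\<^bsub>A\<^esub>, \<one>\<^bsub>H\<^esub>, i) y))"
      using u xy by (simp only: tensor_action_orbit[OF X Y] m XR YR A.one_closed H.one_closed)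
    also have "\<dots> = tensor_action A H \<alpha>' \<beta>' u (?m \<omega>)"
      using u xy by (simp only: tensor_action_orbit[OF X' Y'] m f' g' A.one_closed H.one_closed)
    finally show "?m (restrict (tensor_action A H \<alpha> \<beta> u) ?T \<omega>) = restrict (tensor_action A H \<alpha>' \<beta>' u) ?T' (?m \<omega>)"
      using \<omega> m_T[OF \<omega>] by (simp only: restrict_apply')
  qed
  show "?m ` fst (fb_tensor A G H I (X, \<alpha>) (Y, \<beta>)) =
      {\<omega> \<in> fst (fb_tensor A G H I (X', \<alpha>') (Y', \<beta>')). \<omega> \<subseteq> f ` X \<times> g ` Y}"
    unfolding fb_tensor_eq fst_conv
  proof (intro equalityI subsetI CollectI conjI)
    fix \<omega>' assume "\<omega>' \<in> ?m ` ?T"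
    then obtain \<omega> where "\<omega>' = ?m \<omega>" "\<omega> \<in> ?T" by blast
    then show "\<omega>' \<in> ?T'" "\<And>p. p \<in> \<omega>' \<Longrightarrow> p \<in> f ` X \<times> g ` Y" using m_T T_sub by auto
  next
    fix \<omega>' assume "\<omega>' \<in> {\<omega> \<in> ?T'. \<omega> \<subseteq> f ` X \<times> g ` Y}"
    then have \<omega>': "\<omega>' \<in> ?T'" "\<omega>' \<subseteq> f ` X \<times> g ` Y" by auto
    obtain x' y' where xy': "x' \<in> X'" "y' \<in> Y'" "\<omega>' = ?t' x' y'" using \<omega>'(1) by (rule tensor_pointsE[OF X' Y'])
    then have "(x', y') \<in> f ` X \<times> g ` Y" using \<omega>'(2) tensor_orbit_self[OF X' Y'] by blast
    then obtain x y where xy: "x \<in> X" "y \<in> Y" "x' = f x" "y' = g y" by blast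
    then have "?t x y \<in> ?T" using T_iff \<omega>'(1) xy' by blast
    then show "\<omega>' \<in> ?m ` ?T" using m xy xy' by (intro image_eqI[of _ _ "?t x y"]) simp_all
  qed
qed

text \<open>A transitive tensor product: if the stabilizer of \<open>x\<close> projects onto \<open>H\<close>, there is only one double coset
  in the Mackey formula, so all elements are translates of the single element \<open>[x, y]\<close>.\<close>

lemma tensor_coset_iso:
  assumes X: "fibered_biset A G H (X, \<alpha>)" and Y: "fibered_biset A H I (Y, \<beta>)"
    and x: "x \<in> X" and X_trans: "\<And>x'. x' \<in> X \<Longrightarrow> \<exists>u\<in>carrier P. x' = \<alpha> u x"
    and y: "y \<in> Y" and Y_trans: "\<And>y'. y' \<in> Y \<Longrightarrow> \<exists>u\<in>carrier HI.P. y' = \<beta> u y"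
    and onto: "\<And>h. h \<in> carrier H \<Longrightarrow> \<exists>a\<in>carrier A. \<exists>g\<in>carrier G. \<alpha> (a, g, h) x = x"
    and S: "subgroup S GI.P" and S1: "\<And>a. (a, \<one>\<^bsub>G\<^esub>, \<one>\<^bsub>I\<^esub>) \<in> S \<Longrightarrow> a = \<one>\<^bsub>A\<^esub>"
    and S_iff: "\<And>a g i. \<lbrakk>a \<in> carrier A; g \<in> carrier G; i \<in> carrier I\<rbrakk> \<Longrightarrow> (a, g, i) \<in> S \<longleftrightarrow>
      (\<exists>b\<in>carrier A. \<exists>h\<in>carrier H. \<alpha> (a \<otimes>\<^bsub>A\<^esub> b, g, h) x = x \<and> \<beta> (inv\<^bsub>A\<^esub> b, h, i) y = y)"
  shows "fb_iso A G I (coset_biset GI.P S) (fb_tensor A G H I (X, \<alpha>) (Y, \<beta>))"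
proof -
  note XR = act_closed[OF X] act_one[OF X] act_act[OF X]
  note YR = HI.act_closed[OF Y] HI.act_one[OF Y] HI.act_act[OF Y]
  let ?t = "tensor_orbit A G H I \<alpha> \<beta>" and ?a = "tensor_action A H \<alpha> \<beta>"
  let ?T = "tensor_points A G H I (X, \<alpha>) (Y, \<beta>)"
  note act = tensor_action_orbit[OF X Y] and stab = tensor_stabilizer[OF X Y x y]
  have base: "?t x y \<in> ?T"
    unfolding tensor_points_iff[OF X Y x y]
  proof (intro ballI impI)
    fix a assume a: "a \<in> carrier A" "?t (\<alpha> (a, \<one>\<^bsub>G\<^esub>, \<one>\<^bsub>H\<^esub>) x) y = ?t x y"
    then have "?a (a, \<one>\<^bsub>G\<^esub>, \<one>\<^bsub>I\<^esub>) (?t x y) = ?t x y" using x y by (simp add: act YR)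
    then show "a = \<one>\<^bsub>A\<^esub>" using a(1) stab[of a "\<one>\<^bsub>G\<^esub>" "\<one>\<^bsub>I\<^esub>"] S_iff[of a "\<one>\<^bsub>G\<^esub>" "\<one>\<^bsub>I\<^esub>"] S1 by simp
  qed
  show ?thesis
    unfolding fb_tensor_eq
  proof (rule GI.coset_biset_iso[OF S fibered_tensor[OF X Y, unfolded fb_tensor_eq] base])
    show "stabilizer GI.P (\<lambda>u. restrict (?a u) ?T) (?t x y) = S"
    proof -
      have "restrict (?a u) ?T (?t x y) = ?t x y \<longleftrightarrow> u \<in> S" if P: "u \<in> carrier GI.P" for u
      proof -
        obtain a g i where u: "u = (a, g, i)" "a \<in> carrier A" "g \<in> carrier G" "i \<in> carrier I" using P by auto
        have "restrict (?a u) ?T (?t x y) = ?a u (?t x y)" using base by simp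
        then show ?thesis unfolding u(1) by (simp only: stab[OF u(2-4)] S_iff[OF u(2-4)])
      qed
      then show ?thesis unfolding stabilizer_def using subgroup.subset[OF S] by blast
    qed
    fix \<omega> assume "\<omega> \<in> ?T"
    then obtain x' y' where x': "x' \<in> X" and y': "y' \<in> Y" and \<omega>: "\<omega> = ?t x' y'" by (rule tensor_pointsE[OF X Y])
    obtain a g h where u: "a \<in> carrier A" "g \<in> carrier G" "h \<in> carrier H" "x' = \<alpha> (a, g, h) x"
      using X_trans[OF x'] by auto
    obtain b k i where v: "b \<in> carrier A" "k \<in> carrier H" "i \<in> carrier I" "y' = \<beta> (b, k, i) y"
      using Y_trans[OF y'] by auto
    have kh: "inv\<^bsub>H\<^esub> k \<otimes>\<^bsub>H\<^esub> h \<in> carrier H" using u v by simp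
    obtain c g' where c: "c \<in> carrier A" "g' \<in> carrier G" "\<alpha> (c, g', inv\<^bsub>H\<^esub> k \<otimes>\<^bsub>H\<^esub> h) x = x" using onto[OF kh] by blast
    \<comment> \<open>the element of \<open>H\<close> that separates the two factors is absorbed by the stabilizer of \<open>x\<close>\<close>
    let ?a' = "b \<otimes>\<^bsub>A\<^esub> a \<otimes>\<^bsub>A\<^esub> inv\<^bsub>A\<^esub> c" and ?g' = "g \<otimes>\<^bsub>G\<^esub> inv\<^bsub>G\<^esub> g'"
    have "\<alpha> (inv\<^bsub>A\<^esub> (inv\<^bsub>A\<^esub> b), \<one>\<^bsub>G\<^esub>, inv\<^bsub>H\<^esub> k) x' = \<alpha> (?a', ?g', \<one>\<^bsub>H\<^esub>) (\<alpha> (c, g', inv\<^bsub>H\<^esub> k \<otimes>\<^bsub>H\<^esub> h) x)"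
      using u v c(1,2) x by (simp add: XR A.m_assoc G.m_assoc)
    moreover have "\<beta> (inv\<^bsub>A\<^esub> b, inv\<^bsub>H\<^esub> k, \<one>\<^bsub>I\<^esub>) y' = \<beta> (\<one>\<^bsub>A\<^esub>, \<one>\<^bsub>H\<^esub>, i) y"
      using v y by (simp add: YR)
    moreover have "?t (\<alpha> (inv\<^bsub>A\<^esub> (inv\<^bsub>A\<^esub> b), \<one>\<^bsub>G\<^esub>, inv\<^bsub>H\<^esub> k) x') (\<beta> (inv\<^bsub>A\<^esub> b, inv\<^bsub>H\<^esub> k, \<one>\<^bsub>I\<^esub>) y') = ?t x' y'"
      using v x' y' by (intro tensor_orbit_shift[OF X Y]) auto
    ultimately have "\<omega> = ?t (\<alpha> (?a', ?g', \<one>\<^bsub>H\<^esub>) x) (\<beta> (\<one>\<^bsub>A\<^esub>, \<one>\<^bsub>H\<^esub>, i) y)"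
      using \<omega> c(3) by simp
    also have "\<dots> = ?a (?a', ?g', i) (?t x y)" using u v c x y by (simp add: act)
    finally show "\<exists>u\<in>carrier GI.P. \<omega> = restrict (?a u) ?T (?t x y)"
      using u v c base by (intro bexI[of _ "(?a', ?g', i)"]) auto
  qed
qed

end

section \<open>The Grothendieck group\<close>

interpretation pm: Modules.module "pm_scale :: 'k::comm_ring_1 \<Rightarrow> ('c \<Rightarrow>\<^sub>0 'k) \<Rightarrow> _"
  by (rule module_pm_scale)

lemma pm_scale_single: "pm_scale r (Poly_Mapping.single c s) = Poly_Mapping.single c (r * s)"
  by (rule poly_mapping_eqI) (simp add: lookup_pm_scale lookup_single when_def)

lemma subspace_fb_relations: "pm.subspace (fb_relations A G H)"
  unfolding fb_relations_def by (rule pm.subspace_span)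

lemma mem_fb_coset_iff: "p \<in> fb_coset A G H q \<longleftrightarrow> p - q \<in> fb_relations A G H"
  unfolding fb_coset_def image_iff by (metis add_diff_cancel_left' diff_add_cancel add.commute)

lemma fb_coset_eqI:
  assumes "p - q \<in> fb_relations A G H"
  shows "fb_coset A G H p = fb_coset A G H q"
proof (rule Set.set_eqI)
  fix r
  have "r - p \<in> fb_relations A G H \<longleftrightarrow> (r - p) + (p - q) \<in> fb_relations A G H"
    using assms pm.subspace_add[OF subspace_fb_relations] pm.subspace_diff[OF subspace_fb_relations]
    by (metis add_diff_cancel_right')
  then show "r \<in> fb_coset A G H p \<longleftrightarrow> r \<in> fb_coset A G H q" by (simp add: mem_fb_coset_iff)
qed

text \<open>Summing over a fixed finite set instead of the support makes the composition visibly bilinear.\<close>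

lemma free_comp_superset:
  assumes "finite E" "Poly_Mapping.keys p \<subseteq> E" "finite F" "Poly_Mapping.keys q \<subseteq> F"
  shows "free_comp A G H I p q = (\<Sum>c\<in>E. \<Sum>d\<in>F.
    Poly_Mapping.single (class_tensor A G H I c d) (Poly_Mapping.lookup p c * Poly_Mapping.lookup q d))"
proof -
  have "free_comp A G H I p q = (\<Sum>c\<in>Poly_Mapping.keys p. \<Sum>d\<in>F.
    Poly_Mapping.single (class_tensor A G H I c d) (Poly_Mapping.lookup p c * Poly_Mapping.lookup q d))"
    unfolding free_comp_def using assms by (intro sum.cong refl sum.mono_neutral_left) (auto simp: in_keys_iff)
  also have "\<dots> = (\<Sum>c\<in>E. \<Sum>d\<in>F.
    Poly_Mapping.single (class_tensor A G H I c d) (Poly_Mapping.lookup p c * Poly_Mapping.lookup q d))"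
    using assms by (intro sum.mono_neutral_left) (auto simp: in_keys_iff)
  finally show ?thesis .
qed

lemma free_comp_add_left:
  "free_comp A G H I (p + p') q = free_comp A G H I p q + free_comp A G H I p' q"
proof -
  let ?E = "Poly_Mapping.keys p \<union> Poly_Mapping.keys p'"
  have *: "finite ?E" "Poly_Mapping.keys p \<subseteq> ?E" "Poly_Mapping.keys p' \<subseteq> ?E" "Poly_Mapping.keys (p + p') \<subseteq> ?E"
    using keys_add[of p p'] by auto
  show ?thesis
    unfolding free_comp_superset[OF *(1,2) finite_keys order_refl] free_comp_superset[OF *(1,3) finite_keys order_refl]
      free_comp_superset[OF *(1,4) finite_keys order_refl]
    by (simp add: lookup_add distrib_right single_add sum.distrib)
qed

lemma free_comp_add_right:
  "free_comp A G H I p (q + q') = free_comp A G H I p q + free_comp A G H I p q'"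
proof -
  let ?E = "Poly_Mapping.keys q \<union> Poly_Mapping.keys q'"
  have *: "finite ?E" "Poly_Mapping.keys q \<subseteq> ?E" "Poly_Mapping.keys q' \<subseteq> ?E" "Poly_Mapping.keys (q + q') \<subseteq> ?E"
    using keys_add[of q q'] by auto
  show ?thesis
    unfolding free_comp_superset[OF finite_keys order_refl *(1,2)] free_comp_superset[OF finite_keys order_refl *(1,3)]
      free_comp_superset[OF finite_keys order_refl *(1,4)]
    by (simp add: lookup_add distrib_left single_add sum.distrib)
qed

lemma pm_scale_sum: "pm_scale r (\<Sum>x\<in>S. f x) = (\<Sum>x\<in>S. pm_scale r (f x))"
  by (rule pm.scale_sum_right)

lemma keys_pm_scale: "Poly_Mapping.keys (pm_scale r p) \<subseteq> Poly_Mapping.keys p"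
  by (auto simp: in_keys_iff lookup_pm_scale)

lemma free_comp_scale_left:
  "free_comp A G H I (pm_scale r p) q = pm_scale r (free_comp A G H I p q)"
  unfolding free_comp_superset[where p = "pm_scale r p", OF finite_keys keys_pm_scale finite_keys order_refl]
  by (simp add: free_comp_def pm_scale_sum pm_scale_single lookup_pm_scale mult.assoc)

lemma free_comp_scale_right:
  "free_comp A G H I p (pm_scale r q) = pm_scale r (free_comp A G H I p q)"
  unfolding free_comp_superset[where q = "pm_scale r q", OF finite_keys order_refl finite_keys keys_pm_scale]
  by (simp add: free_comp_def pm_scale_sum pm_scale_single lookup_pm_scale mult.left_commute)

lemma free_comp_minus_left: "free_comp A G H I (p - p') q = free_comp A G H I p q - free_comp A G H I p' q"
  using free_comp_add_left[of A G H I "p - p'" p' q] by simp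

lemma free_comp_minus_right: "free_comp A G H I p (q - q') = free_comp A G H I p q - free_comp A G H I p q'"
  using free_comp_add_right[of A G H I p "q - q'" q'] by simp

lemma free_comp_single_left:
  "free_comp A G H I (Poly_Mapping.single c 1) q =
    (\<Sum>d\<in>Poly_Mapping.keys q. pm_scale (Poly_Mapping.lookup q d) (Poly_Mapping.single (class_tensor A G H I c d) 1))"
  by (subst free_comp_superset[where E = "{c}" and F = "Poly_Mapping.keys q"]) (auto simp: pm_scale_single)

lemma free_comp_single_right:
  "free_comp A G H I p (Poly_Mapping.single d 1) =
    (\<Sum>c\<in>Poly_Mapping.keys p. pm_scale (Poly_Mapping.lookup p c) (Poly_Mapping.single (class_tensor A G H I c d) 1))"
  by (subst free_comp_superset[where E = "Poly_Mapping.keys p" and F = "{d}"]) (auto simp: pm_scale_single)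

context fiber_groups
begin

lemma fibered_disjoint_union:
  assumes X: "fibered_biset A G H (X, \<alpha>)" and Y: "fibered_biset A G H (Y, \<beta>)"
  shows "fibered_biset A G H (fb_disjoint_union (X, \<alpha>) (Y, \<beta>))"
proof -
  obtain E where E: "finite E" "E \<subseteq> X" "\<And>x. x \<in> X \<Longrightarrow> \<exists>a\<in>carrier A. \<exists>f\<in>E. x = \<alpha> (a, \<one>\<^bsub>G\<^esub>, \<one>\<^bsub>H\<^esub>) f"
    using finite_reps[OF X] by metis
  obtain F where F: "finite F" "F \<subseteq> Y" "\<And>x. x \<in> Y \<Longrightarrow> \<exists>a\<in>carrier A. \<exists>f\<in>F. x = \<beta> (a, \<one>\<^bsub>G\<^esub>, \<one>\<^bsub>H\<^esub>) f"
    using finite_reps[OF Y] by metis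
  let ?\<gamma> = "\<lambda>u. restrict (map_sum (\<alpha> u) (\<beta> u)) (X <+> Y)"
  have reps: "\<exists>a\<in>carrier A. \<exists>f\<in>E <+> F. z = ?\<gamma> (a, \<one>\<^bsub>G\<^esub>, \<one>\<^bsub>H\<^esub>) f" if "z \<in> X <+> Y" for z
    using that
  proof (elim PlusE)
    fix x assume "x \<in> X" "z = Inl x"
    moreover obtain a r where "a \<in> carrier A" "r \<in> E" "x = \<alpha> (a, \<one>\<^bsub>G\<^esub>, \<one>\<^bsub>H\<^esub>) r" using E(3) \<open>x \<in> X\<close> by blast
    ultimately show ?thesis using E(2) by (intro bexI[of _ a] bexI[of _ "Inl r"]) auto
  next
    fix x assume "x \<in> Y" "z = Inr x"
    moreover obtain a r where "a \<in> carrier A" "r \<in> F" "x = \<beta> (a, \<one>\<^bsub>G\<^esub>, \<one>\<^bsub>H\<^esub>) r" using F(3) \<open>x \<in> Y\<close> by blast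
    ultimately show ?thesis using F(2) by (intro bexI[of _ a] bexI[of _ "Inr r"]) auto
  qed
  have "E <+> F \<subseteq> X <+> Y" using E(2) F(2) by auto
  then show ?thesis
    unfolding fb_disjoint_union_def prod.case using E(1) F(1)
    by (intro fibered_bisetI[where F = "E <+> F"] reps)
      (auto simp: act_closed[OF X] act_one[OF X] act_act[OF X] act_closed[OF Y] act_one[OF Y] act_act[OF Y]
        dest: act_free[OF X] act_free[OF Y])
qed

lemma fb_iso_disjoint_union:
  assumes W: "fibered_biset A G H (W, \<gamma>)"
    and X: "fb_embedding A G H f (X, \<alpha>) (W, \<gamma>)" and Y: "fb_embedding A G H g (Y, \<beta>) (W, \<gamma>)"
    and disj: "f ` X \<inter> g ` Y = {}" and cover: "W \<subseteq> f ` X \<union> g ` Y"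
  shows "fb_iso A G H (fb_disjoint_union (X, \<alpha>) (Y, \<beta>)) (W, \<gamma>)"
proof -
  have inj: "inj_on f X" "inj_on g Y" using X Y by (simp_all add: fb_embedding_def)
  have "inj_on (case_sum f g) (X <+> Y)"
  proof (rule inj_onI)
    fix z w assume "z \<in> X <+> Y" "w \<in> X <+> Y" "case_sum f g z = case_sum f g w"
    then show "z = w"
      by (elim PlusE) (use disj inj_onD[OF inj(1)] inj_onD[OF inj(2)] in force)+
  qed
  moreover have "case_sum f g ` (X <+> Y) = W"
  proof -
    have "case_sum f g ` (X <+> Y) = f ` X \<union> g ` Y" by (auto simp: Plus_def image_Un image_image)
    then show ?thesis using X Y cover by (auto simp: fb_embedding_def)
  qed
  moreover have "case_sum f g (restrict (map_sum (\<alpha> u) (\<beta> u)) (X <+> Y) z) = \<gamma> u (case_sum f g z)"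
    if "u \<in> carrier P" "z \<in> X <+> Y" for u z
    using that X Y by (auto simp: fb_embedding_def)
  ultimately show ?thesis
    unfolding fb_iso_def fb_disjoint_union_def prod.case bij_betw_def by blast
qed

text \<open>The defining relations only concern bisets on \<open>'a \<times> nat\<close>. Passing to representatives gives the
  relation for every decomposition of a biset of any type into two invariant subsets.\<close>

lemma fb_gen_split:
  assumes W: "fibered_biset A G H W" and X: "fibered_biset A G H X" and Y: "fibered_biset A G H Y"
    and f: "fb_embedding A G H f X W" and g: "fb_embedding A G H g Y W"
    and disj: "f ` fst X \<inter> g ` fst Y = {}" and cover: "fst W \<subseteq> f ` fst X \<union> g ` fst Y"
  shows "(fb_gen A G H W - fb_gen A G H X - fb_gen A G H Y :: _ \<Rightarrow>\<^sub>0 'k::comm_ring_1) \<in> fb_relations A G H"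
proof -
  obtain X' :: "('a \<times> nat, 'a, 'g, 'h) actset" where X': "fibered_biset A G H X'" "fb_iso A G H X X'"
    using ex_representative[OF X] .
  obtain Y' :: "('a \<times> nat, 'a, 'g, 'h) actset" where Y': "fibered_biset A G H Y'" "fb_iso A G H Y Y'"
    using ex_representative[OF Y] .
  obtain h where h: "fb_embedding A G H h X' X" "h ` fst X' = fst X"
    using fb_iso_sym[OF X X'(2)] by (auto simp: fb_iso_iff_embedding)
  obtain k where k: "fb_embedding A G H k Y' Y" "k ` fst Y' = fst Y"
    using fb_iso_sym[OF Y Y'(2)] by (auto simp: fb_iso_iff_embedding)
  have im: "(f \<circ> h) ` fst X' = f ` fst X" "(g \<circ> k) ` fst Y' = g ` fst Y"
    unfolding h(2)[symmetric] k(2)[symmetric] by (simp_all only: image_comp)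
  have D: "fibered_biset A G H (fb_disjoint_union X' Y')"
    using X'(1) Y'(1) by (cases X'; cases Y') (simp add: fibered_disjoint_union)
  have "fb_iso A G H (fb_disjoint_union X' Y') W"
    using fb_iso_disjoint_union[of "fst W" "snd W" "f \<circ> h" "fst X'" "snd X'" "g \<circ> k" "fst Y'" "snd Y'"]
      W disj cover fb_embedding_comp[OF h(1) f] fb_embedding_comp[OF k(1) g] im by (simp only: prod.collapse)
  then have "fb_gen A G H W = (fb_gen A G H (fb_disjoint_union X' Y') :: _ \<Rightarrow>\<^sub>0 'k)"
    unfolding fb_gen_def using fb_class_of_eqI[OF D, of W] by metis
  moreover have "fb_gen A G H X = (fb_gen A G H X' :: _ \<Rightarrow>\<^sub>0 'k)"
    "fb_gen A G H Y = (fb_gen A G H Y' :: _ \<Rightarrow>\<^sub>0 'k)"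
    unfolding fb_gen_def using fb_class_of_eqI[OF X X'(2)] fb_class_of_eqI[OF Y Y'(2)] by simp_all
  ultimately show ?thesis
    unfolding fb_relations_def using X'(1) Y'(1) by (intro pm.span_base) (simp only: mem_Collect_eq, blast)
qed

lemma fb_class_of_nonempty:
  assumes X: "fibered_biset A G H X"
  shows "fb_class_of A G H X \<noteq> {}"
proof -
  obtain Y :: "('a \<times> nat, 'a, 'g, 'h) actset" where "fibered_biset A G H Y" "fb_iso A G H X Y"
    using ex_representative[OF X] .
  then show ?thesis unfolding fb_class_of_def by blast
qed

lemma fb_gen_in_free: "fibered_biset A G H X \<Longrightarrow> fb_gen A G H X \<in> fb_free A G H"
  by (simp add: fb_gen_def fb_free_def fb_class_of_in_classes)

end

lemma disjoint_union_embeddings: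
  "fb_embedding A G H Inl (X, \<alpha>) (fb_disjoint_union (X, \<alpha>) (Y, \<beta>))"
  "fb_embedding A G H Inr (Y, \<beta>) (fb_disjoint_union (X, \<alpha>) (Y, \<beta>))"
  by (auto simp: fb_embedding_def fb_disjoint_union_def)

context fiber_groups3
begin

lemma fb_iso_tensor:
  assumes X: "fibered_biset A G H X" "fibered_biset A G H X'" and Y: "fibered_biset A H I Y" "fibered_biset A H I Y'"
    and iso: "fb_iso A G H X X'" "fb_iso A H I Y Y'"
  shows "fb_iso A G I (fb_tensor A G H I X Y) (fb_tensor A G H I X' Y')"
proof -
  obtain X1 \<alpha> X1' \<alpha>' Y1 \<beta> Y1' \<beta>' where eqs: "X = (X1, \<alpha>)" "X' = (X1', \<alpha>')" "Y = (Y1, \<beta>)" "Y' = (Y1', \<beta>')"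
    by (metis surj_pair)
  obtain f g where f: "fb_embedding A G H f (X1, \<alpha>) (X1', \<alpha>')" "f ` X1 = X1'"
    and g: "fb_embedding A H I g (Y1, \<beta>) (Y1', \<beta>')" "g ` Y1 = Y1'"
    using iso unfolding eqs fb_iso_iff_embedding by auto
  note emb = tensor_embedding[OF X(1)[unfolded eqs] Y(1)[unfolded eqs] X(2)[unfolded eqs] Y(2)[unfolded eqs] f(1) g(1)]
  have "\<omega> \<subseteq> X1' \<times> Y1'" if \<omega>: "\<omega> \<in> fst (fb_tensor A G H I X' Y')" for \<omega>
  proof -
    have "\<omega> \<in> tensor_points A G H I (X1', \<alpha>') (Y1', \<beta>')" using \<omega> by (simp add: eqs fb_tensor_eq)
    then obtain x y where "x \<in> X1'" "y \<in> Y1'" "\<omega> = tensor_orbit A G H I \<alpha>' \<beta>' x y"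
      by (rule tensor_pointsE[OF X(2)[unfolded eqs] Y(2)[unfolded eqs]])
    then show ?thesis using tensor_orbit_subset[OF X(2)[unfolded eqs] Y(2)[unfolded eqs]] by simp
  qed
  then show ?thesis
    unfolding fb_iso_iff_embedding using emb(1) emb(2)[unfolded f(2) g(2)] unfolding eqs
    by (intro exI[of _ "(`) (map_prod f g)"] conjI) auto
qed

lemma class_tensor_class_of:
  assumes X: "fibered_biset A G H X" and Y: "fibered_biset A H I Y"
  shows "class_tensor A G H I (fb_class_of A G H X) (fb_class_of A H I Y) = fb_class_of A G I (fb_tensor A G H I X Y)"
proof -
  have T: "fibered_biset A G I (fb_tensor A G H I X Y)"
    using X Y by (cases X; cases Y) (simp add: fibered_tensor)
  have "fb_class_of A G I (fb_tensor A G H I X' Y') = fb_class_of A G I (fb_tensor A G H I X Y)"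
    if "X' \<in> fb_class_of A G H X" "Y' \<in> fb_class_of A H I Y" for X' Y'
    using GI.fb_class_of_eqI[OF T fb_iso_tensor[OF X _ Y _], of X' Y'] that unfolding fb_class_of_def by blast
  moreover have "fb_class_of A G H X \<noteq> {}" by (rule fb_class_of_nonempty[OF X])
  moreover have "fb_class_of A H I Y \<noteq> {}" by (rule HI.fb_class_of_nonempty[OF Y])
  ultimately show ?thesis unfolding class_tensor_def by simp
qed

text \<open>Stated for two pairs of embeddings so that additivity in the left factor and in the right factor are
  both instances. The tensor orbit of a point in one of the two pieces stays in that piece.\<close>

lemma tensor_split:
  assumes W: "fibered_biset A G H W" and V: "fibered_biset A H I V"
    and X: "fibered_biset A G H X" "fibered_biset A G H X'"
    and Y: "fibered_biset A H I Y" "fibered_biset A H I Y'"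
    and f: "fb_embedding A G H f X W" "fb_embedding A G H f' X' W"
    and g: "fb_embedding A H I g Y V" "fb_embedding A H I g' Y' V"
    and disj: "(f ` fst X \<times> g ` fst Y) \<inter> (f' ` fst X' \<times> g' ` fst Y') = {}"
    and cover: "fst W \<times> fst V \<subseteq> (f ` fst X \<times> g ` fst Y) \<union> (f' ` fst X' \<times> g' ` fst Y')"
  shows "(fb_gen A G I (fb_tensor A G H I W V) - fb_gen A G I (fb_tensor A G H I X Y) -
      fb_gen A G I (fb_tensor A G H I X' Y') :: _ \<Rightarrow>\<^sub>0 'k::comm_ring_1) \<in> fb_relations A G I"
proof -
  obtain W1 \<gamma> V1 \<delta> X1 \<alpha> X1' \<alpha>' Y1 \<beta> Y1' \<beta>'
    where eqs: "W = (W1, \<gamma>)" "V = (V1, \<delta>)" "X = (X1, \<alpha>)" "X' = (X1', \<alpha>')" "Y = (Y1, \<beta>)" "Y' = (Y1', \<beta>')"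
    by (metis surj_pair)
  note [unfolded eqs] = W V X Y f g disj cover
  note W = this(1) and V = this(2) and X = this(3,4) and Y = this(5,6) and f = this(7,8) and g = this(9,10)
    and disj = this(11)[unfolded fst_conv] and cover = this(12)[unfolded fst_conv]
  note emb = tensor_embedding[OF X(1) Y(1) W V f(1) g(1)] tensor_embedding[OF X(2) Y(2) W V f(2) g(2)]
  let ?T = "tensor_points A G H I (W1, \<gamma>) (V1, \<delta>)"
  have mem: "tensor_orbit A G H I \<gamma> \<delta> w v \<subseteq> h ` Z \<times> k ` Z'"
    if Z: "fibered_biset A G H (Z, \<zeta>)" "fb_embedding A G H h (Z, \<zeta>) (W1, \<gamma>)"
      and Z': "fibered_biset A H I (Z', \<eta>)" "fb_embedding A H I k (Z', \<eta>) (V1, \<delta>)"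
      and wv: "(w, v) \<in> h ` Z \<times> k ` Z'" for h Z \<zeta> k Z' \<eta> w v
  proof
    obtain z z' where z: "z \<in> Z" "z' \<in> Z'" "w = h z" "v = k z'" using wv by auto
    fix p assume "p \<in> tensor_orbit A G H I \<gamma> \<delta> w v"
    then obtain b c where bc: "b \<in> carrier A" "c \<in> carrier H" "p = (\<gamma> (inv\<^bsub>A\<^esub> b, \<one>\<^bsub>G\<^esub>, c) w, \<delta> (b, c, \<one>\<^bsub>I\<^esub>) v)"
      unfolding mem_tensor_orbit[OF W V] by blast
    then have "\<gamma> (inv\<^bsub>A\<^esub> b, \<one>\<^bsub>G\<^esub>, c) w = h (\<zeta> (inv\<^bsub>A\<^esub> b, \<one>\<^bsub>G\<^esub>, c) z)" "\<delta> (b, c, \<one>\<^bsub>I\<^esub>) v = k (\<eta> (b, c, \<one>\<^bsub>I\<^esub>) z')"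
      using z Z(2) Z'(2) by (simp_all add: fb_embedding_def)
    moreover have "\<zeta> (inv\<^bsub>A\<^esub> b, \<one>\<^bsub>G\<^esub>, c) z \<in> Z" "\<eta> (b, c, \<one>\<^bsub>I\<^esub>) z' \<in> Z'"
      using z bc by (simp_all add: act_closed[OF Z(1)] HI.act_closed[OF Z'(1)])
    ultimately show "p \<in> h ` Z \<times> k ` Z'" using bc(3) by simp
  qed
  have nonempty: "\<omega> \<noteq> {}" if "\<omega> \<in> ?T" for \<omega>
    using that by (rule tensor_pointsE[OF W V]) (use tensor_orbit_self[OF W V] in blast)
  show ?thesis
    unfolding eqs
  proof (rule GI.fb_gen_split[OF fibered_tensor[OF W V] fibered_tensor[OF X(1) Y(1)] fibered_tensor[OF X(2) Y(2)] emb(1) emb(3)])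
    show "(`) (map_prod f g) ` fst (fb_tensor A G H I (X1, \<alpha>) (Y1, \<beta>)) \<inter>
        (`) (map_prod f' g') ` fst (fb_tensor A G H I (X1', \<alpha>') (Y1', \<beta>')) = {}"
      unfolding emb(2,4) unfolding fb_tensor_eq fst_conv
    proof (rule equals0I)
      fix \<omega> assume "\<omega> \<in> {\<omega> \<in> ?T. \<omega> \<subseteq> f ` X1 \<times> g ` Y1} \<inter> {\<omega> \<in> ?T. \<omega> \<subseteq> f' ` X1' \<times> g' ` Y1'}"
      then have \<omega>: "\<omega> \<in> ?T" "\<omega> \<subseteq> (f ` X1 \<times> g ` Y1) \<inter> (f' ` X1' \<times> g' ` Y1')"
        by auto
      then show False using nonempty[OF \<omega>(1)] disj by simp
    qed
    show "fst (fb_tensor A G H I (W1, \<gamma>) (V1, \<delta>)) \<subseteq>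
        (`) (map_prod f g) ` fst (fb_tensor A G H I (X1, \<alpha>) (Y1, \<beta>)) \<union>
        (`) (map_prod f' g') ` fst (fb_tensor A G H I (X1', \<alpha>') (Y1', \<beta>'))"
      unfolding emb(2,4) unfolding fb_tensor_eq fst_conv
    proof
      fix \<omega> assume \<omega>: "\<omega> \<in> ?T"
      obtain w v where wv: "w \<in> W1" "v \<in> V1" "\<omega> = tensor_orbit A G H I \<gamma> \<delta> w v"
        using \<omega> by (rule tensor_pointsE[OF W V])
      have "(w, v) \<in> f ` X1 \<times> g ` Y1 \<or> (w, v) \<in> f' ` X1' \<times> g' ` Y1'" using wv cover by blast
      then have "\<omega> \<subseteq> f ` X1 \<times> g ` Y1 \<or> \<omega> \<subseteq> f' ` X1' \<times> g' ` Y1'"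
        using mem[OF X(1) f(1) Y(1) g(1)] mem[OF X(2) f(2) Y(2) g(2)] wv(3) by blast
      then show "\<omega> \<in> {\<omega> \<in> ?T. \<omega> \<subseteq> f ` X1 \<times> g ` Y1} \<union> {\<omega> \<in> ?T. \<omega> \<subseteq> f' ` X1' \<times> g' ` Y1'}"
        using \<omega> by blast
    qed
  qed
qed

lemma tensor_disjoint_union_left:
  assumes X: "fibered_biset A G H X" "fibered_biset A G H X'" and Y: "fibered_biset A H I Y"
  shows "(fb_gen A G I (fb_tensor A G H I (fb_disjoint_union X X') Y) - fb_gen A G I (fb_tensor A G H I X Y) -
      fb_gen A G I (fb_tensor A G H I X' Y) :: _ \<Rightarrow>\<^sub>0 'k::comm_ring_1) \<in> fb_relations A G I"
proof (rule tensor_split[where f = Inl and f' = Inr and g = id and g' = id])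
  show "fibered_biset A G H (fb_disjoint_union X X')"
    using X by (cases X; cases X') (simp add: fibered_disjoint_union)
  show "fb_embedding A G H Inl X (fb_disjoint_union X X')" "fb_embedding A G H Inr X' (fb_disjoint_union X X')"
    by (cases X; cases X'; simp only: disjoint_union_embeddings)+
  show "fb_embedding A H I id Y Y" "fb_embedding A H I id Y Y" by (cases Y; simp add: fb_embedding_def)+
  show "fst (fb_disjoint_union X X') \<times> fst Y \<subseteq> Inl ` fst X \<times> id ` fst Y \<union> Inr ` fst X' \<times> id ` fst Y"
    by (cases X; cases X') (auto simp: fb_disjoint_union_def)
qed (use assms in auto)

lemma tensor_disjoint_union_right:
  assumes X: "fibered_biset A G H X" and Y: "fibered_biset A H I Y" "fibered_biset A H I Y'"
  shows "(fb_gen A G I (fb_tensor A G H I X (fb_disjoint_union Y Y')) - fb_gen A G I (fb_tensor A G H I X Y) -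
      fb_gen A G I (fb_tensor A G H I X Y') :: _ \<Rightarrow>\<^sub>0 'k::comm_ring_1) \<in> fb_relations A G I"
proof (rule tensor_split[where f = id and f' = id and g = Inl and g' = Inr])
  show "fibered_biset A H I (fb_disjoint_union Y Y')"
    using Y by (cases Y; cases Y') (simp add: HI.fibered_disjoint_union)
  show "fb_embedding A H I Inl Y (fb_disjoint_union Y Y')" "fb_embedding A H I Inr Y' (fb_disjoint_union Y Y')"
    by (cases Y; cases Y'; simp only: disjoint_union_embeddings)+
  show "fb_embedding A G H id X X" "fb_embedding A G H id X X" by (cases X; simp add: fb_embedding_def)+
  show "fst X \<times> fst (fb_disjoint_union Y Y') \<subseteq> id ` fst X \<times> Inl ` fst Y \<union> id ` fst X \<times> Inr ` fst Y'"
    by (cases Y; cases Y') (auto simp: fb_disjoint_union_def)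
qed (use assms in auto)

text \<open>Together with \<open>free_comp_relations_right\<close>: the composition of representatives depends only on their
  cosets.\<close>

lemma free_comp_relations_left:
  assumes r: "r \<in> fb_relations A G H" and q: "q \<in> fb_free A H I"
  shows "free_comp A G H I r q \<in> fb_relations A G I"
proof -
  note S = subspace_fb_relations[of A G I]
  have "pm.subspace {r. free_comp A G H I r q \<in> fb_relations A G I}"
    unfolding pm.subspace_def mem_Collect_eq
    by (auto simp: free_comp_add_left free_comp_scale_left pm.subspace_add[OF S] pm.subspace_scale[OF S])
      (simp add: free_comp_def pm.subspace_0[OF S])
  moreover have "free_comp A G H I (fb_gen A G H (fb_disjoint_union X X') - fb_gen A G H X - fb_gen A G H X') q
      \<in> fb_relations A G I"
    if X: "fibered_biset A G H X" "fibered_biset A G H X'" for X X'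
  proof -
    have D: "fibered_biset A G H (fb_disjoint_union X X')"
      using X by (cases X; cases X') (simp add: fibered_disjoint_union)
    let ?g = "\<lambda>X d. Poly_Mapping.single (class_tensor A G H I (fb_class_of A G H X) d) 1"
    have "?g (fb_disjoint_union X X') d - ?g X d - ?g X' d \<in> fb_relations A G I" if d: "d \<in> Poly_Mapping.keys q" for d
    proof -
      obtain Y :: "('a \<times> nat, 'a, 'h, 'i) actset" where Y: "fibered_biset A H I Y" "d = fb_class_of A H I Y"
        using d q by (auto simp: fb_free_def fb_classes_def)
      show ?thesis
        unfolding Y(2) class_tensor_class_of[OF D Y(1)] class_tensor_class_of[OF X(1) Y(1)]
          class_tensor_class_of[OF X(2) Y(1)]
        using tensor_disjoint_union_left[OF X Y(1)] unfolding fb_gen_def .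
    qed
    then have "(\<Sum>d\<in>Poly_Mapping.keys q. pm_scale (Poly_Mapping.lookup q d) (?g (fb_disjoint_union X X') d - ?g X d - ?g X' d))
        \<in> fb_relations A G I"
      by (intro pm.subspace_sum[OF S] pm.subspace_scale[OF S])
    then show ?thesis
      by (simp add: fb_gen_def free_comp_minus_left free_comp_single_left sum_subtractf pm.scale_right_diff_distrib)
  qed
  ultimately show ?thesis
    using r unfolding fb_relations_def[of A G H] by (rule_tac pm.span_induct) auto
qed

lemma free_comp_relations_right:
  assumes p: "p \<in> fb_free A G H" and r: "r \<in> fb_relations A H I"
  shows "free_comp A G H I p r \<in> fb_relations A G I"
proof -
  note S = subspace_fb_relations[of A G I]
  have "pm.subspace {r. free_comp A G H I p r \<in> fb_relations A G I}"
    unfolding pm.subspace_def mem_Collect_eq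
    by (auto simp: free_comp_add_right free_comp_scale_right pm.subspace_add[OF S] pm.subspace_scale[OF S])
      (simp add: free_comp_def pm.subspace_0[OF S])
  moreover have "free_comp A G H I p (fb_gen A H I (fb_disjoint_union Y Y') - fb_gen A H I Y - fb_gen A H I Y')
      \<in> fb_relations A G I"
    if Y: "fibered_biset A H I Y" "fibered_biset A H I Y'" for Y Y'
  proof -
    have D: "fibered_biset A H I (fb_disjoint_union Y Y')"
      using Y by (cases Y; cases Y') (simp add: HI.fibered_disjoint_union)
    let ?g = "\<lambda>Y c. Poly_Mapping.single (class_tensor A G H I c (fb_class_of A H I Y)) 1"
    have "?g (fb_disjoint_union Y Y') c - ?g Y c - ?g Y' c \<in> fb_relations A G I" if c: "c \<in> Poly_Mapping.keys p" for c
    proof -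
      obtain X :: "('a \<times> nat, 'a, 'g, 'h) actset" where X: "fibered_biset A G H X" "c = fb_class_of A G H X"
        using c p by (auto simp: fb_free_def fb_classes_def)
      show ?thesis
        unfolding X(2) class_tensor_class_of[OF X(1) D] class_tensor_class_of[OF X(1) Y(1)]
          class_tensor_class_of[OF X(1) Y(2)]
        using tensor_disjoint_union_right[OF X(1) Y] unfolding fb_gen_def .
    qed
    then have "(\<Sum>c\<in>Poly_Mapping.keys p. pm_scale (Poly_Mapping.lookup p c) (?g (fb_disjoint_union Y Y') c - ?g Y c - ?g Y' c))
        \<in> fb_relations A G I"
      by (intro pm.subspace_sum[OF S] pm.subspace_scale[OF S])
    then show ?thesis
      by (simp add: fb_gen_def free_comp_minus_right free_comp_single_right sum_subtractf pm.scale_right_diff_distrib)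
  qed
  ultimately show ?thesis
    using r unfolding fb_relations_def[of A H I] by (rule_tac pm.span_induct) auto
qed

text \<open>All cosets in the union that defines \<open>fb_comp\<close> coincide.\<close>

lemma fb_comp_elem:
  assumes X: "fibered_biset A G H X" and Y: "fibered_biset A H I Y"
  shows "fb_comp A G H I (fb_elem A G H X) (fb_elem A H I Y) =
    (fb_elem A G I (fb_tensor A G H I X Y) :: (_ \<Rightarrow>\<^sub>0 'k::comm_ring_1) set)"
proof -
  have gen: "free_comp A G H I (fb_gen A G H X) (fb_gen A H I Y) =
      (fb_gen A G I (fb_tensor A G H I X Y) :: _ \<Rightarrow>\<^sub>0 'k)"
    by (simp add: fb_gen_def free_comp_single_left pm_scale_single class_tensor_class_of[OF X Y])
  have "fb_coset A G I (free_comp A G H I p q) = fb_elem A G I (fb_tensor A G H I X Y)"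
    if p: "p \<in> fb_elem A G H X" "p \<in> fb_free A G H" and q: "q \<in> fb_elem A H I Y" "q \<in> fb_free A H I"
    for p q :: "_ \<Rightarrow>\<^sub>0 'k"
  proof -
    have "free_comp A G H I p q - free_comp A G H I (fb_gen A G H X) (fb_gen A H I Y) =
        free_comp A G H I (p - fb_gen A G H X) q + free_comp A G H I (fb_gen A G H X) (q - fb_gen A H I Y)"
      by (simp add: free_comp_minus_left free_comp_minus_right)
    moreover have "\<dots> \<in> fb_relations A G I"
      using p q fb_gen_in_free[OF X]
      by (intro pm.subspace_add[OF subspace_fb_relations] free_comp_relations_left free_comp_relations_right)
        (auto simp: fb_elem_def mem_fb_coset_iff)
    ultimately show ?thesis unfolding fb_elem_def by (intro fb_coset_eqI) (simp add: gen)
  qed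
  moreover have "fb_gen A G H X \<in> fb_elem A G H X \<inter> (fb_free A G H :: (_ \<Rightarrow>\<^sub>0 'k) set)"
    "fb_gen A H I Y \<in> fb_elem A H I Y \<inter> (fb_free A H I :: (_ \<Rightarrow>\<^sub>0 'k) set)"
    using X Y by (simp_all add: fb_elem_def mem_fb_coset_iff pm.subspace_0[OF subspace_fb_relations]
        fb_gen_in_free HI.fb_gen_in_free)
  ultimately show ?thesis unfolding fb_comp_def by blast
qed

end

lemma (in fiber_groups) fb_elem_in_module: "fibered_biset A G H X \<Longrightarrow> fb_elem A G H X \<in> fb_module A G H"
  by (simp add: fb_elem_def fb_module_def fb_gen_in_free)

lemma (in fiber_groups) fb_elem_eqI:
  assumes "fibered_biset A G H X" and "fb_iso A G H X Y"
  shows "fb_elem A G H X = fb_elem A G H Y"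
  using fb_class_of_eqI[OF assms] by (simp add: fb_elem_def fb_gen_def)

section \<open>Counting orbits with a given stabilizer\<close>

text \<open>The orbits that contain a point with stabilizer equal to \<open>S\<close>; conjugate stabilizers on the same orbit
  are harmless because the orbit is counted once.\<close>

definition marked_orbits ::
  "'a monoid \<Rightarrow> 'g monoid \<Rightarrow> 'h monoid \<Rightarrow> ('a \<times> 'g \<times> 'h) set \<Rightarrow> ('x, 'a, 'g, 'h) actset \<Rightarrow> 'x set set" where
  "marked_orbits A G H S = (\<lambda>(X, \<alpha>).
     orbit (A \<times>\<times> G \<times>\<times> H) \<alpha> ` {x \<in> X. stabilizer (A \<times>\<times> G \<times>\<times> H) \<alpha> x = S})"

definition marks ::
  "'a monoid \<Rightarrow> 'g monoid \<Rightarrow> 'h monoid \<Rightarrow> ('a \<times> 'g \<times> 'h) set \<Rightarrow> ('x, 'a, 'g, 'h) actset \<Rightarrow> nat" where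
  "marks A G H S X = card (marked_orbits A G H S X)"

text \<open>On a class of fibered bisets the choice of representative does not matter, by \<open>marks_iso\<close>.\<close>

definition class_marks ::
  "'a monoid \<Rightarrow> 'g monoid \<Rightarrow> 'h monoid \<Rightarrow> ('a \<times> 'g \<times> 'h) set \<Rightarrow> ('a, 'g, 'h) fb_class \<Rightarrow> nat" where
  "class_marks A G H S c = marks A G H S (SOME X. X \<in> c)"

definition mark_functional ::
  "'a monoid \<Rightarrow> 'g monoid \<Rightarrow> 'h monoid \<Rightarrow> ('a \<times> 'g \<times> 'h) set \<Rightarrow>
   (('a, 'g, 'h) fb_class \<Rightarrow>\<^sub>0 'k::comm_ring_1) \<Rightarrow> 'k" where
  "mark_functional A G H S p =
     (\<Sum>c\<in>Poly_Mapping.keys p. Poly_Mapping.lookup p c * of_nat (class_marks A G H S c))"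

lemma mark_functional_superset:
  assumes "finite E" "Poly_Mapping.keys p \<subseteq> E"
  shows "mark_functional A G H S p = (\<Sum>c\<in>E. Poly_Mapping.lookup p c * of_nat (class_marks A G H S c))"
  unfolding mark_functional_def using assms by (intro sum.mono_neutral_left) (auto simp: in_keys_iff)

lemma mark_functional_add:
  "mark_functional A G H S (p + q) = mark_functional A G H S p + mark_functional A G H S q"
proof -
  let ?E = "Poly_Mapping.keys p \<union> Poly_Mapping.keys q"
  have "finite ?E" "Poly_Mapping.keys p \<subseteq> ?E" "Poly_Mapping.keys q \<subseteq> ?E" "Poly_Mapping.keys (p + q) \<subseteq> ?E"
    using keys_add[of p q] by auto
  then show ?thesis
    by (simp add: mark_functional_superset[of ?E] lookup_add distrib_right sum.distrib)
qed

lemma mark_functional_diff: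
  "mark_functional A G H S (p - q) = mark_functional A G H S p - mark_functional A G H S q"
  using mark_functional_add[of A G H S "p - q" q] by simp

lemma mark_functional_scale:
  "mark_functional A G H S (pm_scale r p) = r * mark_functional A G H S p"
  using keys_pm_scale[of r p]
  by (subst mark_functional_superset[of "Poly_Mapping.keys p"])
    (auto simp: mark_functional_def lookup_pm_scale sum_distrib_left mult.assoc)

lemma mark_functional_single:
  "mark_functional A G H S (Poly_Mapping.single c r) = r * of_nat (class_marks A G H S c)"
  by (subst mark_functional_superset[of "{c}"]) (auto split: if_splits)

lemma mark_functional_sum:
  "mark_functional A G H S (\<Sum>i\<in>N. f i) = (\<Sum>i\<in>N. mark_functional A G H S (f i))"
  by (induction N rule: infinite_finite_induct) (simp_all add: mark_functional_add, simp_all add: mark_functional_def)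

context fiber_groups
begin

lemma marked_orbits_embedding:
  assumes f: "fb_embedding A G H f (X, \<alpha>) (W, \<gamma>)" and X: "fibered_biset A G H (X, \<alpha>)"
  shows "(`) f ` marked_orbits A G H S (X, \<alpha>) = orbit P \<gamma> ` {w \<in> f ` X. stabilizer P \<gamma> w = S}"
    and "inj_on ((`) f) (marked_orbits A G H S (X, \<alpha>))"
proof -
  have inj: "inj_on f X" and eq: "\<And>u x. u \<in> carrier P \<Longrightarrow> x \<in> X \<Longrightarrow> f (\<alpha> u x) = \<gamma> u (f x)"
    using f by (auto simp: fb_embedding_def)
  have closed: "\<alpha> u x \<in> X" if "u \<in> carrier P" "x \<in> X" for u x
    using that act_closed[OF X] by (cases u) simp
  have orb: "f ` orbit P \<alpha> x = orbit P \<gamma> (f x)" if "x \<in> X" for x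
    unfolding orbit_def setcompr_eq_image Collect_mem_eq image_image
    by (rule image_cong[OF refl]) (rule eq[OF _ that])
  have stab: "stabilizer P \<gamma> (f x) = stabilizer P \<alpha> x" if x: "x \<in> X" for x
  proof -
    have "\<gamma> u (f x) = f x \<longleftrightarrow> \<alpha> u x = x" if "u \<in> carrier P" for u
      using inj_on_eq_iff[OF inj closed[OF that x] x] eq[OF that x] by simp
    then show ?thesis unfolding stabilizer_def by blast
  qed
  have "{w \<in> f ` X. stabilizer P \<gamma> w = S} = f ` {x \<in> X. stabilizer P \<alpha> x = S}"
    using stab by auto
  then show "(`) f ` marked_orbits A G H S (X, \<alpha>) = orbit P \<gamma> ` {w \<in> f ` X. stabilizer P \<gamma> w = S}"
    unfolding marked_orbits_def prod.case using orb by (simp only: image_image) (auto intro!: image_cong)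
  have "marked_orbits A G H S (X, \<alpha>) \<subseteq> Pow X"
    using closed unfolding marked_orbits_def orbit_def by blast
  then show "inj_on ((`) f) (marked_orbits A G H S (X, \<alpha>))"
    using inj_on_image_Pow[OF inj] inj_on_subset by blast
qed

lemma orbit_eq:
  assumes X: "fibered_biset A G H (X, \<alpha>)" and x: "x \<in> X" and u: "u \<in> carrier P"
  shows "orbit P \<alpha> (\<alpha> u x) = orbit P \<alpha> x"
proof -
  interpret act: group_action P X \<alpha> by (rule action[OF X])
  have sub: "orbit P \<alpha> (\<alpha> u x) \<subseteq> orbit P \<alpha> x" if "x \<in> X" "u \<in> carrier P" for u x
    using that act.composition_rule[symmetric] P.m_closed unfolding orbit_def by blast
  have "\<alpha> (inv\<^bsub>P\<^esub> u) (\<alpha> u x) = x" by (rule act.orbit_sym_aux[OF u x refl])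
  then have "orbit P \<alpha> x \<subseteq> orbit P \<alpha> (\<alpha> u x)"
    using sub[OF act.element_image[OF u x refl] P.inv_closed[OF u]] by simp
  then show ?thesis using sub[OF x u] by blast
qed

lemma finite_marked_orbits:
  assumes X: "fibered_biset A G H X"
  shows "finite (marked_orbits A G H S X)"
proof -
  obtain X' \<alpha> where X': "X = (X', \<alpha>)" by (cases X)
  note X = X[unfolded X']
  obtain F where F: "finite F" "F \<subseteq> X'" "\<And>x. x \<in> X' \<Longrightarrow> \<exists>a\<in>carrier A. \<exists>f\<in>F. x = \<alpha> (a, \<one>\<^bsub>G\<^esub>, \<one>\<^bsub>H\<^esub>) f"
    using finite_reps[OF X] by metis
  have "orbit P \<alpha> x \<in> orbit P \<alpha> ` F" if x: "x \<in> X'" for x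
  proof -
    obtain a r where r: "a \<in> carrier A" "r \<in> F" "x = \<alpha> (a, \<one>\<^bsub>G\<^esub>, \<one>\<^bsub>H\<^esub>) r" using F(3)[OF x] by blast
    then have "orbit P \<alpha> x = orbit P \<alpha> r"
      unfolding r(3) using F(2) by (intro orbit_eq[OF X]) auto
    then show ?thesis using r(2) by blast
  qed
  then have "marked_orbits A G H S X \<subseteq> orbit P \<alpha> ` F" unfolding X' marked_orbits_def by auto
  then show ?thesis using F(1) finite_subset by blast
qed

lemma marks_iso:
  assumes X: "fibered_biset A G H X" and iso: "fb_iso A G H X Y"
  shows "marks A G H S X = marks A G H S Y"
proof -
  obtain X' \<alpha> Y' \<beta> where XY: "X = (X', \<alpha>)" "Y = (Y', \<beta>)" by (cases X; cases Y)
  obtain f where f: "fb_embedding A G H f (X', \<alpha>) (Y', \<beta>)" "f ` X' = Y'"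
    using iso unfolding XY fb_iso_iff_embedding by auto
  have "(`) f ` marked_orbits A G H S X = marked_orbits A G H S Y"
    using marked_orbits_embedding(1)[OF f(1) X[unfolded XY]] by (simp add: XY f(2)) (simp add: marked_orbits_def)
  then show ?thesis
    using card_image[OF marked_orbits_embedding(2)[OF f(1) X[unfolded XY]], of S] by (simp add: marks_def XY)
qed

lemma marks_disjoint_union:
  assumes X: "fibered_biset A G H X" and Y: "fibered_biset A G H Y"
  shows "marks A G H S (fb_disjoint_union X Y) = marks A G H S X + marks A G H S Y"
proof -
  obtain X' \<alpha> Y' \<beta> where XY: "X = (X', \<alpha>)" "Y = (Y', \<beta>)" by (cases X; cases Y)
  obtain \<gamma> where D: "fb_disjoint_union (X', \<alpha>) (Y', \<beta>) = (X' <+> Y', \<gamma>)"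
    by (simp add: fb_disjoint_union_def)
  note emb = disjoint_union_embeddings(1)[of A G H X' \<alpha> Y' \<beta>, unfolded D]
    disjoint_union_embeddings(2)[of A G H Y' \<beta> X' \<alpha>, unfolded D]
  note l = marked_orbits_embedding[OF emb(1) X[unfolded XY]] and r = marked_orbits_embedding[OF emb(2) Y[unfolded XY]]
  have "{w \<in> X' <+> Y'. stabilizer P \<gamma> w = S} =
      {w \<in> Inl ` X'. stabilizer P \<gamma> w = S} \<union> {w \<in> Inr ` Y'. stabilizer P \<gamma> w = S}" by auto
  then have "marked_orbits A G H S (X' <+> Y', \<gamma>) =
      (`) Inl ` marked_orbits A G H S (X', \<alpha>) \<union> (`) Inr ` marked_orbits A G H S (Y', \<beta>)"
    unfolding l(1) r(1) by (simp only: marked_orbits_def prod.case image_Un)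
  moreover have "(`) Inl ` marked_orbits A G H S (X', \<alpha>) \<inter> (`) Inr ` marked_orbits A G H S (Y', \<beta>) = {}"
  proof -
    have "\<omega> \<noteq> {}" if "\<omega> \<in> marked_orbits A G H S (X', \<alpha>)" for \<omega>
      using that P.one_closed unfolding marked_orbits_def orbit_def prod.case by blast
    then show ?thesis by fast
  qed
  moreover have "finite (marked_orbits A G H S (X', \<alpha>))" "finite (marked_orbits A G H S (Y', \<beta>))"
    using finite_marked_orbits X Y XY by blast+
  ultimately show ?thesis
    using card_image[OF l(2), of S] card_image[OF r(2), of S] by (simp add: marks_def XY D card_Un_disjoint)
qed

lemma class_marks_class_of:
  assumes X: "fibered_biset A G H X"
  shows "class_marks A G H S (fb_class_of A G H X) = marks A G H S X"
proof -
  have "(SOME Y. Y \<in> fb_class_of A G H X) \<in> fb_class_of A G H X"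
    using fb_class_of_nonempty[OF X] by (simp add: some_in_eq)
  then have "fb_iso A G H X (SOME Y. Y \<in> fb_class_of A G H X)" by (simp only: fb_class_of_def mem_Collect_eq)
  from marks_iso[OF X this, symmetric] show ?thesis unfolding class_marks_def .
qed

lemma mark_functional_gen:
  "fibered_biset A G H X \<Longrightarrow> mark_functional A G H S (fb_gen A G H X) = of_nat (marks A G H S X)"
  by (simp add: fb_gen_def mark_functional_single class_marks_class_of)

lemma mark_functional_relations:
  fixes r :: "('a, 'g, 'h) fb_class \<Rightarrow>\<^sub>0 'k::comm_ring_1"
  assumes "r \<in> fb_relations A G H"
  shows "mark_functional A G H S r = 0"
proof -
  have "pm.subspace {r :: ('a, 'g, 'h) fb_class \<Rightarrow>\<^sub>0 'k. mark_functional A G H S r = 0}"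
    unfolding pm.subspace_def mem_Collect_eq
    by (simp add: mark_functional_add mark_functional_scale) (simp add: mark_functional_def)
  moreover have "mark_functional A G H S
      (fb_gen A G H (fb_disjoint_union X Y) - fb_gen A G H X - fb_gen A G H Y :: _ \<Rightarrow>\<^sub>0 'k) = 0"
    if XY: "fibered_biset A G H X" "fibered_biset A G H Y" for X Y
  proof -
    have "fibered_biset A G H (fb_disjoint_union X Y)"
      using XY by (cases X; cases Y) (simp add: fibered_disjoint_union)
    then show ?thesis using XY by (simp add: mark_functional_diff mark_functional_gen marks_disjoint_union)
  qed
  ultimately show ?thesis
    using assms unfolding fb_relations_def by (rule_tac pm.span_induct) auto
qed

text \<open>A transitive biset has a single orbit, and its base coset has stabilizer \<open>S\<close>.\<close>

lemma marks_coset_biset: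
  assumes S: "subgroup S P" and X: "fibered_biset A G H (coset_biset P S)"
  shows "marks A G H S (coset_biset P S) = 1"
proof -
  obtain X' \<alpha> where X': "coset_biset P S = (X', \<alpha>)" by (cases "coset_biset P S")
  note base = coset_biset_base[OF S, unfolded X' fst_conv snd_conv] and X = X[unfolded X']
  have "marked_orbits A G H S (X', \<alpha>) = {orbit P \<alpha> S}"
  proof (intro equalityI subsetI)
    fix \<omega> assume "\<omega> \<in> marked_orbits A G H S (X', \<alpha>)"
    then obtain y where y: "y \<in> X'" "\<omega> = orbit P \<alpha> y" unfolding marked_orbits_def by auto
    obtain u where "u \<in> carrier P" "y = \<alpha> u S" using base(3)[OF y(1)] by blast
    then show "\<omega> \<in> {orbit P \<alpha> S}" using orbit_eq[OF X base(1)] y(2) by blast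
  qed (use base(1,2) in \<open>auto simp: marked_orbits_def\<close>)
  then show ?thesis by (simp add: marks_def X')
qed

end

section \<open>Faithful characters on commutators\<close>

text \<open>The pairs in \<open>\<M>\<^sub>G\<^sup>G\<close>.\<close>

locale invariant_pair = A: comm_group A + G: group G
  for A :: "'a monoid" and G :: "'g monoid" +
  fixes K :: "'g set" and \<kappa> :: "'g \<Rightarrow> 'a"
  assumes normal: "normal K G"
    and hom: "\<kappa> \<in> hom (G\<lparr>carrier := K\<rparr>) A"
    and invariant: "\<And>g x. \<lbrakk>g \<in> carrier G; x \<in> K\<rbrakk> \<Longrightarrow> \<kappa> (g \<otimes>\<^bsub>G\<^esub> x \<otimes>\<^bsub>G\<^esub> inv\<^bsub>G\<^esub> g) = \<kappa> x"
begin

sublocale GG: fiber_groups A G G ..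

lemma K: "subgroup K G" by (rule normal_imp_subgroup[OF normal])

lemmas K_closed = subgroup.one_closed[OF K] subgroup.m_closed[OF K] subgroup.m_inv_closed[OF K]

lemma K_carrier: "x \<in> K \<Longrightarrow> x \<in> carrier G" by (rule subgroup.mem_carrier[OF K])

lemma K_conj: "\<lbrakk>g \<in> carrier G; x \<in> K\<rbrakk> \<Longrightarrow> g \<otimes>\<^bsub>G\<^esub> x \<otimes>\<^bsub>G\<^esub> inv\<^bsub>G\<^esub> g \<in> K"
  by (rule normal.inv_op_closed2[OF normal])

lemma \<kappa>_closed: "x \<in> K \<Longrightarrow> \<kappa> x \<in> carrier A"
  using hom by (auto simp: hom_def)

lemma \<kappa>_mult: "\<lbrakk>x \<in> K; y \<in> K\<rbrakk> \<Longrightarrow> \<kappa> (x \<otimes>\<^bsub>G\<^esub> y) = \<kappa> x \<otimes>\<^bsub>A\<^esub> \<kappa> y"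
  using hom by (auto simp: hom_def)

lemma \<kappa>_one: "\<kappa> \<one>\<^bsub>G\<^esub> = \<one>\<^bsub>A\<^esub>"
  using \<kappa>_mult[of "\<one>\<^bsub>G\<^esub>" "\<one>\<^bsub>G\<^esub>"] K_closed(1) by (simp add: \<kappa>_closed)

lemma \<kappa>_inv: "x \<in> K \<Longrightarrow> \<kappa> (inv\<^bsub>G\<^esub> x) = inv\<^bsub>A\<^esub> (\<kappa> x)"
  using \<kappa>_mult[of "inv\<^bsub>G\<^esub> x" x] K_closed
  by (intro A.inv_equality[symmetric]) (auto simp: \<kappa>_closed \<kappa>_one K_carrier)

lemma \<kappa>_pow: "x \<in> K \<Longrightarrow> \<kappa> x [^]\<^bsub>A\<^esub> (n::nat) = \<kappa> (x [^]\<^bsub>G\<^esub> n) \<and> x [^]\<^bsub>G\<^esub> n \<in> K"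
  by (induction n) (auto simp: \<kappa>_one \<kappa>_mult K_closed)

lemma inv_mult_in_K_iff:
  assumes "g \<in> carrier G" "g' \<in> carrier G"
  shows "inv\<^bsub>G\<^esub> g' \<otimes>\<^bsub>G\<^esub> g \<in> K \<longleftrightarrow> g \<otimes>\<^bsub>G\<^esub> inv\<^bsub>G\<^esub> g' \<in> K"
proof
  assume "inv\<^bsub>G\<^esub> g' \<otimes>\<^bsub>G\<^esub> g \<in> K"
  then show "g \<otimes>\<^bsub>G\<^esub> inv\<^bsub>G\<^esub> g' \<in> K"
    using K_conj[of g' "inv\<^bsub>G\<^esub> g' \<otimes>\<^bsub>G\<^esub> g"] assms by (simp add: G.m_assoc[symmetric])
next
  assume "g \<otimes>\<^bsub>G\<^esub> inv\<^bsub>G\<^esub> g' \<in> K"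
  then show "inv\<^bsub>G\<^esub> g' \<otimes>\<^bsub>G\<^esub> g \<in> K"
    using K_conj[of "inv\<^bsub>G\<^esub> g'" "g \<otimes>\<^bsub>G\<^esub> inv\<^bsub>G\<^esub> g'"] assms by (simp add: G.m_assoc)
qed

lemma lcoset_eq_iff:
  assumes "g \<in> carrier G" "g' \<in> carrier G"
  shows "g <#\<^bsub>G\<^esub> K = g' <#\<^bsub>G\<^esub> K \<longleftrightarrow> g \<otimes>\<^bsub>G\<^esub> inv\<^bsub>G\<^esub> g' \<in> K"
  using G.l_coset_eq_iff[OF K assms] inv_mult_in_K_iff[OF assms] by simp

text \<open>The stabilizer of the base point of the biset that represents \<open>e\<close>.\<close>

definition "S = twisted_subgroup A (Delta G K) (phi_char G \<kappa>)"

lemma mem_S: "(a, g, g') \<in> S \<longleftrightarrow>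
    g \<in> carrier G \<and> g' \<in> carrier G \<and> g \<otimes>\<^bsub>G\<^esub> inv\<^bsub>G\<^esub> g' \<in> K \<and> a = inv\<^bsub>A\<^esub> (\<kappa> (g \<otimes>\<^bsub>G\<^esub> inv\<^bsub>G\<^esub> g'))"
proof -
  have "(g, g') \<in> Delta G K \<longleftrightarrow> g \<in> carrier G \<and> g' \<in> carrier G \<and> g \<otimes>\<^bsub>G\<^esub> inv\<^bsub>G\<^esub> g' \<in> K"
    by (simp add: Delta_def lcoset_eq_iff cong: conj_cong)
  then show ?thesis by (auto simp: S_def twisted_subgroup_def phi_char_def)
qed

lemma subgroup_S: "subgroup S GG.P"
proof (rule GG.P.subgroupI)
  show "S \<subseteq> carrier GG.P"
    by (clarsimp simp: mem_S \<kappa>_closed)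
  have "(\<one>\<^bsub>A\<^esub>, \<one>\<^bsub>G\<^esub>, \<one>\<^bsub>G\<^esub>) \<in> S" using K_closed(1) by (simp add: mem_S \<kappa>_one)
  then show "S \<noteq> {}" by blast
next
  fix u assume "u \<in> S"
  then obtain a g g' where u: "u = (a, g, g')" "g \<in> carrier G" "g' \<in> carrier G" "g \<otimes>\<^bsub>G\<^esub> inv\<^bsub>G\<^esub> g' \<in> K"
    "a = inv\<^bsub>A\<^esub> (\<kappa> (g \<otimes>\<^bsub>G\<^esub> inv\<^bsub>G\<^esub> g'))" by (cases u) (auto simp: mem_S)
  have 1: "inv\<^bsub>G\<^esub> g \<otimes>\<^bsub>G\<^esub> g' = inv\<^bsub>G\<^esub> g' \<otimes>\<^bsub>G\<^esub> inv\<^bsub>G\<^esub> (g \<otimes>\<^bsub>G\<^esub> inv\<^bsub>G\<^esub> g') \<otimes>\<^bsub>G\<^esub> inv\<^bsub>G\<^esub> (inv\<^bsub>G\<^esub> g')"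
    using u by (simp add: G.inv_mult_group G.m_assoc[symmetric])
  have 2: "inv\<^bsub>G\<^esub> g \<otimes>\<^bsub>G\<^esub> g' \<in> K" unfolding 1 using u by (intro K_conj K_closed(3)) auto
  have "\<kappa> (inv\<^bsub>G\<^esub> g \<otimes>\<^bsub>G\<^esub> g') = \<kappa> (inv\<^bsub>G\<^esub> (g \<otimes>\<^bsub>G\<^esub> inv\<^bsub>G\<^esub> g'))"
    unfolding 1 using u by (intro invariant K_closed(3)) auto
  then show "inv\<^bsub>GG.P\<^esub> u \<in> S" using u 2 by (simp add: GG.inv_P mem_S \<kappa>_inv \<kappa>_closed)
next
  fix u v assume "u \<in> S" "v \<in> S"
  then obtain a g g' b h h' where u: "u = (a, g, g')" "g \<in> carrier G" "g' \<in> carrier G" "g \<otimes>\<^bsub>G\<^esub> inv\<^bsub>G\<^esub> g' \<in> K"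
    "a = inv\<^bsub>A\<^esub> (\<kappa> (g \<otimes>\<^bsub>G\<^esub> inv\<^bsub>G\<^esub> g'))"
    and v: "v = (b, h, h')" "h \<in> carrier G" "h' \<in> carrier G" "h \<otimes>\<^bsub>G\<^esub> inv\<^bsub>G\<^esub> h' \<in> K"
    "b = inv\<^bsub>A\<^esub> (\<kappa> (h \<otimes>\<^bsub>G\<^esub> inv\<^bsub>G\<^esub> h'))" by (cases u; cases v) (auto simp: mem_S)
  have 1: "(g \<otimes>\<^bsub>G\<^esub> h) \<otimes>\<^bsub>G\<^esub> inv\<^bsub>G\<^esub> (g' \<otimes>\<^bsub>G\<^esub> h') =
      (g \<otimes>\<^bsub>G\<^esub> (h \<otimes>\<^bsub>G\<^esub> inv\<^bsub>G\<^esub> h') \<otimes>\<^bsub>G\<^esub> inv\<^bsub>G\<^esub> g) \<otimes>\<^bsub>G\<^esub> (g \<otimes>\<^bsub>G\<^esub> inv\<^bsub>G\<^esub> g')"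
  proof -
    have "inv\<^bsub>G\<^esub> g \<otimes>\<^bsub>G\<^esub> (g \<otimes>\<^bsub>G\<^esub> inv\<^bsub>G\<^esub> g') = inv\<^bsub>G\<^esub> g'" using u by (simp add: G.m_assoc[symmetric])
    then show ?thesis using u v by (simp add: G.inv_mult_group G.m_assoc)
  qed
  have 2: "g \<otimes>\<^bsub>G\<^esub> (h \<otimes>\<^bsub>G\<^esub> inv\<^bsub>G\<^esub> h') \<otimes>\<^bsub>G\<^esub> inv\<^bsub>G\<^esub> g \<in> K" using u v by (intro K_conj)
  have "\<kappa> ((g \<otimes>\<^bsub>G\<^esub> h) \<otimes>\<^bsub>G\<^esub> inv\<^bsub>G\<^esub> (g' \<otimes>\<^bsub>G\<^esub> h')) = \<kappa> (h \<otimes>\<^bsub>G\<^esub> inv\<^bsub>G\<^esub> h') \<otimes>\<^bsub>A\<^esub> \<kappa> (g \<otimes>\<^bsub>G\<^esub> inv\<^bsub>G\<^esub> g')"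
    unfolding 1 using u v 2 by (simp only: \<kappa>_mult invariant)
  moreover have "(g \<otimes>\<^bsub>G\<^esub> h) \<otimes>\<^bsub>G\<^esub> inv\<^bsub>G\<^esub> (g' \<otimes>\<^bsub>G\<^esub> h') \<in> K"
    unfolding 1 using 2 u(4) by (rule K_closed)
  ultimately show "u \<otimes>\<^bsub>GG.P\<^esub> v \<in> S"
    using u v by (simp add: mem_S A.inv_mult \<kappa>_closed A.m_comm)
qed

lemma fibered_S:
  assumes "finite (carrier G)"
  shows "fibered_biset A G G (coset_biset GG.P S)"
  using assms by (intro GG.fibered_coset_biset[OF subgroup_S]) (auto simp: mem_S \<kappa>_one)

lemma e_elem_eq: "e_elem A G K \<kappa> = fb_elem A G G (coset_biset GG.P S)"
  by (simp add: e_elem_def fb_transitive_eq_coset_biset S_def)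

text \<open>The projection of \<open>U\<close> to \<open>H\<close> must be large. An element of \<open>G\<close> is a product \<open>r x\<close> of a coset representative
  \<open>r\<close> and some \<open>x \<in> K\<close>. Lifting \<open>r\<close> arbitrarily, and \<open>x\<close> with \<open>A\<close>-component \<open>1\<close>, assigns to it an element of
  \<open>H\<close>. If \<open>g\<close> and \<open>g'\<close> get the same element, the quotient of the two lifts lies over \<open>1 \<in> H\<close>, so \<open>g\<close> and \<open>g'\<close> lie
  in the same coset and share \<open>r\<close>; then the \<open>A\<close>-components of the lifts agree, which forces
  \<open>\<kappa>(g g'\<^sup>-\<^sup>1) = 1\<close> and \<open>g = g'\<close>.\<close>

lemma order_le_of_stabilizer:
  fixes H :: "'h monoid"
  assumes H: "group H" "finite (carrier H)"
    and derived: "K \<subseteq> derived G (carrier G)" and inj: "inj_on \<kappa> K"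
    and U: "subgroup U (A \<times>\<times> G \<times>\<times> H)"
    and onto: "\<And>g. g \<in> carrier G \<Longrightarrow> \<exists>a h. (a, g, h) \<in> U"
    and kernel: "\<And>a g. (a, g, \<one>\<^bsub>H\<^esub>) \<in> U \<Longrightarrow> g \<in> K \<and> a = inv\<^bsub>A\<^esub> (\<kappa> g)"
  shows "order G \<le> order H"
proof -
  interpret GH: fiber_groups A G H by (intro fiber_groups.intro A.comm_group_axioms G.group_axioms H(1))
  have U_carrier: "a \<in> carrier A" "g \<in> carrier G" "h \<in> carrier H" if "(a, g, h) \<in> U" for a g h
    using subgroup.mem_carrier[OF U that] by auto
  have U_mult: "(a \<otimes>\<^bsub>A\<^esub> b, g \<otimes>\<^bsub>G\<^esub> g', h \<otimes>\<^bsub>H\<^esub> h') \<in> U" if "(a, g, h) \<in> U" "(b, g', h') \<in> U" for a g h b g' h'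
    using subgroup.m_closed[OF U that] by simp
  have U_inv: "(inv\<^bsub>A\<^esub> a, inv\<^bsub>G\<^esub> g, inv\<^bsub>H\<^esub> h) \<in> U" if "(a, g, h) \<in> U" for a g h
    using subgroup.m_inv_closed[OF U that] U_carrier[OF that] by (simp add: GH.inv_P)
  have U_one: "(\<one>\<^bsub>A\<^esub>, \<one>\<^bsub>G\<^esub>, \<one>\<^bsub>H\<^esub>) \<in> U"
    using subgroup.one_closed[OF U] by simp
  \<comment> \<open>a subgroup that contains all commutators, hence \<open>G'\<close>\<close>
  let ?C = "{x. \<exists>h. (\<one>\<^bsub>A\<^esub>, x, h) \<in> U}"
  have C: "subgroup ?C G"
  proof (rule G.subgroupI)
    show "?C \<subseteq> carrier G" using U_carrier by blast
    show "?C \<noteq> {}" using U_one by blast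
    show "inv\<^bsub>G\<^esub> x \<in> ?C" if "x \<in> ?C" for x
      using that U_inv[of "\<one>\<^bsub>A\<^esub>" x] by auto
    show "x \<otimes>\<^bsub>G\<^esub> y \<in> ?C" if "x \<in> ?C" "y \<in> ?C" for x y
      using that U_mult[of "\<one>\<^bsub>A\<^esub>" x _ "\<one>\<^bsub>A\<^esub>" y] by fastforce
  qed
  have "derived_set G (carrier G) \<subseteq> ?C"
  proof
    fix x assume "x \<in> derived_set G (carrier G)"
    then obtain g g' where x: "g \<in> carrier G" "g' \<in> carrier G" "x = g \<otimes>\<^bsub>G\<^esub> g' \<otimes>\<^bsub>G\<^esub> inv\<^bsub>G\<^esub> g \<otimes>\<^bsub>G\<^esub> inv\<^bsub>G\<^esub> g'" by auto
    obtain a h b h' where u: "(a, g, h) \<in> U" "(b, g', h') \<in> U" using onto x(1,2) by meson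
    have "(a \<otimes>\<^bsub>A\<^esub> b \<otimes>\<^bsub>A\<^esub> inv\<^bsub>A\<^esub> a \<otimes>\<^bsub>A\<^esub> inv\<^bsub>A\<^esub> b, x, h \<otimes>\<^bsub>H\<^esub> h' \<otimes>\<^bsub>H\<^esub> inv\<^bsub>H\<^esub> h \<otimes>\<^bsub>H\<^esub> inv\<^bsub>H\<^esub> h') \<in> U"
      unfolding x(3) using u by (intro U_mult U_inv)
    moreover have "a \<otimes>\<^bsub>A\<^esub> b \<otimes>\<^bsub>A\<^esub> inv\<^bsub>A\<^esub> a \<otimes>\<^bsub>A\<^esub> inv\<^bsub>A\<^esub> b = \<one>\<^bsub>A\<^esub>"
      using U_carrier[OF u(1)] U_carrier[OF u(2)] by (simp add: A.m_comm[of a b] A.m_assoc)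
    ultimately show "x \<in> ?C" by auto
  qed
  then have "K \<subseteq> ?C"
    using derived G.generate_subgroup_incl[OF _ C] unfolding derived_def by blast
  then have "\<exists>m. \<forall>x\<in>K. (\<one>\<^bsub>A\<^esub>, x, m x) \<in> U" by (intro bchoice) blast
  then obtain m where m: "\<And>x. x \<in> K \<Longrightarrow> (\<one>\<^bsub>A\<^esub>, x, m x) \<in> U" by blast
  obtain b t where bt: "\<And>g. g \<in> carrier G \<Longrightarrow> (b g, g, t g) \<in> U"
    using onto by metis
  define rep where "rep g = (SOME x. x \<in> g <#\<^bsub>G\<^esub> K)" for g
  have rep: "rep g \<in> carrier G" "inv\<^bsub>G\<^esub> (rep g) \<otimes>\<^bsub>G\<^esub> g \<in> K" if g: "g \<in> carrier G" for g
  proof -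
    have "rep g \<in> g <#\<^bsub>G\<^esub> K" unfolding rep_def using G.lcos_self[OF g K] by (rule someI)
    then obtain x where x: "x \<in> K" "rep g = g \<otimes>\<^bsub>G\<^esub> x" unfolding l_coset_def by blast
    then show "rep g \<in> carrier G" using g by (simp add: K_carrier)
    show "inv\<^bsub>G\<^esub> (rep g) \<otimes>\<^bsub>G\<^esub> g \<in> K"
      using x g K_closed by (simp add: G.inv_mult_group G.m_assoc K_carrier)
  qed
  \<comment> \<open>the \<open>H\<close>-component of the product of the lift of \<open>rep g\<close> and the lift of \<open>rep g\<^sup>-\<^sup>1 g \<in> K\<close>\<close>
  define F where "F g = t (rep g) \<otimes>\<^bsub>H\<^esub> m (inv\<^bsub>G\<^esub> (rep g) \<otimes>\<^bsub>G\<^esub> g)" for g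
  have F: "(b (rep g), g, F g) \<in> U" if g: "g \<in> carrier G" for g
    using U_mult[OF bt[OF rep(1)[OF g]] m[OF rep(2)[OF g]]] rep(1)[OF g] g U_carrier(1)[OF bt[OF rep(1)[OF g]]]
    by (simp add: F_def G.m_assoc[symmetric])
  have "inj_on F (carrier G)"
  proof (rule inj_onI)
    fix g g' assume g: "g \<in> carrier G" "g' \<in> carrier G" "F g = F g'"
    have *: "(b (rep g) \<otimes>\<^bsub>A\<^esub> inv\<^bsub>A\<^esub> b (rep g'), g \<otimes>\<^bsub>G\<^esub> inv\<^bsub>G\<^esub> g', \<one>\<^bsub>H\<^esub>) \<in> U"
      using U_mult[OF F[OF g(1)] U_inv[OF F[OF g(2)]]] U_carrier(3)[OF F[OF g(2)]] g(3) by simp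
    then have gK: "g \<otimes>\<^bsub>G\<^esub> inv\<^bsub>G\<^esub> g' \<in> K" using kernel by blast
    then have "rep g = rep g'" using lcoset_eq_iff[OF g(1,2)] by (simp add: rep_def)
    then have "\<one>\<^bsub>A\<^esub> = inv\<^bsub>A\<^esub> (\<kappa> (g \<otimes>\<^bsub>G\<^esub> inv\<^bsub>G\<^esub> g'))"
      using kernel[OF *] U_carrier(1)[OF F[OF g(2)]] by simp
    then have "\<kappa> (g \<otimes>\<^bsub>G\<^esub> inv\<^bsub>G\<^esub> g') = \<kappa> \<one>\<^bsub>G\<^esub>"
      using \<kappa>_closed[OF gK] by (metis A.inv_inv A.inv_one \<kappa>_one)
    then have "g \<otimes>\<^bsub>G\<^esub> inv\<^bsub>G\<^esub> g' = \<one>\<^bsub>G\<^esub>" using inj gK K_closed(1) by (meson inj_onD)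
    then show "g = g'" using g by (metis G.inv_closed G.inv_equality G.inv_inv)
  qed
  moreover have "F ` carrier G \<subseteq> carrier H" using F U_carrier(3) by blast
  ultimately show ?thesis unfolding order_def using H(2) by (rule_tac card_inj_on_le)
qed

text \<open>If \<open>[x, y]\<close> had stabilizer \<open>S\<close>, then the stabilizer of \<open>x\<close> would satisfy the hypotheses of
  \<open>order_le_of_stabilizer\<close>: it projects onto \<open>G\<close> because \<open>S\<close> contains the diagonal, and it is controlled over
  \<open>1 \<in> H\<close> because \<open>(1, 1, 1)\<close> fixes \<open>y\<close>.\<close>

lemma tensor_marks_zero:
  fixes H :: "'h monoid"
  assumes H: "group H" "finite (carrier H)" "order H < order G"
    and derived: "K \<subseteq> derived G (carrier G)" and inj: "inj_on \<kappa> K"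
    and X: "fibered_biset A G H X" and Y: "fibered_biset A H G Y"
  shows "marks A G G S (fb_tensor A G H G X Y) = 0"
proof -
  interpret GHG: fiber_groups3 A G H G
    by (intro fiber_groups3.intro fiber_groups.intro A.comm_group_axioms G.group_axioms H(1))
  obtain X' \<alpha> Y' \<beta> where XY: "X = (X', \<alpha>)" "Y = (Y', \<beta>)" by (cases X; cases Y)
  note X = X[unfolded XY] and Y = Y[unfolded XY]
  have False if \<omega>: "\<omega> \<in> tensor_points A G H G (X', \<alpha>) (Y', \<beta>)"
    and stab: "\<And>u. u \<in> carrier GG.P \<Longrightarrow> tensor_action A H \<alpha> \<beta> u \<omega> = \<omega> \<longleftrightarrow> u \<in> S" for \<omega>
  proof -
    obtain x y where xy: "x \<in> X'" "y \<in> Y'" "\<omega> = tensor_orbit A G H G \<alpha> \<beta> x y"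
      using \<omega> by (rule GHG.tensor_pointsE[OF X Y])
    have S_iff: "(a, g, g') \<in> S \<longleftrightarrow>
        (\<exists>b\<in>carrier A. \<exists>h\<in>carrier H. \<alpha> (a \<otimes>\<^bsub>A\<^esub> b, g, h) x = x \<and> \<beta> (inv\<^bsub>A\<^esub> b, h, g') y = y)"
      if "a \<in> carrier A" "g \<in> carrier G" "g' \<in> carrier G" for a g g'
      using stab[of "(a, g, g')"] GHG.tensor_stabilizer[OF X Y xy(1,2) that] that xy(3) by simp
    let ?U = "stabilizer GHG.P \<alpha> x"
    have U: "subgroup ?U GHG.P"
      by (rule group_action.stabilizer_subgroup[OF GHG.action[OF X] xy(1)])
    have "\<exists>a h. (a, g, h) \<in> ?U" if g: "g \<in> carrier G" for g
    proof -
      have "(\<one>\<^bsub>A\<^esub>, g, g) \<in> S" using g K_closed(1) by (simp add: mem_S \<kappa>_one)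
      then obtain b h where "b \<in> carrier A" "h \<in> carrier H" "\<alpha> (\<one>\<^bsub>A\<^esub> \<otimes>\<^bsub>A\<^esub> b, g, h) x = x"
        using S_iff[of "\<one>\<^bsub>A\<^esub>" g g] g by auto
      then show ?thesis using g unfolding stabilizer_def by auto
    qed
    moreover have "g \<in> K \<and> a = inv\<^bsub>A\<^esub> (\<kappa> g)" if u: "(a, g, \<one>\<^bsub>H\<^esub>) \<in> ?U" for a g
    proof -
      have ag: "a \<in> carrier A" "g \<in> carrier G" "\<alpha> (a, g, \<one>\<^bsub>H\<^esub>) x = x" using u by (auto simp: stabilizer_def)
      then have "(a, g, \<one>\<^bsub>G\<^esub>) \<in> S"
        using S_iff[of a g "\<one>\<^bsub>G\<^esub>"] GHG.HI.act_one[OF Y xy(2)]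
        by (auto intro!: bexI[of _ "\<one>\<^bsub>A\<^esub>"] bexI[of _ "\<one>\<^bsub>H\<^esub>"])
      then show ?thesis using ag(2) by (simp add: mem_S)
    qed
    ultimately have "order G \<le> order H" by (rule order_le_of_stabilizer[OF H(1,2) derived inj U])
    then show False using H(3) by simp
  qed
  then have "marked_orbits A G G S (fb_tensor A G H G X Y) = {}"
    unfolding XY fb_tensor_eq marked_orbits_def prod.case stabilizer_def by auto
  then show ?thesis by (simp add: marks_def)
qed

lemma ideal_marks_zero:
  fixes Q :: "(('a, 'g, 'g) fb_class \<Rightarrow>\<^sub>0 'k::comm_ring_1) set"
  assumes derived: "K \<subseteq> derived G (carrier G)" and inj: "inj_on \<kappa> K"
    and Q: "Q \<in> fb_ideal A G" and q: "q \<in> Q"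
  shows "mark_functional A G G S q = 0"
  using Q q
proof (induction arbitrary: q rule: fb_ideal.induct)
  case zero
  then show ?case by (simp add: mem_fb_coset_iff GG.mark_functional_relations)
next
  case (prod H Q Q')
  interpret GHG: fiber_groups3 A G H G
    by (intro fiber_groups3.intro fiber_groups.intro A.comm_group_axioms G.group_axioms prod(1))
  obtain p p' where p: "p \<in> fb_free A G H" "p' \<in> fb_free A H G" "q \<in> fb_coset A G G (free_comp A G H G p p')"
    using prod.prems unfolding fb_comp_def by blast
  have "class_marks A G G S (class_tensor A G H G c d) = 0"
    if c: "c \<in> Poly_Mapping.keys p" and d: "d \<in> Poly_Mapping.keys p'" for c d
  proof -
    obtain X :: "('a \<times> nat, 'a, 'g, nat) actset" where X: "fibered_biset A G H X" "c = fb_class_of A G H X"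
      using c p by (auto simp: fb_free_def fb_classes_def)
    obtain Y :: "('a \<times> nat, 'a, nat, 'g) actset" where Y: "fibered_biset A H G Y" "d = fb_class_of A H G Y"
      using d p by (auto simp: fb_free_def fb_classes_def)
    have "fibered_biset A G G (fb_tensor A G H G X Y)"
      using X(1) Y(1) by (cases X; cases Y) (simp add: GHG.fibered_tensor)
    then show ?thesis
      unfolding X(2) Y(2) GHG.class_tensor_class_of[OF X(1) Y(1)]
      using tensor_marks_zero[OF prod(1-3) derived inj X(1) Y(1)] by (simp add: GG.class_marks_class_of)
  qed
  then have "mark_functional A G G S (free_comp A G H G p p') = 0"
    by (simp add: free_comp_def mark_functional_sum mark_functional_single)
  moreover have "mark_functional A G G S (q - free_comp A G H G p p') = 0"
    using p(3) by (simp add: mem_fb_coset_iff GG.mark_functional_relations)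
  ultimately show ?case by (simp add: mark_functional_diff)
next
  case (add Q Q')
  then show ?case by (auto simp: fb_add_def mark_functional_add)
qed

lemma reduced_if:
  assumes fin: "finite (carrier G)" and derived: "K \<subseteq> derived G (carrier G)" and inj: "inj_on \<kappa> K"
  shows "reduced_pair (k :: 'k::comm_ring_1 itself) A G K \<kappa>"
proof -
  have "fb_gen A G G (coset_biset GG.P S) \<in> (e_elem A G K \<kappa> :: (_ \<Rightarrow>\<^sub>0 'k) set)"
    by (simp add: e_elem_eq fb_elem_def mem_fb_coset_iff pm.subspace_0[OF subspace_fb_relations])
  moreover have "mark_functional A G G S (fb_gen A G G (coset_biset GG.P S) :: _ \<Rightarrow>\<^sub>0 'k) = 1"
    by (simp add: GG.mark_functional_gen fibered_S[OF fin] GG.marks_coset_biset[OF subgroup_S])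
  ultimately show ?thesis unfolding reduced_pair_def using ideal_marks_zero[OF derived inj] by fastforce
qed

end

section \<open>Roots of torsion elements\<close>

lemma pi_part_eq_prod:
  assumes "\<forall>p\<in>\<pi>. prime p" "finite E" "prime_factors n \<subseteq> E"
  shows "pi_part \<pi> n = (\<Prod>p\<in>E \<inter> \<pi>. p ^ multiplicity p n)"
  unfolding pi_part_def using assms
  by (intro prod.mono_neutral_left) (auto simp: prime_factors_multiplicity)

lemma pi_part_mult:
  assumes "\<forall>p\<in>\<pi>. prime p" "n > 0" "m > 0"
  shows "pi_part \<pi> (n * m) = pi_part \<pi> n * pi_part \<pi> m"
proof -
  let ?E = "prime_factors (n * m)"
  have E: "prime_factors n \<subseteq> ?E" "prime_factors m \<subseteq> ?E"
    using assms by (auto simp: in_prime_factors_iff)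
  have "pi_part \<pi> (n * m) = (\<Prod>p\<in>?E \<inter> \<pi>. p ^ multiplicity p n * p ^ multiplicity p m)"
    unfolding pi_part_def using assms
    by (intro prod.cong refl) (simp add: prime_elem_multiplicity_mult_distrib power_add)
  also have "\<dots> = pi_part \<pi> n * pi_part \<pi> m"
    using assms E by (simp add: pi_part_eq_prod[of _ ?E] prod.distrib del: prime_factors_product)
  finally show ?thesis .
qed

lemma pi_part_pos: "pi_part \<pi> n > 0"
  unfolding pi_part_def by (intro prod_pos) (auto simp: in_prime_factors_iff prime_gt_0_nat)

text \<open>The complementary factor of \<open>n\<^sub>\<pi>\<close> in \<open>n\<close> can only be \<open>1\<close>.\<close>

lemma pi_part_ge_imp_prime_factors:
  assumes n: "n > 0" and ge: "pi_part \<pi> n \<ge> n"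
  shows "pi_part \<pi> n = n" and "prime_factors n \<subseteq> \<pi>"
proof -
  let ?r = "\<Prod>p\<in>prime_factors n - \<pi>. p ^ multiplicity p n"
  have "n = (\<Prod>p\<in>prime_factors n. p ^ multiplicity p n)"
    using n by (simp add: prime_factorization_nat)
  also have "\<dots> = pi_part \<pi> n * ?r"
    unfolding pi_part_def by (subst prod.union_disjoint[symmetric]) (auto intro!: prod.cong)
  finally have eq: "n = pi_part \<pi> n * ?r" .
  have "?r > 0" by (intro prod_pos) (auto simp: in_prime_factors_iff prime_gt_0_nat)
  moreover have "pi_part \<pi> n * ?r \<le> pi_part \<pi> n * 1" using eq ge by simp
  then have "?r \<le> 1" using pi_part_pos[of \<pi> n] by (simp only: mult_le_cancel1)
  ultimately have r: "?r = 1" by (intro le_antisym) (simp_all only: One_nat_def Suc_le_eq)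
  then show "pi_part \<pi> n = n" using eq by simp
  have "prime_factors n - \<pi> = {}"
  proof (rule ccontr)
    assume "prime_factors n - \<pi> \<noteq> {}"
    then obtain p where p: "p \<in> prime_factors n - \<pi>" by blast
    have "p ^ multiplicity p n dvd ?r" using p by (intro dvd_prodI) auto
    then have "p ^ multiplicity p n = 1" using r by simp
    then show False using p by (auto simp: prime_factors_multiplicity)
  qed
  then show "prime_factors n \<subseteq> \<pi>" by blast
qed

locale pi_torsion = comm_group A for A :: "'a monoid" +
  fixes \<pi> :: "nat set"
  assumes primes: "\<forall>p\<in>\<pi>. prime p"
    and torsion_card: "\<And>n. n > 0 \<Longrightarrow> card (torsion A n) = pi_part \<pi> n"
begin

lemma finite_torsion: "n > 0 \<Longrightarrow> finite (torsion A n)"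
  using torsion_card[of n] pi_part_pos[of \<pi> n] by (metis card.infinite less_irrefl)

text \<open>A counting argument: the \<open>m\<close>-th power maps the group of \<open>nm\<close>-torsion, of order \<open>n\<^sub>\<pi> m\<^sub>\<pi>\<close>, into the
  \<open>n\<close>-torsion, of order \<open>n\<^sub>\<pi>\<close>. Its fibers are translates of subsets of the \<open>m\<close>-torsion, of order \<open>m\<^sub>\<pi>\<close>, so it
  must be surjective.\<close>

lemma torsion_root:
  assumes n: "n > 0" and m: "m > 0" and a: "a \<in> torsion A n"
  shows "\<exists>b\<in>torsion A (n * m). b [^]\<^bsub>A\<^esub> m = a"
proof -
  let ?T = "torsion A (n * m)" and ?f = "\<lambda>b. b [^]\<^bsub>A\<^esub> m"
  have T: "finite ?T" "card ?T = pi_part \<pi> n * pi_part \<pi> m"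
    using finite_torsion[of "n * m"] torsion_card[of "n * m"] n m by (simp_all add: pi_part_mult[OF primes])
  have im: "?f ` ?T \<subseteq> torsion A n"
    by (auto simp: torsion_def nat_pow_pow mult.commute)
  define s where "s = inv_into ?T ?f"
  have s: "s (?f b) \<in> ?T" "?f (s (?f b)) = ?f b" if "b \<in> ?T" for b
  proof -
    have "?f b \<in> ?f ` ?T" using that by blast
    then show "s (?f b) \<in> ?T" "?f (s (?f b)) = ?f b"
      unfolding s_def by (rule inv_into_into, rule f_inv_into_f)
  qed
  let ?g = "\<lambda>b. (?f b, inv\<^bsub>A\<^esub> (s (?f b)) \<otimes>\<^bsub>A\<^esub> b)"
  have "inj_on ?g ?T"
  proof (rule inj_onI)
    fix b c assume b: "b \<in> ?T" "c \<in> ?T" "?g b = ?g c"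
    then have *: "?f b = ?f c" "inv\<^bsub>A\<^esub> (s (?f b)) \<otimes>\<^bsub>A\<^esub> b = inv\<^bsub>A\<^esub> (s (?f c)) \<otimes>\<^bsub>A\<^esub> c"
      unfolding prod.inject by blast+
    have "inv\<^bsub>A\<^esub> (s (?f b)) \<otimes>\<^bsub>A\<^esub> b = inv\<^bsub>A\<^esub> (s (?f b)) \<otimes>\<^bsub>A\<^esub> c" using *(2) unfolding *(1) .
    then show "b = c" using b s[OF b(1)] by (auto simp: torsion_def)
  qed
  moreover have "?g ` ?T \<subseteq> ?f ` ?T \<times> torsion A m"
  proof
    fix z assume "z \<in> ?g ` ?T"
    then obtain b where b: "b \<in> ?T" "z = ?g b" by blast
    have "inv\<^bsub>A\<^esub> (s (?f b)) \<otimes>\<^bsub>A\<^esub> b \<in> torsion A m"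
      using s[OF b(1)] b(1) by (auto simp: torsion_def nat_pow_distrib nat_pow_inv)
    then show "z \<in> ?f ` ?T \<times> torsion A m" using b by blast
  qed
  ultimately have "card ?T \<le> card (?f ` ?T \<times> torsion A m)"
    using T(1) finite_torsion[OF m] by (intro card_inj_on_le) auto
  then have "pi_part \<pi> n * pi_part \<pi> m \<le> card (?f ` ?T) * pi_part \<pi> m"
    by (simp add: T(2) card_cartesian_product torsion_card[OF m])
  then have "card (torsion A n) \<le> card (?f ` ?T)"
    using pi_part_pos[of \<pi> m] torsion_card[OF n] by simp
  then have "?f ` ?T = torsion A n" using card_seteq[OF finite_torsion[OF n] im] by simp
  then show ?thesis using a by (metis imageE)
qed

end

section \<open>Factoring through a smaller group\<close>

context invariant_pair
begin

abbreviation Q where "Q \<equiv> A \<times>\<times> G"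

sublocale Q: group Q by (intro DirProd_group A.is_group G.is_group)

lemma inv_Q: "a \<in> carrier A \<Longrightarrow> g \<in> carrier G \<Longrightarrow> inv\<^bsub>Q\<^esub> (a, g) = (inv\<^bsub>A\<^esub> a, inv\<^bsub>G\<^esub> g)"
  by (simp add: inv_DirProd A.is_group G.is_group)

lemma fst_hom: "fst \<in> hom Q A" and snd_hom: "snd \<in> hom Q G"
  by (auto simp: hom_def)

lemma pow_Q:
  assumes "a \<in> carrier A" "g \<in> carrier G"
  shows "(a, g) [^]\<^bsub>Q\<^esub> (i::int) = (a [^]\<^bsub>A\<^esub> i, g [^]\<^bsub>G\<^esub> i)"
proof -
  have "fst ((a, g) [^]\<^bsub>Q\<^esub> i) = a [^]\<^bsub>A\<^esub> i" "snd ((a, g) [^]\<^bsub>Q\<^esub> i) = g [^]\<^bsub>G\<^esub> i"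
    using assms hom_int_pow[OF fst_hom, of "(a, g)" i] hom_int_pow[OF snd_hom, of "(a, g)" i]
    by (simp_all add: Q.is_group A.is_group G.is_group)
  then show ?thesis by (metis prod.collapse)
qed

text \<open>The three ingredients of the extension problem: the graph of \<open>\<kappa>\<close>, the subgroup \<open>1 \<times> G'\<close>, and the group
  \<open>\<kappa>(K \<inter> G')\<close> modulo which \<open>\<kappa>\<close> can be extended.\<close>

definition graph_K where "graph_K = (\<lambda>x. (\<kappa> x, x)) ` K"

definition derived_Q where "derived_Q = {\<one>\<^bsub>A\<^esub>} \<times> derived G (carrier G)"

definition kappa_derived where "kappa_derived = \<kappa> ` (K \<inter> derived G (carrier G))"

lemma derived_carrier: "derived G (carrier G) \<subseteq> carrier G"
  by (rule G.derived_in_carrier) simp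

lemma subgroup_derived: "subgroup (derived G (carrier G)) G"
  by (rule G.derived_is_subgroup) simp

lemma subgroup_graph_K: "subgroup graph_K Q"
proof (rule Q.subgroupI)
  show "graph_K \<subseteq> carrier Q" by (auto simp: graph_K_def \<kappa>_closed K_carrier)
  show "graph_K \<noteq> {}" using K_closed(1) by (auto simp: graph_K_def)
  show "inv\<^bsub>Q\<^esub> u \<in> graph_K" if u: "u \<in> graph_K" for u
  proof -
    obtain x where x: "x \<in> K" "u = (\<kappa> x, x)" using u by (auto simp: graph_K_def)
    then have "inv\<^bsub>Q\<^esub> u = (\<kappa> (inv\<^bsub>G\<^esub> x), inv\<^bsub>G\<^esub> x)" by (simp add: inv_Q \<kappa>_closed K_carrier \<kappa>_inv)
    then show ?thesis unfolding graph_K_def using K_closed(3)[OF x(1)] by blast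
  qed
  show "u \<otimes>\<^bsub>Q\<^esub> v \<in> graph_K" if uv: "u \<in> graph_K" "v \<in> graph_K" for u v
  proof -
    obtain x y where xy: "x \<in> K" "u = (\<kappa> x, x)" "y \<in> K" "v = (\<kappa> y, y)" using uv by (auto simp: graph_K_def)
    then have "u \<otimes>\<^bsub>Q\<^esub> v = (\<kappa> (x \<otimes>\<^bsub>G\<^esub> y), x \<otimes>\<^bsub>G\<^esub> y)" by (simp add: \<kappa>_mult)
    then show ?thesis unfolding graph_K_def using K_closed(2)[OF xy(1,3)] by blast
  qed
qed

lemma subgroup_derived_Q: "subgroup derived_Q Q"
  unfolding derived_Q_def
  by (intro DirProd_subgroups A.is_group G.is_group A.triv_subgroup subgroup_derived)

text \<open>Conjugation changes an element of \<open>A \<times> G\<close> by a commutator, which lies in \<open>1 \<times> G'\<close>.\<close>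

lemma normal_if_derived:
  assumes E: "subgroup E Q" and d: "derived_Q \<subseteq> E"
  shows "normal E Q"
  unfolding Q.normal_inv_iff
proof (intro conjI ballI E)
  fix u v assume u: "u \<in> carrier Q" and v: "v \<in> E"
  obtain a g where u': "u = (a, g)" "a \<in> carrier A" "g \<in> carrier G" using u by auto
  obtain e y where v': "v = (e, y)" "e \<in> carrier A" "y \<in> carrier G" using subgroup.mem_carrier[OF E v] by (cases v) auto
  have "g \<otimes>\<^bsub>G\<^esub> y \<otimes>\<^bsub>G\<^esub> inv\<^bsub>G\<^esub> g \<otimes>\<^bsub>G\<^esub> inv\<^bsub>G\<^esub> y \<in> derived G (carrier G)"
    using u' v' unfolding derived_def by (intro generate.incl) auto
  then have "(\<one>\<^bsub>A\<^esub>, g \<otimes>\<^bsub>G\<^esub> y \<otimes>\<^bsub>G\<^esub> inv\<^bsub>G\<^esub> g \<otimes>\<^bsub>G\<^esub> inv\<^bsub>G\<^esub> y) \<in> E" using d by (auto simp: derived_Q_def)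
  then have "(\<one>\<^bsub>A\<^esub>, g \<otimes>\<^bsub>G\<^esub> y \<otimes>\<^bsub>G\<^esub> inv\<^bsub>G\<^esub> g \<otimes>\<^bsub>G\<^esub> inv\<^bsub>G\<^esub> y) \<otimes>\<^bsub>Q\<^esub> (e, y) \<in> E"
    using v v' subgroup.m_closed[OF E] by blast
  then show "u \<otimes>\<^bsub>Q\<^esub> v \<otimes>\<^bsub>Q\<^esub> inv\<^bsub>Q\<^esub> u \<in> E"
    using u' v' by (simp add: inv_Q G.m_assoc A.m_comm[of a e] A.m_assoc)
qed

text \<open>\<open>E\<close> is the graph of a homomorphism from a subgroup of \<open>G\<close> containing \<open>K G'\<close> to the torsion elements of \<open>A\<close>
  modulo \<open>\<kappa>(K \<inter> G')\<close>, which extends \<open>\<kappa>\<close> and is trivial on \<open>G'\<close>. Working with graphs avoids the quotient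
  groups of \<open>A\<close> and \<open>G\<close>.\<close>

definition extends_\<kappa> :: "('a \<times> 'g) set \<Rightarrow> bool" where
  "extends_\<kappa> E \<longleftrightarrow> subgroup E Q \<and> graph_K \<subseteq> E \<and> derived_Q \<subseteq> E \<and>
     (\<forall>a. (a, \<one>\<^bsub>G\<^esub>) \<in> E \<longrightarrow> a \<in> kappa_derived) \<and> (\<forall>u\<in>E. \<exists>n>0. fst u \<in> torsion A n)"

lemma mem_set_mult: "u \<in> E <#>\<^bsub>Q\<^esub> C \<longleftrightarrow> (\<exists>v\<in>E. \<exists>w\<in>C. u = v \<otimes>\<^bsub>Q\<^esub> w)"
  by (auto simp: set_mult_def)

lemma subset_set_mult:
  assumes E: "subgroup E Q" and C: "subgroup C Q"
  shows "E \<subseteq> E <#>\<^bsub>Q\<^esub> C" and "C \<subseteq> E <#>\<^bsub>Q\<^esub> C"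
proof -
  have "u \<in> E <#>\<^bsub>Q\<^esub> C" if u: "u \<in> E" for u
    unfolding mem_set_mult using Q.r_one[OF subgroup.mem_carrier[OF E u], symmetric]
    by (intro bexI[OF _ u] bexI[OF _ subgroup.one_closed[OF C]])
  then show "E \<subseteq> E <#>\<^bsub>Q\<^esub> C" by blast
  have "u \<in> E <#>\<^bsub>Q\<^esub> C" if u: "u \<in> C" for u
    unfolding mem_set_mult using Q.l_one[OF subgroup.mem_carrier[OF C u], symmetric]
    by (intro bexI[OF _ subgroup.one_closed[OF E]] bexI[OF _ u])
  then show "C \<subseteq> E <#>\<^bsub>Q\<^esub> C" by blast
qed

text \<open>On \<open>G' K\<close> the assignment \<open>d x \<mapsto> \<kappa>(x)\<close> is well defined modulo \<open>\<kappa>(K \<inter> G')\<close>.\<close>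

lemma extends_\<kappa>_base:
  assumes fin: "finite (carrier G)"
  shows "extends_\<kappa> (derived_Q <#>\<^bsub>Q\<^esub> graph_K)"
proof -
  have "subgroup (derived_Q <#>\<^bsub>Q\<^esub> graph_K) Q"
    by (intro Q.mult_norm_subgroup normal_if_derived subgroup_derived_Q order_refl subgroup_graph_K)
  moreover note subset_set_mult[OF subgroup_derived_Q subgroup_graph_K]
  moreover have mem: "\<exists>d\<in>derived G (carrier G). \<exists>x\<in>K. u = (\<kappa> x, d \<otimes>\<^bsub>G\<^esub> x)"
    if "u \<in> derived_Q <#>\<^bsub>Q\<^esub> graph_K" for u
    using that unfolding mem_set_mult by (force simp: derived_Q_def graph_K_def \<kappa>_closed)
  have "a \<in> kappa_derived" if a: "(a, \<one>\<^bsub>G\<^esub>) \<in> derived_Q <#>\<^bsub>Q\<^esub> graph_K" for a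
  proof -
    obtain d x where d: "d \<in> derived G (carrier G)" "x \<in> K" "a = \<kappa> x" "\<one>\<^bsub>G\<^esub> = d \<otimes>\<^bsub>G\<^esub> x"
      using mem[OF a] by auto
    have "inv\<^bsub>G\<^esub> d = x" using d derived_carrier K_carrier by (metis G.inv_comm G.inv_equality subsetD)
    then have "x \<in> derived G (carrier G)" using subgroup.m_inv_closed[OF subgroup_derived d(1)] by simp
    then show ?thesis using d by (auto simp: kappa_derived_def)
  qed
  moreover have "\<exists>n>0. fst u \<in> torsion A n" if u: "u \<in> derived_Q <#>\<^bsub>Q\<^esub> graph_K" for u
  proof -
    obtain x where x: "x \<in> K" "fst u = \<kappa> x" using mem[OF u] by auto
    have "\<kappa> x [^]\<^bsub>A\<^esub> order G = \<one>\<^bsub>A\<^esub>"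
      using \<kappa>_pow[OF x(1), of "order G"] G.pow_order_eq_1[OF K_carrier[OF x(1)]] by (simp add: \<kappa>_one)
    then show ?thesis using G.order_gt_0_iff_finite fin x by (auto simp: torsion_def \<kappa>_closed)
  qed
  ultimately show ?thesis unfolding extends_\<kappa>_def by blast
qed

text \<open>The usual extension to one more element \<open>x\<close>: with \<open>m\<close> the order of \<open>x\<close> modulo the current domain, the
  image of \<open>x\<close> has to be an \<open>m\<close>-th root \<open>b\<close> of the image of \<open>x^m\<close>. Since \<open>E\<close> is normal, its product with the
  cyclic group of \<open>(b, x)\<close> is again a subgroup, and it acquires no new elements over \<open>1 \<in> G\<close> because a power
  of \<open>x\<close> in the domain is a power of \<open>x^m\<close>.\<close>

lemma extends_\<kappa>_step:
  assumes fin: "finite (carrier G)"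
    and root: "\<And>a n m. \<lbrakk>n > 0; m > 0; a \<in> torsion A n\<rbrakk> \<Longrightarrow> \<exists>b\<in>torsion A (n * m). b [^]\<^bsub>A\<^esub> m = a"
    and E: "extends_\<kappa> E" and x: "x \<in> carrier G" "x \<notin> snd ` E"
  shows "\<exists>E'. extends_\<kappa> E' \<and> snd ` E \<subset> snd ` E'"
proof -
  have sub: "subgroup E Q" and d: "derived_Q \<subseteq> E"
    and AE: "\<And>a. (a, \<one>\<^bsub>G\<^esub>) \<in> E \<Longrightarrow> a \<in> kappa_derived" and tors: "\<And>u. u \<in> E \<Longrightarrow> \<exists>n>0. fst u \<in> torsion A n"
    using E by (auto simp: extends_\<kappa>_def)
  have Ec: "u \<in> carrier Q" if "u \<in> E" for u using subgroup.mem_carrier[OF sub that] .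
  let ?Y = "snd ` E"
  have Y: "subgroup ?Y G"
    using group_hom.subgroup_img_is_subgroup[OF _ sub, of G snd] Q.is_group G.is_group snd_hom
    by (simp add: group_hom_def group_hom_axioms_def)
  define m where "m = (LEAST n::nat. n > 0 \<and> x [^]\<^bsub>G\<^esub> n \<in> ?Y)"
  have "order G > 0 \<and> x [^]\<^bsub>G\<^esub> order G \<in> ?Y"
    using G.pow_order_eq_1[OF x(1)] subgroup.one_closed[OF Y] G.order_gt_0_iff_finite fin by simp
  then have "m > 0 \<and> x [^]\<^bsub>G\<^esub> m \<in> ?Y" 
    unfolding m_def by (rule LeastI)
  then have m: "m > 0" "x [^]\<^bsub>G\<^esub> m \<in> ?Y" by simp_all
  have m_dvd: "int m dvd i" if i: "x [^]\<^bsub>G\<^esub> i \<in> ?Y" for i :: int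
  proof -
    have "x [^]\<^bsub>G\<^esub> (i mod int m) = x [^]\<^bsub>G\<^esub> i \<otimes>\<^bsub>G\<^esub> inv\<^bsub>G\<^esub> ((x [^]\<^bsub>G\<^esub> int m) [^]\<^bsub>G\<^esub> (i div int m))"
      using x(1) by (simp add: G.int_pow_pow G.int_pow_diff[symmetric] minus_mult_div_eq_mod)
    also have "\<dots> \<in> ?Y"
    proof -
      have "x [^]\<^bsub>G\<^esub> int m \<in> ?Y" using m(2) by (simp add: int_pow_int)
      then have "(x [^]\<^bsub>G\<^esub> int m) [^]\<^bsub>G\<^esub> (i div int m) \<in> ?Y" by (rule G.subgroup_int_pow_closed[OF Y])
      then show ?thesis by (intro subgroup.m_closed[OF Y i] subgroup.m_inv_closed[OF Y])
    qed
    finally have "x [^]\<^bsub>G\<^esub> nat (i mod int m) \<in> ?Y"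
      using m(1) by (simp add: int_pow_int[symmetric])
    moreover have "nat (i mod int m) < m" using m(1) by (simp add: nat_less_iff)
    then have "\<not> (nat (i mod int m) > 0 \<and> x [^]\<^bsub>G\<^esub> nat (i mod int m) \<in> ?Y)"
      unfolding m_def by (rule not_less_Least)
    ultimately have "nat (i mod int m) = 0" by simp
    then have "i mod int m \<le> 0" by simp
    moreover have "i mod int m \<ge> 0" using m(1) by simp
    ultimately show ?thesis by (simp only: dvd_eq_mod_eq_0 order_antisym)
  qed
  obtain c where c: "(c, x [^]\<^bsub>G\<^esub> m) \<in> E" using m(2) by auto
  obtain n where n: "n > 0" "c \<in> torsion A n" using tors[OF c] by auto
  obtain b where b: "b \<in> torsion A (n * m)" "b [^]\<^bsub>A\<^esub> m = c" using root[OF n(1) m(1) n(2)] by blast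
  have bA: "b \<in> carrier A" using b by (simp add: torsion_def)
  let ?u = "(b, x)"
  have u: "?u \<in> carrier Q" using bA x by simp
  have pow_E: "?u [^]\<^bsub>Q\<^esub> i \<in> E" if "x [^]\<^bsub>G\<^esub> i \<in> ?Y" for i :: int
  proof -
    obtain j where j: "i = int m * j" using m_dvd[OF \<open>x [^]\<^bsub>G\<^esub> i \<in> ?Y\<close>] by blast
    have "?u [^]\<^bsub>Q\<^esub> int m = (c, x [^]\<^bsub>G\<^esub> m)"
      unfolding pow_Q[OF bA x(1)] by (simp add: int_pow_int b(2))
    then have "?u [^]\<^bsub>Q\<^esub> i = (c, x [^]\<^bsub>G\<^esub> m) [^]\<^bsub>Q\<^esub> j" using u by (simp add: j Q.int_pow_pow[symmetric])
    then show ?thesis using c by (simp add: Q.subgroup_int_pow_closed[OF sub])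
  qed
  let ?C = "generate Q {?u}"
  have C: "subgroup ?C Q" using u by (intro Q.generate_is_subgroup) simp
  have C_iff: "v \<in> ?C \<longleftrightarrow> (\<exists>i::int. v = ?u [^]\<^bsub>Q\<^esub> i)" for v using Q.generate_pow[OF u] by blast
  let ?E = "E <#>\<^bsub>Q\<^esub> ?C"
  have sub': "subgroup ?E Q" by (intro Q.mult_norm_subgroup normal_if_derived sub d C)
  have E_sub: "E \<subseteq> ?E" and "?u \<in> ?E"
    using subset_set_mult[OF sub C] generate.incl[of ?u "{?u}" Q] by auto
  have "a \<in> kappa_derived" if a: "(a, \<one>\<^bsub>G\<^esub>) \<in> ?E" for a
  proof -
    obtain v i where v: "v \<in> E" "(a, \<one>\<^bsub>G\<^esub>) = v \<otimes>\<^bsub>Q\<^esub> ?u [^]\<^bsub>Q\<^esub> (i::int)"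
    proof -
      obtain v w where "v \<in> E" "w \<in> ?C" "(a, \<one>\<^bsub>G\<^esub>) = v \<otimes>\<^bsub>Q\<^esub> w" using a unfolding mem_set_mult by blast
      then show ?thesis using that C_iff[of w] by blast
    qed
    obtain e y where ey: "v = (e, y)" "e \<in> carrier A" "y \<in> carrier G" using Ec[OF v(1)] by (cases v) auto
    have xi: "x [^]\<^bsub>G\<^esub> i \<in> carrier G" using x(1) by simp
    have "\<one>\<^bsub>G\<^esub> = y \<otimes>\<^bsub>G\<^esub> x [^]\<^bsub>G\<^esub> i" using v(2) ey by (simp add: pow_Q[OF bA x(1)])
    then have "inv\<^bsub>G\<^esub> y = x [^]\<^bsub>G\<^esub> i" using ey(3) xi by (metis G.inv_comm G.inv_equality)
    moreover have "inv\<^bsub>G\<^esub> y \<in> ?Y" using v(1) ey by (intro subgroup.m_inv_closed[OF Y]) force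
    ultimately have "?u [^]\<^bsub>Q\<^esub> i \<in> E" using pow_E by simp
    then have "(a, \<one>\<^bsub>G\<^esub>) \<in> E" using v subgroup.m_closed[OF sub] by simp
    then show ?thesis by (rule AE)
  qed
  moreover have "\<exists>k>0. fst w \<in> torsion A k" if w: "w \<in> ?E" for w
  proof -
    obtain v i where v: "v \<in> E" "w = v \<otimes>\<^bsub>Q\<^esub> ?u [^]\<^bsub>Q\<^esub> (i::int)"
    proof -
      obtain v c where "v \<in> E" "c \<in> ?C" "w = v \<otimes>\<^bsub>Q\<^esub> c" using w unfolding mem_set_mult by blast
      then show ?thesis using that C_iff[of c] by blast
    qed
    obtain e y where ey: "v = (e, y)" "e \<in> carrier A" "y \<in> carrier G" using Ec[OF v(1)] by (cases v) auto
    obtain k where k: "k > 0" "e \<in> torsion A k" using tors[OF v(1)] ey by auto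
    have 1: "e [^]\<^bsub>A\<^esub> (k * (n * m)) = \<one>\<^bsub>A\<^esub>"
      using k ey by (simp add: torsion_def A.nat_pow_pow[symmetric])
    have "(b [^]\<^bsub>A\<^esub> i) [^]\<^bsub>A\<^esub> (k * (n * m)) = (b [^]\<^bsub>A\<^esub> (n * m)) [^]\<^bsub>A\<^esub> (i * int k)"
      using bA by (simp add: int_pow_int[symmetric] A.int_pow_pow mult_ac)
    also have "\<dots> = \<one>\<^bsub>A\<^esub>" using b(1) by (simp add: torsion_def)
    finally have "(e \<otimes>\<^bsub>A\<^esub> b [^]\<^bsub>A\<^esub> i) [^]\<^bsub>A\<^esub> (k * (n * m)) = \<one>\<^bsub>A\<^esub>"
      using 1 bA ey by (simp add: A.nat_pow_distrib)
    then show ?thesis using v ey bA k(1) n(1) m(1)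
      by (intro exI[of _ "k * (n * m)"]) (simp add: pow_Q[OF bA x(1)] torsion_def)
  qed
  ultimately have "extends_\<kappa> ?E" using sub' E_sub E unfolding extends_\<kappa>_def by blast
  moreover have "snd ` E \<subset> snd ` ?E"
    using E_sub \<open>?u \<in> ?E\<close> x(2) by force
  ultimately show ?thesis by blast
qed

text \<open>A partial extension whose domain has the largest possible order is defined on all of \<open>G\<close>.\<close>

lemma ex_extension:
  assumes fin: "finite (carrier G)"
    and root: "\<And>a n m. \<lbrakk>n > 0; m > 0; a \<in> torsion A n\<rbrakk> \<Longrightarrow> \<exists>b\<in>torsion A (n * m). b [^]\<^bsub>A\<^esub> m = a"
  shows "\<exists>E. extends_\<kappa> E \<and> snd ` E = carrier G"
proof -
  have snd_sub: "snd ` E \<subseteq> carrier G" if "extends_\<kappa> E" for E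
    using that subgroup.subset[of E Q] by (auto simp: extends_\<kappa>_def)
  obtain E where E: "extends_\<kappa> E" and max: "\<And>E'. extends_\<kappa> E' \<Longrightarrow> card (snd ` E') \<le> card (snd ` E)"
    using ex_has_greatest_nat[of extends_\<kappa> _ "\<lambda>E. card (snd ` E)" "Suc (card (carrier G))"]
      extends_\<kappa>_base[OF fin] card_mono[OF fin snd_sub] by (metis le_imp_less_Suc)
  have "x \<in> snd ` E" if x: "x \<in> carrier G" for x
  proof (rule ccontr)
    assume "x \<notin> snd ` E"
    then obtain E' where E': "extends_\<kappa> E'" "snd ` E \<subset> snd ` E'"
      using extends_\<kappa>_step[OF fin root E x] by blast
    then have "card (snd ` E) < card (snd ` E')"
      using finite_subset[OF snd_sub[OF E'(1)] fin] by (intro psubset_card_mono)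
    then show False using max[OF E'(1)] by simp
  qed
  then show ?thesis using E snd_sub[OF E] by blast
qed

text \<open>The fibers of \<open>E \<rightarrow> G\<close> are cosets of a subgroup of \<open>\<kappa>(K \<inter> G')\<close>.\<close>

lemma card_extension_le:
  assumes fin: "finite (carrier G)" and E: "extends_\<kappa> E" "snd ` E = carrier G"
  shows "finite E" and "card E \<le> card kappa_derived * order G"
proof -
  have sub: "subgroup E Q" using E by (simp add: extends_\<kappa>_def)
  have Ec: "fst u \<in> carrier A" "snd u \<in> carrier G" if "u \<in> E" for u
    using subgroup.mem_carrier[OF sub that] by auto
  have "\<forall>g\<in>carrier G. \<exists>a. (a, g) \<in> E" using E(2) by force
  then obtain s where s: "\<And>g. g \<in> carrier G \<Longrightarrow> (s g, g) \<in> E" by metis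
  let ?f = "\<lambda>(a, g). (a \<otimes>\<^bsub>A\<^esub> inv\<^bsub>A\<^esub> s g, g)"
  have inj: "inj_on ?f E"
  proof (rule inj_onI)
    fix u v assume uv: "u \<in> E" "v \<in> E" "?f u = ?f v"
    obtain a b g where "u = (a, g)" "v = (b, g)" using uv by (cases u; cases v) auto
    then show "u = v" using uv Ec[of u] Ec[of v] Ec(1)[OF s[of g]] by simp
  qed
  have im: "?f ` E \<subseteq> kappa_derived \<times> carrier G"
  proof
    fix z assume "z \<in> ?f ` E"
    then obtain a g where z: "(a, g) \<in> E" "z = (a \<otimes>\<^bsub>A\<^esub> inv\<^bsub>A\<^esub> s g, g)" by auto
    have g: "g \<in> carrier G" using Ec[OF z(1)] by simp
    have "(a, g) \<otimes>\<^bsub>Q\<^esub> inv\<^bsub>Q\<^esub> (s g, g) \<in> E"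
      by (intro subgroup.m_closed[OF sub] subgroup.m_inv_closed[OF sub] z s g)
    then have "(a \<otimes>\<^bsub>A\<^esub> inv\<^bsub>A\<^esub> s g, \<one>\<^bsub>G\<^esub>) \<in> E" using g Ec(1)[OF s[OF g]] by (simp add: inv_Q)
    then show "z \<in> kappa_derived \<times> carrier G" using E(1) g z by (auto simp: extends_\<kappa>_def)
  qed
  have "finite K" using fin subgroup.subset[OF K] finite_subset by blast
  then have fin': "finite (kappa_derived \<times> carrier G)" using fin by (simp add: kappa_derived_def)
  show "finite E" using finite_imageD[OF finite_subset[OF im fin'] inj] .
  show "card E \<le> card kappa_derived * order G"
    using card_inj_on_le[OF inj im fin'] by (simp add: card_cartesian_product order_def)
qed

text \<open>The group \<open>H\<close> is \<open>E\<close> modulo the graph of \<open>\<kappa>\<close>, relabelled by natural numbers, and \<open>q\<close> is the projection. The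
  graph is normal because \<open>\<kappa>\<close> is invariant under conjugation.\<close>

lemma ex_small_quotient:
  assumes fin: "finite (carrier G)" and E: "extends_\<kappa> E" "snd ` E = carrier G"
  shows "\<exists>(H :: nat monoid) q. group H \<and> finite (carrier H) \<and> q ` E = carrier H \<and> q \<in> hom (Q\<lparr>carrier := E\<rparr>) H \<and>
     (\<forall>u\<in>E. \<forall>v\<in>E. q u = q v \<longleftrightarrow> u \<otimes>\<^bsub>Q\<^esub> inv\<^bsub>Q\<^esub> v \<in> graph_K) \<and> order H * card K \<le> card kappa_derived * order G"
proof -
  have sub: "subgroup E Q" and gE: "graph_K \<subseteq> E" using E by (simp_all add: extends_\<kappa>_def)
  let ?E = "Q\<lparr>carrier := E\<rparr>"
  interpret E: group ?E by (rule subgroup.subgroup_is_group[OF sub Q.is_group])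
  have inv_E: "inv\<^bsub>?E\<^esub> u = inv\<^bsub>Q\<^esub> u" if "u \<in> E" for u
    using that sub by (simp add: Q.m_inv_consistent)
  have sub': "subgroup graph_K ?E" by (rule Q.subgroup_incl[OF subgroup_graph_K sub gE])
  have norm: "normal graph_K ?E"
    unfolding E.normal_inv_iff
  proof (intro conjI ballI sub')
    fix u v assume u: "u \<in> carrier ?E" and v: "v \<in> graph_K"
    obtain a g where ag: "u = (a, g)" "a \<in> carrier A" "g \<in> carrier G" using u subgroup.mem_carrier[OF sub] by (cases u) auto
    obtain x where x: "x \<in> K" "v = (\<kappa> x, x)" using v by (auto simp: graph_K_def)
    have "u \<otimes>\<^bsub>Q\<^esub> v \<otimes>\<^bsub>Q\<^esub> inv\<^bsub>Q\<^esub> u = (\<kappa> (g \<otimes>\<^bsub>G\<^esub> x \<otimes>\<^bsub>G\<^esub> inv\<^bsub>G\<^esub> g), g \<otimes>\<^bsub>G\<^esub> x \<otimes>\<^bsub>G\<^esub> inv\<^bsub>G\<^esub> g)"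
      using ag x by (simp add: inv_Q invariant A.m_comm[of a] A.m_assoc \<kappa>_closed)
    then have "u \<otimes>\<^bsub>Q\<^esub> v \<otimes>\<^bsub>Q\<^esub> inv\<^bsub>Q\<^esub> u \<in> graph_K"
      using K_conj[OF ag(3) x(1)] by (simp add: graph_K_def)
    then show "u \<otimes>\<^bsub>?E\<^esub> v \<otimes>\<^bsub>?E\<^esub> inv\<^bsub>?E\<^esub> u \<in> graph_K" using u inv_E by simp
  qed
  have finE: "finite E" by (rule card_extension_le[OF fin E])
  let ?C = "rcosets\<^bsub>?E\<^esub> graph_K"
  have "finite ?C" using finE by (simp add: RCOSETS_def)
  then obtain idx :: "('a \<times> 'g) set \<Rightarrow> nat" where idx: "inj_on idx ?C" using finite_imp_inj_to_nat_seg by metis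
  define q where "q u = idx (graph_K #>\<^bsub>?E\<^esub> u)" for u
  have q_iff: "q u = q v \<longleftrightarrow> u \<otimes>\<^bsub>?E\<^esub> inv\<^bsub>?E\<^esub> v \<in> graph_K" if "u \<in> carrier ?E" "v \<in> carrier ?E" for u v
  proof -
    have "q u = q v \<longleftrightarrow> graph_K #>\<^bsub>?E\<^esub> u = graph_K #>\<^bsub>?E\<^esub> v"
      unfolding q_def using that inj_on_eq_iff[OF idx] by (auto simp: RCOSETS_def)
    also have "\<dots> \<longleftrightarrow> u \<in> graph_K #>\<^bsub>?E\<^esub> v"
      using that E.repr_independence[OF _ _ sub'] E.rcos_self[OF _ sub'] by metis
    also have "\<dots> \<longleftrightarrow> u \<otimes>\<^bsub>?E\<^esub> inv\<^bsub>?E\<^esub> v \<in> graph_K"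
      by (rule subgroup.rcos_module[OF sub' E.is_group that(2,1)])
    finally show ?thesis .
  qed
  have weak: "weak_group_morphism q graph_K ?E"
    by (rule weak_group_morphismsI[OF norm q_iff])
  let ?H = "image_group q ?E"
  have cH: "carrier ?H = q ` E" by (simp add: image_group_carrier)
  have "q ` E = idx ` ?C" by (auto simp: q_def RCOSETS_def)
  then have "order ?H = card ?C" using card_image[OF idx] by (simp add: order_def cH)
  moreover have "card ?C * card graph_K = card E"
    using E.lagrange[OF sub'] by (simp add: order_def)
  moreover have "card graph_K = card K"
    unfolding graph_K_def by (rule card_image) (simp add: inj_on_def)
  ultimately have "order ?H * card K \<le> card kappa_derived * order G"
    using card_extension_le(2)[OF fin E] by simp
  moreover have "q u = q v \<longleftrightarrow> u \<otimes>\<^bsub>Q\<^esub> inv\<^bsub>Q\<^esub> v \<in> graph_K" if "u \<in> E" "v \<in> E" for u v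
    using q_iff[of u v] that inv_E by simp
  ultimately show ?thesis
    using E.image_group_is_group[OF weak] E.weak_group_morphism_is_hom[OF weak] finE cH
    by (intro exI[of _ ?H] exI[of _ q]) simp
qed

text \<open>In \<open>A \<times> G \<times> H\<close> and \<open>A \<times> H \<times> G\<close> take the graphs of \<open>q\<close>, the first with inverted \<open>A\<close>-component. The elements
  \<open>((a b)\<^sup>-\<^sup>1, g)\<close> and \<open>(b\<^sup>-\<^sup>1, g')\<close> of \<open>E\<close> have the same image under \<open>q\<close> iff \<open>(a\<^sup>-\<^sup>1, g g'\<^sup>-\<^sup>1)\<close> is in the graph of \<open>\<kappa>\<close>, which
  is the condition for \<open>(a, g, g')\<close> to lie in the stabilizer \<open>S\<close>.\<close>

lemma e_elem_in_ideal:
  assumes fin: "finite (carrier G)" and small: "card kappa_derived < card K"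
    and root: "\<And>a n m. \<lbrakk>n > 0; m > 0; a \<in> torsion A n\<rbrakk> \<Longrightarrow> \<exists>b\<in>torsion A (n * m). b [^]\<^bsub>A\<^esub> m = a"
  shows "(e_elem A G K \<kappa> :: (_ \<Rightarrow>\<^sub>0 'k::comm_ring_1) set) \<in> fb_ideal A G"
proof -
  obtain E where E: "extends_\<kappa> E" "snd ` E = carrier G" using ex_extension[OF fin root] by blast
  have sub: "subgroup E Q" and gE: "graph_K \<subseteq> E" using E by (simp_all add: extends_\<kappa>_def)
  have Ec: "a \<in> carrier A" "g \<in> carrier G" if "(a, g) \<in> E" for a g
    using subgroup.mem_carrier[OF sub that] by auto
  obtain H :: "nat monoid" and q where H: "group H" "finite (carrier H)" and q: "q ` E = carrier H" "q \<in> hom (Q\<lparr>carrier := E\<rparr>) H"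
    and q_iff: "\<And>u v. \<lbrakk>u \<in> E; v \<in> E\<rbrakk> \<Longrightarrow> q u = q v \<longleftrightarrow> u \<otimes>\<^bsub>Q\<^esub> inv\<^bsub>Q\<^esub> v \<in> graph_K"
    and card: "order H * card K \<le> card kappa_derived * order G"
    using ex_small_quotient[OF fin E] by blast
  have "order H < order G"
  proof (rule ccontr)
    assume "\<not> order H < order G"
    then have "order G * card K \<le> card kappa_derived * order G"
      using card by (meson le_trans mult_le_mono1 not_le)
    moreover have "order G > 0" using fin G.order_gt_0_iff_finite by simp
    ultimately show False using small by simp
  qed
  interpret GHG: fiber_groups3 A G H G
    by (intro fiber_groups3.intro fiber_groups.intro A.comm_group_axioms G.group_axioms H(1))
  interpret q: group_hom "Q\<lparr>carrier := E\<rparr>" H q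
    using q(2) subgroup.subgroup_is_group[OF sub Q.is_group] H(1) by (simp add: group_hom_def group_hom_axioms_def)
  have q_mult: "q (a \<otimes>\<^bsub>A\<^esub> b, g \<otimes>\<^bsub>G\<^esub> h) = q (a, g) \<otimes>\<^bsub>H\<^esub> q (b, h)" if "(a, g) \<in> E" "(b, h) \<in> E" for a b g h
    using q.hom_mult[of "(a, g)" "(b, h)"] that by simp
  have q_inv: "q (inv\<^bsub>A\<^esub> a, inv\<^bsub>G\<^esub> g) = inv\<^bsub>H\<^esub> q (a, g)" if "(a, g) \<in> E" for a g
    using q.hom_inv[of "(a, g)"] that Ec[OF that] sub by (simp add: Q.m_inv_consistent inv_Q)
  have q_one: "q (\<one>\<^bsub>A\<^esub>, \<one>\<^bsub>G\<^esub>) = \<one>\<^bsub>H\<^esub>" using q.hom_one by simp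
  have q_closed: "q (a, g) \<in> carrier H" if "(a, g) \<in> E" for a g using that q(1) by blast
  have E_mult: "(a \<otimes>\<^bsub>A\<^esub> b, g \<otimes>\<^bsub>G\<^esub> h) \<in> E" if "(a, g) \<in> E" "(b, h) \<in> E" for a b g h
    using subgroup.m_closed[OF sub that] by simp
  have E_inv: "(inv\<^bsub>A\<^esub> a, inv\<^bsub>G\<^esub> g) \<in> E" if "(a, g) \<in> E" for a g
    using subgroup.m_inv_closed[OF sub that] Ec[OF that] by (simp add: inv_Q)
  have E_one: "(\<one>\<^bsub>A\<^esub>, \<one>\<^bsub>G\<^esub>) \<in> E" using subgroup.one_closed[OF sub] by simp
  define V where "V = {(a, q (a, g), g) | a g. (a, g) \<in> E}"
  define U where "U = {(inv\<^bsub>A\<^esub> a, g, q (a, g)) | a g. (a, g) \<in> E}"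
  have V_iff: "(a, h, g) \<in> V \<longleftrightarrow> (a, g) \<in> E \<and> h = q (a, g)" for a h g by (auto simp: V_def)
  have U_iff: "(a, g, h) \<in> U \<longleftrightarrow> (inv\<^bsub>A\<^esub> a, g) \<in> E \<and> h = q (inv\<^bsub>A\<^esub> a, g)" if "a \<in> carrier A" for a g h
    using that unfolding U_def by (auto simp: Ec intro!: exI[of _ "inv\<^bsub>A\<^esub> a"])
  have V: "subgroup V GHG.HI.P"
  proof (rule GHG.HI.P.subgroupI)
    show "V \<subseteq> carrier GHG.HI.P" by (auto simp: V_def Ec q_closed)
    show "V \<noteq> {}" using E_one by (auto simp: V_def)
    show "inv\<^bsub>GHG.HI.P\<^esub> u \<in> V" if "u \<in> V" for u
      using that by (auto simp: V_def Ec q_closed GHG.HI.inv_P q_inv intro: E_inv)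
    show "u \<otimes>\<^bsub>GHG.HI.P\<^esub> v \<in> V" if "u \<in> V" "v \<in> V" for u v
      using that by (auto simp: V_def q_mult intro: E_mult)
  qed
  have U: "subgroup U GHG.P"
  proof (rule GHG.P.subgroupI)
    show "U \<subseteq> carrier GHG.P" by (auto simp: U_def Ec q_closed)
    show "U \<noteq> {}" using E_one by (auto simp: U_def)
    show "inv\<^bsub>GHG.P\<^esub> u \<in> U" if "u \<in> U" for u
    proof -
      obtain a g where "(a, g) \<in> E" "u = (inv\<^bsub>A\<^esub> a, g, q (a, g))" using \<open>u \<in> U\<close> by (auto simp: U_def)
      then show ?thesis by (auto simp: U_def Ec q_closed GHG.inv_P q_inv intro!: exI[of _ "inv\<^bsub>A\<^esub> a"] E_inv)
    qed
    show "u \<otimes>\<^bsub>GHG.P\<^esub> v \<in> U" if "u \<in> U" "v \<in> U" for u v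
    proof -
      obtain a g b h where "(a, g) \<in> E" "u = (inv\<^bsub>A\<^esub> a, g, q (a, g))" "(b, h) \<in> E" "v = (inv\<^bsub>A\<^esub> b, h, q (b, h))"
        using \<open>u \<in> U\<close> \<open>v \<in> U\<close> by (auto simp: U_def)
      then show ?thesis by (auto simp: U_def Ec q_mult A.inv_mult intro!: exI[of _ "a \<otimes>\<^bsub>A\<^esub> b"] E_mult)
    qed
  qed
  have q_one_iff: "a = \<one>\<^bsub>A\<^esub>" if "(a, \<one>\<^bsub>G\<^esub>) \<in> E" "q (a, \<one>\<^bsub>G\<^esub>) = \<one>\<^bsub>H\<^esub>" for a
  proof -
    have "q (a, \<one>\<^bsub>G\<^esub>) = q (\<one>\<^bsub>A\<^esub>, \<one>\<^bsub>G\<^esub>)" using that q_one by simp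
    then have "(a, \<one>\<^bsub>G\<^esub>) \<in> graph_K" using q_iff[OF that(1) E_one] Ec[OF that(1)] by (simp add: inv_Q)
    then show ?thesis by (auto simp: graph_K_def \<kappa>_one)
  qed
  have V1: "a = \<one>\<^bsub>A\<^esub>" if "(a, \<one>\<^bsub>H\<^esub>, \<one>\<^bsub>G\<^esub>) \<in> V" for a
    using that q_one_iff[of a] by (simp add: V_iff)
  have U1: "a = \<one>\<^bsub>A\<^esub>" if "(a, \<one>\<^bsub>G\<^esub>, \<one>\<^bsub>H\<^esub>) \<in> U" for a
  proof -
    have a: "a \<in> carrier A" using subgroup.mem_carrier[OF U that] by simp
    then have "inv\<^bsub>A\<^esub> a = \<one>\<^bsub>A\<^esub>" using that q_one_iff[of "inv\<^bsub>A\<^esub> a"] by (simp add: U_iff)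
    then show ?thesis using a by (metis A.inv_inv A.inv_one)
  qed
  obtain X \<alpha> where X: "coset_biset GHG.P U = (X, \<alpha>)" by (cases "coset_biset GHG.P U")
  obtain Y \<beta> where Y: "coset_biset GHG.HI.P V = (Y, \<beta>)" by (cases "coset_biset GHG.HI.P V")
  have fX: "fibered_biset A G H (X, \<alpha>)" using GHG.fibered_coset_biset[OF U U1 fin H(2)] by (simp add: X)
  have fY: "fibered_biset A H G (Y, \<beta>)" using GHG.HI.fibered_coset_biset[OF V V1 H(2) fin] by (simp add: Y)
  note bX = GHG.coset_biset_base[OF U, unfolded X fst_conv snd_conv]
  note bY = GHG.HI.coset_biset_base[OF V, unfolded Y fst_conv snd_conv]
  have sX: "\<alpha> (a, g, h) U = U \<longleftrightarrow> (a, g, h) \<in> U" if "a \<in> carrier A" "g \<in> carrier G" "h \<in> carrier H" for a g h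
    using bX(2) that by (auto simp: stabilizer_def)
  have sY: "\<beta> (a, h, g) V = V \<longleftrightarrow> (a, h, g) \<in> V" if "a \<in> carrier A" "h \<in> carrier H" "g \<in> carrier G" for a g h
    using bY(2) that by (auto simp: stabilizer_def)
  have "fb_iso A G G (coset_biset GG.P S) (fb_tensor A G H G (X, \<alpha>) (Y, \<beta>))"
  proof (rule GHG.tensor_coset_iso[OF fX fY bX(1,3) bY(1,3) _ subgroup_S])
    fix h assume "h \<in> carrier H"
    then obtain a g where ag: "(a, g) \<in> E" "h = q (a, g)" using q(1) by force
    then have "(inv\<^bsub>A\<^esub> a, g, h) \<in> U" by (auto simp: U_def)
    then show "\<exists>a\<in>carrier A. \<exists>g\<in>carrier G. \<alpha> (a, g, h) U = U"
      using ag Ec[OF ag(1)] by (intro bexI[of _ "inv\<^bsub>A\<^esub> a"] bexI[of _ g]) (simp_all add: sX q_closed)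
  next
    fix a assume "(a, \<one>\<^bsub>G\<^esub>, \<one>\<^bsub>G\<^esub>) \<in> S"
    then show "a = \<one>\<^bsub>A\<^esub>" by (simp add: mem_S \<kappa>_one)
  next
    fix a g g' assume a: "a \<in> carrier A" and g: "g \<in> carrier G" "g' \<in> carrier G"
    have quot: "(inv\<^bsub>A\<^esub> (a \<otimes>\<^bsub>A\<^esub> b), g) \<otimes>\<^bsub>Q\<^esub> inv\<^bsub>Q\<^esub> (inv\<^bsub>A\<^esub> b, g') = (inv\<^bsub>A\<^esub> a, g \<otimes>\<^bsub>G\<^esub> inv\<^bsub>G\<^esub> g')" if b: "b \<in> carrier A" for b
      using a b g by (simp add: inv_Q A.inv_mult A.m_assoc)
    have S_graph: "(a, g, g') \<in> S \<longleftrightarrow> (inv\<^bsub>A\<^esub> a, g \<otimes>\<^bsub>G\<^esub> inv\<^bsub>G\<^esub> g') \<in> graph_K"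
    proof -
      have "a = inv\<^bsub>A\<^esub> c \<longleftrightarrow> inv\<^bsub>A\<^esub> a = c" if "c \<in> carrier A" for c using a that by auto
      then show ?thesis using g by (auto simp: mem_S graph_K_def \<kappa>_closed)
    qed
    show "(a, g, g') \<in> S \<longleftrightarrow> (\<exists>b\<in>carrier A. \<exists>h\<in>carrier H. \<alpha> (a \<otimes>\<^bsub>A\<^esub> b, g, h) U = U \<and> \<beta> (inv\<^bsub>A\<^esub> b, h, g') V = V)"
    proof
      assume S: "(a, g, g') \<in> S"
      obtain c where c: "(c, g') \<in> E" using E(2) g(2) by force
      have cA: "c \<in> carrier A" using Ec[OF c] by simp
      let ?b = "inv\<^bsub>A\<^esub> c"
      have "(inv\<^bsub>A\<^esub> a \<otimes>\<^bsub>A\<^esub> c, g \<otimes>\<^bsub>G\<^esub> inv\<^bsub>G\<^esub> g' \<otimes>\<^bsub>G\<^esub> g') \<in> E" using S S_graph gE c by (intro E_mult) auto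
      then have E1: "(inv\<^bsub>A\<^esub> (a \<otimes>\<^bsub>A\<^esub> ?b), g) \<in> E" using a cA g by (simp add: A.inv_mult G.m_assoc)
      have E2: "(inv\<^bsub>A\<^esub> ?b, g') \<in> E" using c cA by simp
      have "q (inv\<^bsub>A\<^esub> (a \<otimes>\<^bsub>A\<^esub> ?b), g) = q (inv\<^bsub>A\<^esub> ?b, g')"
        unfolding q_iff[OF E1 E2] quot[OF A.inv_closed[OF cA]] using S S_graph by simp
      then show "\<exists>b\<in>carrier A. \<exists>h\<in>carrier H. \<alpha> (a \<otimes>\<^bsub>A\<^esub> b, g, h) U = U \<and> \<beta> (inv\<^bsub>A\<^esub> b, h, g') V = V"
        using a g cA E1 E2 q_closed[OF E2]
        by (intro bexI[of _ ?b] bexI[of _ "q (inv\<^bsub>A\<^esub> ?b, g')"]) (simp_all add: sX sY U_iff V_iff)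
    next
      assume "\<exists>b\<in>carrier A. \<exists>h\<in>carrier H. \<alpha> (a \<otimes>\<^bsub>A\<^esub> b, g, h) U = U \<and> \<beta> (inv\<^bsub>A\<^esub> b, h, g') V = V"
      then obtain b h where b: "b \<in> carrier A" "h \<in> carrier H" "\<alpha> (a \<otimes>\<^bsub>A\<^esub> b, g, h) U = U" "\<beta> (inv\<^bsub>A\<^esub> b, h, g') V = V"
        by blast
      then have E1: "(inv\<^bsub>A\<^esub> (a \<otimes>\<^bsub>A\<^esub> b), g) \<in> E" and E2: "(inv\<^bsub>A\<^esub> b, g') \<in> E"
        and eq: "q (inv\<^bsub>A\<^esub> (a \<otimes>\<^bsub>A\<^esub> b), g) = q (inv\<^bsub>A\<^esub> b, g')"
        using a g by (simp_all add: sX sY U_iff V_iff)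
      show "(a, g, g') \<in> S" using eq unfolding q_iff[OF E1 E2] quot[OF b(1)] S_graph .
    qed
  qed
  then have "e_elem A G K \<kappa> = (fb_elem A G G (fb_tensor A G H G (X, \<alpha>) (Y, \<beta>)) :: (_ \<Rightarrow>\<^sub>0 'k) set)"
    unfolding e_elem_eq by (rule GG.fb_elem_eqI[OF fibered_S[OF fin]])
  also have "\<dots> = fb_comp A G H G (fb_elem A G H (X, \<alpha>)) (fb_elem A H G (Y, \<beta>))"
    by (rule GHG.fb_comp_elem[OF fX fY, symmetric])
  also have "\<dots> \<in> fb_ideal A G"
    using H \<open>order H < order G\<close> GHG.fb_elem_in_module[OF fX] GHG.HI.fb_elem_in_module[OF fY]
    by (intro fb_ideal.prod)
  finally show ?thesis .
qed

end

section \<open>The characterization\<close>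

context invariant_pair
begin

lemma K_central:
  assumes "inj_on \<kappa> K"
  shows "K \<subseteq> group_center G"
proof
  fix x assume x: "x \<in> K"
  have "g \<otimes>\<^bsub>G\<^esub> x = x \<otimes>\<^bsub>G\<^esub> g" if g: "g \<in> carrier G" for g
  proof -
    have "g \<otimes>\<^bsub>G\<^esub> x \<otimes>\<^bsub>G\<^esub> inv\<^bsub>G\<^esub> g = x"
      using inj_onD[OF assms invariant[OF g x] K_conj[OF g x] x] .
    then show ?thesis using g x K_carrier[OF x] by (metis G.inv_solve_right G.inv_closed G.inv_inv G.m_closed)
  qed
  then show "x \<in> group_center G" using K_carrier[OF x] by (auto simp: group_center_def)
qed

text \<open>For \<open>n = |K|\<close> the image \<open>\<kappa>(K)\<close> has \<open>n\<close> elements and lies in the \<open>n\<close>-torsion of \<open>A\<close>, which has \<open>n\<^sub>\<pi> \<le> n\<close>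
  elements. So the two agree, and \<open>K\<close> inherits cyclicity from the torsion group.\<close>

lemma K_cyclic_pi:
  assumes fin: "finite (carrier G)" and inj: "inj_on \<kappa> K"
    and tors: "\<And>n. n > 0 \<Longrightarrow> cyclic_group (A\<lparr>carrier := torsion A n\<rparr>) \<and> card (torsion A n) = pi_part \<pi> n"
  shows "cyclic_group (G\<lparr>carrier := K\<rparr>)" and "pi_subgroup \<pi> K G"
proof -
  let ?n = "card K"
  interpret K: group "G\<lparr>carrier := K\<rparr>" by (rule subgroup.subgroup_is_group[OF K G.is_group])
  have finK: "finite K" using fin subgroup.subset[OF K] finite_subset by blast
  have n: "?n > 0" using finK K_closed(1) by (auto simp: card_gt_0_iff)
  have "\<kappa> x \<in> torsion A ?n" if x: "x \<in> K" for x
  proof -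
    have "x [^]\<^bsub>G\<^esub> ?n = \<one>\<^bsub>G\<^esub>"
      using K.pow_order_eq_1[of x] G.nat_pow_consistent[of x "card K" K] x by (simp add: order_def)
    then show ?thesis using \<kappa>_pow[OF x, of ?n] x by (simp add: torsion_def \<kappa>_one \<kappa>_closed)
  qed
  then have sub: "\<kappa> ` K \<subseteq> torsion A ?n" by blast
  have card_im: "card (\<kappa> ` K) = ?n" using inj by (rule card_image)
  have "card (torsion A ?n) = pi_part \<pi> ?n" using tors n by blast
  moreover have fin_t: "finite (torsion A ?n)"
    using calculation pi_part_pos[of \<pi> ?n] by (metis card.infinite less_irrefl)
  ultimately have ge: "?n \<le> pi_part \<pi> ?n" using card_mono[OF fin_t sub] card_im by simp
  show "pi_subgroup \<pi> K G"
    unfolding pi_subgroup_def using K finK pi_part_ge_imp_prime_factors(2)[OF n ge] by blast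
  have im: "\<kappa> ` K = torsion A ?n"
    using card_seteq[OF fin_t sub] card_im pi_part_ge_imp_prime_factors(1)[OF n ge] tors n by simp
  have "\<kappa> \<in> iso (G\<lparr>carrier := K\<rparr>) (A\<lparr>carrier := torsion A ?n\<rparr>)"
    using inj im by (auto simp: iso_def hom_def bij_betw_def \<kappa>_mult)
  then have "G\<lparr>carrier := K\<rparr> \<cong> A\<lparr>carrier := torsion A ?n\<rparr>" by (auto simp: is_iso_def)
  moreover have "subgroup (torsion A ?n) A"
    by (rule A.subgroupI) (auto simp: torsion_def A.nat_pow_distrib A.nat_pow_inv intro!: exI[of _ "\<one>\<^bsub>A\<^esub>"])
  then have "group (A\<lparr>carrier := torsion A ?n\<rparr>)" by (rule subgroup.subgroup_is_group) (rule A.is_group)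
  moreover have "cyclic_group (A\<lparr>carrier := torsion A ?n\<rparr>)" using tors n by blast
  ultimately show "cyclic_group (G\<lparr>carrier := K\<rparr>)"
    using isomorphic_group_cyclicity K.is_group by blast
qed

text \<open>Both steps \<open>K \<supseteq> K \<inter> G' \<rightarrow> \<kappa>(K \<inter> G')\<close> can only lose elements; equality of orders excludes any loss.\<close>

lemma derived_faithful_if_card:
  assumes fin: "finite (carrier G)" and le: "card K \<le> card kappa_derived"
  shows "K \<subseteq> derived G (carrier G)" and "inj_on \<kappa> K"
proof -
  let ?D = "K \<inter> derived G (carrier G)"
  have finK: "finite K" using fin subgroup.subset[OF K] finite_subset by blast
  have "card kappa_derived \<le> card ?D"
    unfolding kappa_derived_def using finK by (intro card_image_le) simp
  then have D: "?D = K" using card_seteq[OF finK, of ?D] le by simp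
  then show "K \<subseteq> derived G (carrier G)" by blast
  have "card (\<kappa> ` K) = card K"
    using le card_image_le[OF finK, of \<kappa>] unfolding kappa_derived_def D by simp
  then show "inj_on \<kappa> K" using finK by (simp add: eq_card_imp_inj_on)
qed

end

theorem corollary10p13:
  fixes A :: "'a monoid" and G :: "'g monoid" and \<pi> :: "nat set"
    and k :: "'k::comm_ring_1 itself" and K :: "'g set" and \<kappa> :: "'g \<Rightarrow> 'a"
  assumes "comm_group A"
    and "\<forall>p\<in>\<pi>. prime p"
    and "\<forall>n::nat. n > 0 \<longrightarrow>
           cyclic_group (A\<lparr>carrier := torsion A n\<rparr>) \<and> card (torsion A n) = pi_part \<pi> n"
    and "group G" and "finite (carrier G)"
    and "(K, \<kappa>) \<in> invariant_char_pairs A G"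
  shows "reduced_pair k A G K \<kappa> \<longleftrightarrow>
    cyclic_group (G\<lparr>carrier := K\<rparr>) \<and> pi_subgroup \<pi> K G \<and>
    K \<subseteq> group_center G \<inter> derived G (carrier G) \<and> inj_on \<kappa> K"
proof -
  interpret invariant_pair A G K \<kappa>
    using assms(1,4,6)
    by (auto simp: invariant_char_pairs_def char_pairs_def invariant_pair_def invariant_pair_axioms_def)
  interpret pi_torsion A \<pi>
    using assms(1-3) by (simp add: pi_torsion_def pi_torsion_axioms_def)
  show ?thesis
  proof
    assume red: "reduced_pair k A G K \<kappa>"
    have "card K \<le> card kappa_derived"
    proof (rule ccontr)
      assume "\<not> card K \<le> card kappa_derived"
      then have "(e_elem A G K \<kappa> :: (_ \<Rightarrow>\<^sub>0 'k) set) \<in> fb_ideal A G"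
        by (intro e_elem_in_ideal[OF assms(5)] torsion_root) simp_all
      then show False using red by (simp add: reduced_pair_def)
    qed
    note * = derived_faithful_if_card[OF assms(5) this]
    show "cyclic_group (G\<lparr>carrier := K\<rparr>) \<and> pi_subgroup \<pi> K G \<and>
        K \<subseteq> group_center G \<inter> derived G (carrier G) \<and> inj_on \<kappa> K"
      using * K_central[OF *(2)] K_cyclic_pi[OF assms(5) *(2), of \<pi>] assms(3) by blast
  next
    assume "cyclic_group (G\<lparr>carrier := K\<rparr>) \<and> pi_subgroup \<pi> K G \<and>
        K \<subseteq> group_center G \<inter> derived G (carrier G) \<and> inj_on \<kappa> K"
    then show "reduced_pair k A G K \<kappa>" using reduced_if[OF assms(5)] by blast
  qed
qed

end
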